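(* Let $\kappa\in\{1,-1\}$ and let $\Phi_t$ be the flow on $X_5$ of $i\partial_tq=-\frac12\partial_x^2q+\kappa|q|^2q$. Let $q_0\in X_5$, $t\in\mathbb R$, and put $\mathcal H_0=\mathcal H_{\rm loc}(q_0)$, $\mathcal H_t=\mathcal H_{\rm loc}(\Phi_t(q_0))$. Let $F_t=\Phi_t:\mathcal H_0\to\mathcal H_t$ be the restricted flow, which is a homeomorphism intertwining translations. For a translation-invariant probability measure $\mu$ on $\mathcal H_0$, put $\mu_t=(F_t)_*\mu$. For each $z\in\mathbb C$, define $$\mathcal L_\mu(z)=\lim_{L\to\infty}\frac1L\int_{\mathcal H_0}\log\|\mathsf Y_p(L,0,z)\|\,d\mu(p).$$ This limit exists, and $$\mathcal L_{\mu_t}(z)=\mathcal L_\mu(z)$$ (with $\mathcal L_{\mu_t}$ defined by the same formula on $\mathcal H_t$).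
   Context: Choose a real, even $\chi\in C_c^\infty((-1,1))$ with $\sum_{k\in\mathbb Z}\chi(\xi-k)=1$; with $\widehat f(\xi)=\int e^{-ix\xi}f(x)\,dx$ put $\Box_kf=\mathcal F^{-1}(\chi(\xi-k)\widehat f(\xi))$. For $s\ge0$, $X_s=\{f\in\mathcal S'(\mathbb R):\|f\|_s:=\sum_k(1+k^2)^{s/2}\|\Box_kf\|_\infty<\infty\}$ (complex-valued). For every $q_0\in X_5$ the equation has a global classical solution $q\in C(\mathbb R;X_5)\cap C^1(\mathbb R;X_3)$, $q(0)=q_0$, unique among classical solutions $v$ with $v,v_x$ bounded on every strip $[-T,T]\times\mathbb R$, $T<\infty$; $\Phi_t(q_0)=q(t)$. With $(\mathcal T_yf)(x)=f(x+y)$, $\mathcal H_{\rm loc}(f)$ is the closure of $\{\mathcal T_yf:y\in\mathbb R\}$ in $C^4_{\rm loc}(\mathbb R)$; it is compact and contained in a bounded ball of $X_5$. Measures on it are Borel for the $C^4_{\rm loc}$ topology, and translation invariance means invariance under all $\mathcal T_y$. For a potential $p$, $\mathsf Y_p(x,y,z)$ is the transfer matrix: $\partial_x\mathsf Y_p=\bigl(-iz\sigma_3+i\sigma_3\begin{pmatrix}0&p(x)\\\kappa\overline{p(x)}&0\end{pmatrix}\bigr)\mathsf Y_p$, $\mathsf Y_p(y,y,z)=I$, with $\sigma_3=\operatorname{diag}(1,-1)$. Matrix norms are Euclidean operator norms. *)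

theory Defs
  imports "HOL-Probability.Probability"
begin

definition vderiv :: "nat \<Rightarrow> (real \<Rightarrow> 'a::real_normed_vector) \<Rightarrow> real \<Rightarrow> 'a" where
  "vderiv j f = ((\<lambda>g x. vector_derivative g (at x)) ^^ j) f"

definition Ck_fun :: "nat \<Rightarrow> (real \<Rightarrow> 'a::real_normed_vector) \<Rightarrow> bool" where
  "Ck_fun k f \<longleftrightarrow>
     (\<forall>j<k. \<forall>x. vderiv j f differentiable (at x)) \<and> continuous_on UNIV (vderiv k f)"

definition smooth_fun :: "(real \<Rightarrow> 'a::real_normed_vector) \<Rightarrow> bool" where
  "smooth_fun f \<longleftrightarrow> (\<forall>k. Ck_fun k f)"

definition schwartz :: "(real \<Rightarrow> complex) set" where
  "schwartz = {\<phi>. smooth_fun \<phi> \<and>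
     (\<forall>m n. bounded (range (\<lambda>x. (x ^ m) *\<^sub>R vderiv n \<phi> x)))}"

text \<open>
  Distributions are functionals on all functions of which only the values on Schwartz
  functions matter; they are never compared outside the Schwartz space.
\<close>

definition tempered :: "((real \<Rightarrow> complex) \<Rightarrow> complex) \<Rightarrow> bool" where
  "tempered u \<longleftrightarrow>
     (\<forall>\<phi>\<in>schwartz. \<forall>\<psi>\<in>schwartz. u (\<lambda>x. \<phi> x + \<psi> x) = u \<phi> + u \<psi>) \<and>
     (\<forall>c. \<forall>\<phi>\<in>schwartz. u (\<lambda>x. c * \<phi> x) = c * u \<phi>) \<and>
     (\<exists>C N. \<forall>\<phi>\<in>schwartz.
        norm (u \<phi>) \<le> C * (\<Sum>m\<le>N. \<Sum>n\<le>N. SUP x. norm ((x ^ m) *\<^sub>R vderiv n \<phi> x)))"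

definition reg_dist :: "(real \<Rightarrow> complex) \<Rightarrow> (real \<Rightarrow> complex) \<Rightarrow> complex" where
  "reg_dist f \<phi> = (LINT x|lborel. f x * \<phi> x)"

definition represents :: "(real \<Rightarrow> complex) \<Rightarrow> ((real \<Rightarrow> complex) \<Rightarrow> complex) \<Rightarrow> bool" where
  "represents f u \<longleftrightarrow>
     (\<forall>\<phi>\<in>schwartz. integrable lborel (\<lambda>x. f x * \<phi> x) \<and> u \<phi> = reg_dist f \<phi>)"

definition fourier :: "(real \<Rightarrow> complex) \<Rightarrow> real \<Rightarrow> complex" where
  "fourier \<phi> \<xi> = (LINT x|lborel. exp (- \<i> * complex_of_real (x * \<xi>)) * \<phi> x)"

definition inv_fourier :: "(real \<Rightarrow> complex) \<Rightarrow> real \<Rightarrow> complex" where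
  "inv_fourier \<phi> x =
     (LINT \<xi>|lborel. exp (\<i> * complex_of_real (x * \<xi>)) * \<phi> \<xi>) / complex_of_real (2 * pi)"

definition fourier_dist :: "((real \<Rightarrow> complex) \<Rightarrow> complex) \<Rightarrow> (real \<Rightarrow> complex) \<Rightarrow> complex" where
  "fourier_dist u \<phi> = u (fourier \<phi>)"

definition inv_fourier_dist :: "((real \<Rightarrow> complex) \<Rightarrow> complex) \<Rightarrow> (real \<Rightarrow> complex) \<Rightarrow> complex" where
  "inv_fourier_dist u \<phi> = u (inv_fourier \<phi>)"

definition mult_dist ::
  "(real \<Rightarrow> complex) \<Rightarrow> ((real \<Rightarrow> complex) \<Rightarrow> complex) \<Rightarrow> (real \<Rightarrow> complex) \<Rightarrow> complex" where
  "mult_dist a u \<phi> = u (\<lambda>x. a x * \<phi> x)"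

text \<open>The \<open>L\<^sup>\<infinity>\<close> norm of a distribution; it is \<open>\<infinity>\<close> unless a bounded function represents it.\<close>

definition Linf_dist :: "((real \<Rightarrow> complex) \<Rightarrow> complex) \<Rightarrow> ennreal" where
  "Linf_dist u =
     (INF g\<in>{g \<in> borel_measurable lborel. represents g u}.
        esssup lborel (\<lambda>x. ennreal (norm (g x))))"

definition unit_partition :: "(real \<Rightarrow> real) \<Rightarrow> bool" where
  "unit_partition \<eta> \<longleftrightarrow>
     smooth_fun \<eta> \<and> closure {\<xi>. \<eta> \<xi> \<noteq> 0} \<subseteq> {-1<..<1} \<and> (\<forall>\<xi>. \<eta> (- \<xi>) = \<eta> \<xi>) \<and>
     (\<forall>\<xi>. ((\<lambda>k::int. \<eta> (\<xi> - of_int k)) has_sum 1) UNIV)"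

definition box ::
  "(real \<Rightarrow> real) \<Rightarrow> int \<Rightarrow> ((real \<Rightarrow> complex) \<Rightarrow> complex) \<Rightarrow> (real \<Rightarrow> complex) \<Rightarrow> complex" where
  "box \<eta> k u =
     inv_fourier_dist (mult_dist (\<lambda>\<xi>. complex_of_real (\<eta> (\<xi> - of_int k))) (fourier_dist u))"

definition mod_norm :: "(real \<Rightarrow> real) \<Rightarrow> real \<Rightarrow> ((real \<Rightarrow> complex) \<Rightarrow> complex) \<Rightarrow> ennreal" where
  "mod_norm \<eta> s u =
     (\<Sum>\<^sub>\<infinity>k\<in>(UNIV::int set).
        ennreal ((1 + (of_int k)\<^sup>2) powr (s / 2)) * Linf_dist (box \<eta> k u))"

definition mod_dist :: "(real \<Rightarrow> real) \<Rightarrow> real \<Rightarrow> ((real \<Rightarrow> complex) \<Rightarrow> complex) set" where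
  "mod_dist \<eta> s = {u. tempered u \<and> mod_norm \<eta> s u < \<infinity>}"

text \<open>
  For \<open>s \<ge> 0\<close> the series of the frequency blocks of an element of the space converges
  uniformly, so each such distribution is given by a unique continuous function. We work
  with these continuous representatives.
\<close>

definition mod_space :: "(real \<Rightarrow> real) \<Rightarrow> real \<Rightarrow> (real \<Rightarrow> complex) set" where
  "mod_space \<eta> s = {f. continuous_on UNIV f \<and> (\<exists>u\<in>mod_dist \<eta> s. represents f u)}"

definition mod_fnorm :: "(real \<Rightarrow> real) \<Rightarrow> real \<Rightarrow> (real \<Rightarrow> complex) \<Rightarrow> ennreal" where
  "mod_fnorm \<eta> s f = mod_norm \<eta> s (reg_dist f)"

definition continuous_into_mod ::
  "(real \<Rightarrow> real) \<Rightarrow> real \<Rightarrow> (real \<Rightarrow> real \<Rightarrow> complex) \<Rightarrow> bool" where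
  "continuous_into_mod \<eta> s q \<longleftrightarrow>
     (\<forall>t. q t \<in> mod_space \<eta> s) \<and>
     (\<forall>t. ((\<lambda>t'. mod_fnorm \<eta> s (\<lambda>x. q t' x - q t x)) \<longlongrightarrow> 0) (at t))"

definition C1_into_mod ::
  "(real \<Rightarrow> real) \<Rightarrow> real \<Rightarrow> (real \<Rightarrow> real \<Rightarrow> complex) \<Rightarrow> bool" where
  "C1_into_mod \<eta> s q \<longleftrightarrow>
     (\<forall>t. q t \<in> mod_space \<eta> s) \<and>
     (\<exists>q'. continuous_into_mod \<eta> s q' \<and>
        (\<forall>t. ((\<lambda>h. mod_fnorm \<eta> s (\<lambda>x. (q (t + h) x - q t x) / complex_of_real h - q' t x))
               \<longlongrightarrow> 0) (at 0)))"

definition classical_nls_solution :: "real \<Rightarrow> (real \<Rightarrow> real \<Rightarrow> complex) \<Rightarrow> bool" where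
  "classical_nls_solution \<kappa> v \<longleftrightarrow>
     (\<exists>vt vx vxx.
        continuous_on UNIV (\<lambda>(t, x). vt t x) \<and>
        continuous_on UNIV (\<lambda>(t, x). vx t x) \<and>
        continuous_on UNIV (\<lambda>(t, x). vxx t x) \<and>
        (\<forall>t x. ((\<lambda>s. v s x) has_vector_derivative vt t x) (at t) \<and>
               (v t has_vector_derivative vx t x) (at x) \<and>
               (vx t has_vector_derivative vxx t x) (at x) \<and>
               \<i> * vt t x =
                 - (1 / 2) * vxx t x + complex_of_real (\<kappa> * (norm (v t x))\<^sup>2) * v t x))"

definition bounded_on_strips :: "(real \<Rightarrow> real \<Rightarrow> complex) \<Rightarrow> bool" where
  "bounded_on_strips w \<longleftrightarrow> (\<forall>T. bounded ((\<lambda>(t, x). w t x) ` ({-T..T} \<times> UNIV)))"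

text \<open>
  Well-posedness of the equation is part of being the flow. The values of \<open>\<Phi>\<close> on data
  outside the space of order 5 are arbitrary.
\<close>

definition nls_flow ::
  "(real \<Rightarrow> real) \<Rightarrow> real \<Rightarrow> (real \<Rightarrow> (real \<Rightarrow> complex) \<Rightarrow> real \<Rightarrow> complex) \<Rightarrow> bool" where
  "nls_flow \<eta> \<kappa> \<Phi> \<longleftrightarrow>
     (\<forall>q0\<in>mod_space \<eta> 5.
        classical_nls_solution \<kappa> (\<lambda>t. \<Phi> t q0) \<and>
        continuous_into_mod \<eta> 5 (\<lambda>t. \<Phi> t q0) \<and>
        C1_into_mod \<eta> 3 (\<lambda>t. \<Phi> t q0) \<and>
        \<Phi> 0 q0 = q0 \<and>
        (\<forall>v. classical_nls_solution \<kappa> v \<and> bounded_on_strips v \<and>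
             bounded_on_strips (\<lambda>t. vderiv 1 (v t)) \<and> v 0 = q0
             \<longrightarrow> (\<forall>t. v t = \<Phi> t q0)))"

definition Ck_loc_nhd ::
  "nat \<Rightarrow> (real \<Rightarrow> complex) \<Rightarrow> real \<Rightarrow> real \<Rightarrow> (real \<Rightarrow> complex) set" where
  "Ck_loc_nhd k f R \<epsilon> =
     {g. Ck_fun k g \<and> (\<forall>j\<le>k. \<forall>x\<in>{-R..R}. norm (vderiv j g x - vderiv j f x) < \<epsilon>)}"

definition Ck_loc_open :: "nat \<Rightarrow> (real \<Rightarrow> complex) set \<Rightarrow> bool" where
  "Ck_loc_open k U \<longleftrightarrow>
     U \<subseteq> Collect (Ck_fun k) \<and> (\<forall>f\<in>U. \<exists>R>0. \<exists>\<epsilon>>0. Ck_loc_nhd k f R \<epsilon> \<subseteq> U)"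

definition Ck_loc :: "nat \<Rightarrow> (real \<Rightarrow> complex) topology" where
  "Ck_loc k = topology (Ck_loc_open k)"

lemma Ck_loc_nhd_mono:
  assumes "R \<le> R'" "e' \<le> e"
  shows "Ck_loc_nhd k f R' e' \<subseteq> Ck_loc_nhd k f R e"
proof
  fix g assume g: "g \<in> Ck_loc_nhd k f R' e'"
  have "norm (vderiv j g x - vderiv j f x) < e" if "j \<le> k" "x \<in> {-R..R}" for j x
  proof -
    have "x \<in> {-R'..R'}" using that assms by simp
    then have "norm (vderiv j g x - vderiv j f x) < e'"
      using g that(1) by (simp add: Ck_loc_nhd_def)
    then show ?thesis using assms(2) by linarith
  qed
  then show "g \<in> Ck_loc_nhd k f R e" using g by (simp add: Ck_loc_nhd_def)
qed

lemma istopology_Ck_loc_open: "istopology (Ck_loc_open k)"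
  unfolding istopology_def
proof (intro conjI allI impI)
  fix S T assume S: "Ck_loc_open k S" and T: "Ck_loc_open k T"
  have "\<exists>R>0. \<exists>\<epsilon>>0. Ck_loc_nhd k f R \<epsilon> \<subseteq> S \<inter> T" if f: "f \<in> S \<inter> T" for f
  proof -
    from S f obtain R1 e1 where 1: "R1 > 0" "e1 > 0" "Ck_loc_nhd k f R1 e1 \<subseteq> S"
      unfolding Ck_loc_open_def by (meson IntD1)
    from T f obtain R2 e2 where 2: "R2 > 0" "e2 > 0" "Ck_loc_nhd k f R2 e2 \<subseteq> T"
      unfolding Ck_loc_open_def by (meson IntD2)
    have "Ck_loc_nhd k f (max R1 R2) (min e1 e2) \<subseteq> S"
      by (rule order_trans[OF Ck_loc_nhd_mono 1(3)]) auto
    moreover have "Ck_loc_nhd k f (max R1 R2) (min e1 e2) \<subseteq> T"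
      by (rule order_trans[OF Ck_loc_nhd_mono 2(3)]) auto
    ultimately show ?thesis
      using 1 2 by (intro exI[of _ "max R1 R2"] conjI exI[of _ "min e1 e2"] Int_greatest) auto
  qed
  moreover have "S \<inter> T \<subseteq> Collect (Ck_fun k)" using S unfolding Ck_loc_open_def by fast
  ultimately show "Ck_loc_open k (S \<inter> T)" unfolding Ck_loc_open_def by simp
next
  fix K assume K: "\<forall>S\<in>K. Ck_loc_open k S"
  have "\<exists>R>0. \<exists>\<epsilon>>0. Ck_loc_nhd k f R \<epsilon> \<subseteq> \<Union>K" if "f \<in> \<Union>K" for f
  proof -
    from that obtain S where S: "S \<in> K" "f \<in> S" by (rule UnionE)
    with K obtain R e where "R > 0" "e > 0" "Ck_loc_nhd k f R e \<subseteq> S"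
      unfolding Ck_loc_open_def by meson
    moreover have "S \<subseteq> \<Union>K" using S(1) by (rule Union_upper)
    ultimately show ?thesis by (meson order_trans)
  qed
  moreover have "\<Union>K \<subseteq> Collect (Ck_fun k)"
    using K unfolding Ck_loc_open_def by (intro Union_least) simp
  ultimately show "Ck_loc_open k (\<Union>K)" unfolding Ck_loc_open_def by simp
qed

lemma openin_Ck_loc: "openin (Ck_loc k) U \<longleftrightarrow> Ck_loc_open k U"
  by (simp add: Ck_loc_def istopology_Ck_loc_open topology_inverse')

lemma topspace_Ck_loc: "topspace (Ck_loc k) = Collect (Ck_fun k)"
proof
  show "topspace (Ck_loc k) \<subseteq> Collect (Ck_fun k)"
    unfolding topspace_def openin_Ck_loc Ck_loc_open_def by (rule Union_least) simp
  have "Ck_loc_open k (Collect (Ck_fun k))"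
    unfolding Ck_loc_open_def
    by (intro conjI order_refl ballI exI[of _ 1]) (simp_all add: Ck_loc_nhd_def Collect_mono)
  then show "Collect (Ck_fun k) \<subseteq> topspace (Ck_loc k)"
    by (intro openin_subset) (simp add: openin_Ck_loc)
qed

definition translate :: "real \<Rightarrow> (real \<Rightarrow> complex) \<Rightarrow> real \<Rightarrow> complex" where
  "translate y f = (\<lambda>x. f (x + y))"

definition hull_loc :: "(real \<Rightarrow> complex) \<Rightarrow> (real \<Rightarrow> complex) set" where
  "hull_loc f = Ck_loc 4 closure_of (range (\<lambda>y. translate y f))"

definition hull_top :: "(real \<Rightarrow> complex) \<Rightarrow> (real \<Rightarrow> complex) topology" where
  "hull_top f = subtopology (Ck_loc 4) (hull_loc f)"

definition borel_top :: "'a topology \<Rightarrow> 'a measure" where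
  "borel_top X = sigma (topspace X) {U. openin X U}"

definition invariant_prob :: "(real \<Rightarrow> complex) \<Rightarrow> (real \<Rightarrow> complex) measure \<Rightarrow> bool" where
  "invariant_prob f \<mu> \<longleftrightarrow>
     prob_space \<mu> \<and> sets \<mu> = sets (borel_top (hull_top f)) \<and>
     (\<forall>y. distr \<mu> \<mu> (translate y) = \<mu>)"

definition mat2 :: "complex \<Rightarrow> complex \<Rightarrow> complex \<Rightarrow> complex \<Rightarrow> complex^2^2" where
  "mat2 a b c d = vector [vector [a, b], vector [c, d]]"

definition sigma3 :: "complex^2^2" where
  "sigma3 = mat2 1 0 0 (-1)"

definition cscale :: "complex \<Rightarrow> complex^2^2 \<Rightarrow> complex^2^2" where
  "cscale c A = (\<chi> i j. c * A $ i $ j)"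

definition zs_matrix :: "real \<Rightarrow> (real \<Rightarrow> complex) \<Rightarrow> complex \<Rightarrow> real \<Rightarrow> complex^2^2" where
  "zs_matrix \<kappa> p z x =
     cscale (- \<i> * z) sigma3 +
     cscale \<i> (sigma3 ** mat2 0 (p x) (complex_of_real \<kappa> * cnj (p x)) 0)"

text \<open>For continuous \<open>p\<close> the linear initial value problem has exactly one global solution.\<close>

definition transfer ::
  "real \<Rightarrow> (real \<Rightarrow> complex) \<Rightarrow> real \<Rightarrow> real \<Rightarrow> complex \<Rightarrow> complex^2^2" where
  "transfer \<kappa> p x y z =
     (THE Y. (\<forall>s. (Y has_vector_derivative (zs_matrix \<kappa> p z s ** Y s)) (at s)) \<and>
             Y y = mat 1) x"

definition op_norm :: "complex^2^2 \<Rightarrow> real" where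
  "op_norm A = onorm (\<lambda>v. A *v v)"

definition mean_log ::
  "real \<Rightarrow> (real \<Rightarrow> complex) measure \<Rightarrow> complex \<Rightarrow> real \<Rightarrow> real" where
  "mean_log \<kappa> \<mu> z L = (1 / L) * (LINT p|\<mu>. ln (op_norm (transfer \<kappa> p L 0 z)))"

definition lyapunov :: "real \<Rightarrow> (real \<Rightarrow> complex) measure \<Rightarrow> complex \<Rightarrow> real" where
  "lyapunov \<kappa> \<mu> z = Lim at_top (mean_log \<kappa> \<mu> z)"

text \<open>
  Existence of the limit includes integrability, because the Bochner integral of a
  non-integrable function is 0 by convention.
\<close>

definition lyapunov_exists :: "real \<Rightarrow> (real \<Rightarrow> complex) measure \<Rightarrow> complex \<Rightarrow> bool" where
  "lyapunov_exists \<kappa> \<mu> z \<longleftrightarrow>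
     (\<forall>L>0. integrable \<mu> (\<lambda>p. ln (op_norm (transfer \<kappa> p L 0 z)))) \<and>
     (\<exists>l. (mean_log \<kappa> \<mu> z \<longlongrightarrow> l) at_top)"

end

theory Submission
  imports Defs "HOL-Complex_Analysis.Great_Picard"
begin

text \<open>
  The flow moves the transfer matrix by a bounded gauge. Zero curvature gives, for fixed \<open>L\<close>,
  the Lax equation \<open>\<partial>\<^sub>t Y = V(t, L) Y - Y V(t, 0)\<close> for \<open>Y = Y\<^bsub>q(t)\<^esub>(L, 0, z)\<close>, where \<open>V\<close> involves only
  \<open>q\<close> and \<open>q\<^sub>x\<close>. These are bounded on the hull uniformly for times between \<open>0\<close> and \<open>t\<close>, so
  \<open>log \<parallel>Y\<parallel>\<close> changes by an amount independent of \<open>L\<close>, and dividing by \<open>L\<close> leaves the limit unchanged.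
  The limit itself exists by subadditivity (cocycle property and invariance of the measure).

  That \<open>\<Phi>\<^sub>t\<close> is a homeomorphism of hulls is soft: elements of the space of order 5 have five bounded
  derivatives (Bernstein estimates on frequency blocks), so translates of one solution are relatively
  compact in space-time. Every limit is again a solution with bounded gradient, and uniqueness
  identifies it; the inverse is \<open>\<Phi>\<^bsub>-t\<^esub>\<close>.
\<close>

section \<open>Iterated derivatives and Schwartz functions\<close>

text \<open>The norm of order 5 is used through sup bounds on the derivatives up to order 5. Orders
  0 to 4 are those that \<open>Ck_loc 4\<close> sees; the fifth makes them equicontinuous in space.
  Continuity in time with values in the space gives equicontinuity in time and, since time intervals
  are compact, bounds uniform in time.

  The obstacle is that a limit of translates must lie in the space again before the uniqueness
  clause of \<open>nls_flow\<close> applies to it. It does because each frequency block of a bounded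
  function is a convolution with a Schwartz kernel: this commutes with translations and with bounded
  pointwise limits, so no block norm grows in the limit.

  Blocks are defined by duality, on functionals; Fourier inversion on Schwartz functions is what
  makes them add up to the distribution.

  Stability of the flow is obtained only along translates of \<open>q0\<close>; it reaches the other
  points of the hull because these are approximated by translates.\<close>

lemma vderiv_0 [simp]: "vderiv 0 f = f"
  by (simp add: vderiv_def)

lemma vderiv_Suc: "vderiv (Suc j) f x = vector_derivative (vderiv j f) (at x)"
  by (simp add: vderiv_def)

lemma vderiv_vderiv: "vderiv i (vderiv j f) = vderiv (i + j) f"
  by (simp add: vderiv_def funpow_add)

lemma vderiv_Suc_right: "vderiv (Suc j) f = vderiv j (vderiv (Suc 0) f)"
  by (simp add: vderiv_vderiv)

lemma vderiv_1_eqI: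
  "(\<And>x. (f has_vector_derivative f' x) (at x)) \<Longrightarrow> vderiv (Suc 0) f = f'"
  by (auto simp: vderiv_Suc fun_eq_iff intro: vector_derivative_at)

lemma Ck_fun_has_vderiv:
  "Ck_fun k f \<Longrightarrow> j < k \<Longrightarrow> (vderiv j f has_vector_derivative vderiv (Suc j) f x) (at x)"
  unfolding Ck_fun_def vderiv_Suc by (auto simp: vector_derivative_works[symmetric])

lemma Ck_fun_continuous: "Ck_fun k f \<Longrightarrow> j \<le> k \<Longrightarrow> continuous_on UNIV (vderiv j f)"
proof (cases "j = k")
  case False
  assume a: "Ck_fun k f" "j \<le> k"
  with False have "\<And>x. isCont (vderiv j f) x"
    by (auto intro!: differentiable_imp_continuous_within simp: Ck_fun_def)
  then show ?thesis by (simp add: continuous_at_imp_continuous_on)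
qed (auto simp: Ck_fun_def)

text \<open>Derivatives of a concrete function are found by giving the whole sequence
  \<open>D\<close> of candidates at once; sums, dilations, exponentials, Fourier transforms and
  convolutions are all treated this way.\<close>

lemma vderiv_eqI:
  assumes "\<And>x. D 0 x = f x" and "\<And>j x. j < k \<Longrightarrow> (D j has_vector_derivative D (Suc j) x) (at x)"
    and "j \<le> k"
  shows "vderiv j f = D j"
  using assms(3)
proof (induction j)
  case 0
  then show ?case using assms(1) by auto
next
  case (Suc j)
  then have eq: "vderiv j f = D j" by simp
  have "vderiv (Suc j) f x = D (Suc j) x" for x
    using assms(2)[of j x] Suc.prems by (simp add: vderiv_Suc eq vector_derivative_at)
  then show ?case by blast
qed

lemma Ck_funI:
  assumes "\<And>x. D 0 x = f x" and D: "\<And>j x. j < k \<Longrightarrow> (D j has_vector_derivative D (Suc j) x) (at x)"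
    and "continuous_on UNIV (D k)"
  shows "Ck_fun k f"
proof -
  have eq: "vderiv j f = D j" if "j \<le> k" for j
    using vderiv_eqI[where D = D and f = f and k = k] assms that by blast
  show ?thesis
    unfolding Ck_fun_def using D eq assms(3) by (auto intro: differentiableI_vector)
qed

lemma Ck_fun_mono: "Ck_fun k f \<Longrightarrow> l \<le> k \<Longrightarrow> Ck_fun l f"
  using Ck_fun_continuous[of k f l] by (auto simp: Ck_fun_def)

lemma Ck_fun_Suc:
  "Ck_fun (Suc k) f \<longleftrightarrow> (\<forall>x. f differentiable (at x)) \<and> Ck_fun k (vderiv (Suc 0) f)"
  unfolding Ck_fun_def vderiv_vderiv by (auto simp: less_Suc_eq_0_disj)

lemma Ck_fun_SucI:
  "(\<And>x. (f has_vector_derivative f' x) (at x)) \<Longrightarrow> Ck_fun k f' \<Longrightarrow> Ck_fun (Suc k) f"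
  using vderiv_1_eqI[of f f'] by (auto simp: Ck_fun_Suc intro: differentiableI_vector)

lemma Ck_fun_0: "Ck_fun 0 f \<longleftrightarrow> continuous_on UNIV f"
  by (simp add: Ck_fun_def)

lemma smooth_fun_has_vderiv:
  "smooth_fun f \<Longrightarrow> (vderiv j f has_vector_derivative vderiv (Suc j) f x) (at x)"
  using Ck_fun_has_vderiv[of "Suc j" f j] by (simp add: smooth_fun_def)

lemma smooth_fun_has_vderiv_0:
  "smooth_fun f \<Longrightarrow> (f has_vector_derivative vderiv (Suc 0) f x) (at x)"
  using smooth_fun_has_vderiv[of f 0] by simp

lemma smooth_fun_vderiv: "smooth_fun f \<Longrightarrow> smooth_fun (vderiv n f)"
proof (induction n arbitrary: f)
  case (Suc n)
  then have "smooth_fun (vderiv (Suc 0) f)"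
    unfolding smooth_fun_def using Ck_fun_Suc by blast
  with Suc.IH show ?case by (simp add: vderiv_Suc_right[of n])
qed simp

lemma smooth_fun_continuous: "smooth_fun f \<Longrightarrow> continuous_on A (vderiv n f)"
  using Ck_fun_continuous[of n f n] continuous_on_subset by (fastforce simp: smooth_fun_def)

lemma smooth_fun_continuous_0: "smooth_fun f \<Longrightarrow> continuous_on A f"
  using smooth_fun_continuous[of f A 0] by simp

lemma smooth_funI:
  assumes "\<And>x. D 0 x = f x" and "\<And>j x. (D j has_vector_derivative D (Suc j) x) (at x)"
  shows "smooth_fun f"
  unfolding smooth_fun_def
proof
  fix k
  have "continuous_on UNIV (D k)"
    using assms(2) by (meson continuous_at_imp_continuous_on has_vector_derivative_continuous)
  then show "Ck_fun k f" using assms by (intro Ck_funI[of D]) auto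
qed

lemma Ck_fun_add:
  "Ck_fun k f \<Longrightarrow> Ck_fun k g \<Longrightarrow> Ck_fun k (\<lambda>x. f x + g x)"
  "Ck_fun k f \<Longrightarrow> Ck_fun k g \<Longrightarrow> j \<le> k \<Longrightarrow>
     vderiv j (\<lambda>x. f x + g x) = (\<lambda>x. vderiv j f x + vderiv j g x)"
  by (rule Ck_funI[where D = "\<lambda>j x. vderiv j f x + vderiv j g x"])
    (auto intro!: derivative_eq_intros Ck_fun_has_vderiv continuous_intros Ck_fun_continuous
      vderiv_eqI[where D = "\<lambda>j x. vderiv j f x + vderiv j g x" and k = k])

lemma Ck_fun_linear:
  assumes "bounded_linear h" "Ck_fun k f"
  shows "Ck_fun k (\<lambda>x. h (f x))"
    and "j \<le> k \<Longrightarrow> vderiv j (\<lambda>x. h (f x)) = (\<lambda>x. h (vderiv j f x))"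
  using assms
  by (auto intro!: Ck_funI[where D = "\<lambda>j x. h (vderiv j f x)"] Ck_fun_has_vderiv
      vderiv_eqI[where D = "\<lambda>j x. h (vderiv j f x)" and k = k]
      bounded_linear.has_vector_derivative[OF assms(1)] Ck_fun_continuous
      bounded_linear.continuous_on[OF assms(1)])

lemma Ck_fun_diff:
  assumes "Ck_fun k f" "Ck_fun k g"
  shows "Ck_fun k (\<lambda>x. f x - g x)"
    and "j \<le> k \<Longrightarrow> vderiv j (\<lambda>x. f x - g x) = (\<lambda>x. vderiv j f x - vderiv j g x)"
  using assms Ck_fun_add[OF assms(1) Ck_fun_linear(1)[OF bounded_linear_minus[OF bounded_linear_ident] assms(2)]]
    Ck_fun_linear(2)[OF bounded_linear_minus[OF bounded_linear_ident] assms(2)]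
  by auto

lemma has_vector_derivative_affine:
  assumes "(f has_vector_derivative f') (at (a * x + c))"
  shows "((\<lambda>x. f (a * x + c)) has_vector_derivative a *\<^sub>R f') (at x)"
proof -
  have "((\<lambda>x. a * x + c) has_vector_derivative a) (at x)"
    by (auto intro!: derivative_eq_intros)
  from vector_diff_chain_at[OF this assms] show ?thesis by (simp add: o_def)
qed

lemma Ck_fun_affine:
  assumes "Ck_fun k f"
  shows "Ck_fun k (\<lambda>x. f (a * x + c))"
    and "j \<le> k \<Longrightarrow> vderiv j (\<lambda>x. f (a * x + c)) = (\<lambda>x. a ^ j *\<^sub>R vderiv j f (a * x + c))"
proof -
  have D: "((\<lambda>x. a ^ i *\<^sub>R vderiv i f (a * x + c)) has_vector_derivative
           a ^ Suc i *\<^sub>R vderiv (Suc i) f (a * x + c)) (at x)" if "i < k" for i x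
    using bounded_linear.has_vector_derivative[OF bounded_linear_scaleR_right
        has_vector_derivative_affine[OF Ck_fun_has_vderiv[OF assms that], where a = a and x = x and c = c],
        of "a ^ i"]
    by (simp add: mult.commute)
  have "continuous_on UNIV (\<lambda>x. a ^ k *\<^sub>R vderiv k f (a * x + c))"
    by (intro continuous_intros continuous_on_compose2[OF Ck_fun_continuous[OF assms order_refl]]) auto
  then show "Ck_fun k (\<lambda>x. f (a * x + c))"
    by (intro Ck_funI[where D = "\<lambda>j x. a ^ j *\<^sub>R vderiv j f (a * x + c)"] D) auto
  show "vderiv j (\<lambda>x. f (a * x + c)) = (\<lambda>x. a ^ j *\<^sub>R vderiv j f (a * x + c))" if "j \<le> k"
    by (rule vderiv_eqI[where D = "\<lambda>j x. a ^ j *\<^sub>R vderiv j f (a * x + c)" and k = k])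
      (use D that in auto)
qed

text \<open>Going through the first derivative of the product avoids the binomial sum of Leibniz's
  rule; the induction generalises over both factors because each of them gets
  differentiated.\<close>

lemma Ck_fun_mult:
  fixes f g :: "real \<Rightarrow> 'a::real_normed_algebra"
  shows "Ck_fun k f \<Longrightarrow> Ck_fun k g \<Longrightarrow> Ck_fun k (\<lambda>x. f x * g x)"
proof (induction k arbitrary: f g)
  case 0
  then show ?case by (auto simp: Ck_fun_0 intro!: continuous_intros)
next
  case (Suc k)
  have f: "(f has_vector_derivative vderiv (Suc 0) f x) (at x)" and
    g: "(g has_vector_derivative vderiv (Suc 0) g x) (at x)" for x
    using Ck_fun_has_vderiv[of "Suc k" _ 0] Suc.prems by auto
  have "Ck_fun k f" "Ck_fun k g" "Ck_fun k (vderiv (Suc 0) f)" "Ck_fun k (vderiv (Suc 0) g)"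
    using Suc.prems by (auto intro: Ck_fun_mono simp: Ck_fun_Suc[of k, symmetric]) (auto simp: Ck_fun_Suc)
  then show ?case
    by (intro Ck_fun_SucI[OF has_vector_derivative_mult[OF f g]] Ck_fun_add Suc.IH)
qed

lemma smooth_fun_add: "smooth_fun f \<Longrightarrow> smooth_fun g \<Longrightarrow> smooth_fun (\<lambda>x. f x + g x)"
  and smooth_fun_diff: "smooth_fun f \<Longrightarrow> smooth_fun g \<Longrightarrow> smooth_fun (\<lambda>x. f x - g x)"
  and smooth_fun_affine: "smooth_fun f \<Longrightarrow> smooth_fun (\<lambda>x. f (a * x + c))"
  and smooth_fun_linear: "bounded_linear h \<Longrightarrow> smooth_fun f \<Longrightarrow> smooth_fun (\<lambda>x. h (f x))"
  unfolding smooth_fun_def by (blast intro: Ck_fun_add Ck_fun_diff Ck_fun_affine Ck_fun_linear)+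

lemma smooth_fun_mult:
  fixes f g :: "real \<Rightarrow> 'a::real_normed_algebra"
  shows "smooth_fun f \<Longrightarrow> smooth_fun g \<Longrightarrow> smooth_fun (\<lambda>x. f x * g x)"
  by (simp add: smooth_fun_def Ck_fun_mult)

lemma vderiv_add:
  "smooth_fun f \<Longrightarrow> smooth_fun g \<Longrightarrow>
     vderiv j (\<lambda>x. f x + g x) x = vderiv j f x + vderiv j g x"
  and vderiv_diff:
  "smooth_fun f \<Longrightarrow> smooth_fun g \<Longrightarrow>
     vderiv j (\<lambda>x. f x - g x) x = vderiv j f x - vderiv j g x"
  and vderiv_affine:
  "smooth_fun f \<Longrightarrow> vderiv j (\<lambda>x. f (a * x + c)) x = a ^ j *\<^sub>R vderiv j f (a * x + c)"
  and vderiv_linear: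
  "bounded_linear h \<Longrightarrow> smooth_fun f \<Longrightarrow> vderiv j (\<lambda>x. h (f x)) x = h (vderiv j f x)"
  unfolding smooth_fun_def
  by (blast intro: fun_cong[OF Ck_fun_add(2)[where k = j]] fun_cong[OF Ck_fun_diff(2)[where k = j]]
      fun_cong[OF Ck_fun_affine(2)[where k = j]] fun_cong[OF Ck_fun_linear(2)[where k = j]])+

lemma smooth_fun_const: "smooth_fun (\<lambda>_. c)"
  by (rule smooth_funI[where D = "\<lambda>j _. if j = 0 then c else 0"]) auto

lemma smooth_fun_sum:
  "finite A \<Longrightarrow> (\<And>i. i \<in> A \<Longrightarrow> smooth_fun (f i)) \<Longrightarrow> smooth_fun (\<lambda>x. \<Sum>i\<in>A. f i x)"
  by (induction A rule: finite_induct) (auto intro: smooth_fun_add smooth_fun_const)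

lemma vderiv_const: "vderiv j (\<lambda>_. c) x = (if j = 0 then c else 0)"
  by (rule fun_cong[OF vderiv_eqI[where D = "\<lambda>j _. if j = 0 then c else 0" and k = j]]) auto

lemma vderiv_sum:
  "finite A \<Longrightarrow> (\<And>i. i \<in> A \<Longrightarrow> smooth_fun (f i)) \<Longrightarrow>
     vderiv j (\<lambda>x. \<Sum>i\<in>A. f i x) x = (\<Sum>i\<in>A. vderiv j (f i) x)"
  by (induction A rule: finite_induct) (auto simp: vderiv_add smooth_fun_sum vderiv_const)

lemma vderiv_1_mult:
  fixes f g :: "real \<Rightarrow> 'a::real_normed_algebra"
  assumes "smooth_fun f" "smooth_fun g"
  shows "vderiv (Suc 0) (\<lambda>x. f x * g x) = (\<lambda>x. f x * vderiv (Suc 0) g x + vderiv (Suc 0) f x * g x)"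
  by (rule vderiv_1_eqI) (intro has_vector_derivative_mult smooth_fun_has_vderiv_0 assms)

lemma vderiv_vanish:
  assumes "open S" "\<And>x. x \<in> S \<Longrightarrow> f x = 0" "x \<in> S"
  shows "vderiv j f x = 0"
  using assms(3)
proof (induction j arbitrary: x)
  case (Suc j)
  have "(vderiv j f has_vector_derivative 0) (at x)"
    by (rule has_vector_derivative_transform_within_open[where S = S and f = "\<lambda>_. 0"])
      (use Suc.prems Suc.IH[symmetric] assms(1) in \<open>simp_all only: has_vector_derivative_const\<close>)
  then show ?case unfolding vderiv_Suc by (rule vector_derivative_at)
next
  case 0
  then show ?case unfolding vderiv_0 by (rule assms(2))
qed

section \<open>Closure properties and decay of Schwartz functions\<close>

lemma schwartz_smooth: "\<phi> \<in> schwartz \<Longrightarrow> smooth_fun \<phi>"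
  by (simp add: schwartz_def)

lemma schwartz_bound:
  assumes "\<phi> \<in> schwartz"
  obtains B where "\<And>x. \<bar>x\<bar> ^ m * norm (vderiv n \<phi> x) \<le> B"
proof -
  from assms have "bounded (range (\<lambda>x. (x ^ m) *\<^sub>R vderiv n \<phi> x))" by (simp add: schwartz_def)
  then obtain B where "\<forall>x. norm ((x ^ m) *\<^sub>R vderiv n \<phi> x) \<le> B"
    by (auto simp: bounded_iff)
  then have "\<And>x. \<bar>x\<bar> ^ m * norm (vderiv n \<phi> x) \<le> B" by (simp add: power_abs)
  with that show ?thesis by blast
qed

lemma schwartzI:
  assumes "smooth_fun \<phi>" "\<And>m n. \<exists>B. \<forall>x. \<bar>x\<bar> ^ m * norm (vderiv n \<phi> x) \<le> B"
  shows "\<phi> \<in> schwartz"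
  unfolding schwartz_def using assms by (auto simp: bounded_iff power_abs)

lemma schwartz_vderiv: "\<phi> \<in> schwartz \<Longrightarrow> vderiv n \<phi> \<in> schwartz"
proof (rule schwartzI)
  assume "\<phi> \<in> schwartz"
  then show "\<exists>B. \<forall>x. \<bar>x\<bar> ^ m * norm (vderiv k (vderiv n \<phi>) x) \<le> B" for m k
    unfolding vderiv_vderiv by (rule schwartz_bound[where m = m and n = "k + n"]) blast
qed (simp add: smooth_fun_vderiv schwartz_smooth)

lemma schwartz_add:
  assumes "\<phi> \<in> schwartz" "\<psi> \<in> schwartz"
  shows "(\<lambda>x. \<phi> x + \<psi> x) \<in> schwartz"
proof (rule schwartzI)
  show "smooth_fun (\<lambda>x. \<phi> x + \<psi> x)" by (intro smooth_fun_add schwartz_smooth assms)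
  fix m n
  obtain B where B: "\<And>x. \<bar>x\<bar> ^ m * norm (vderiv n \<phi> x) \<le> B" using assms schwartz_bound by blast
  obtain C where C: "\<And>x. \<bar>x\<bar> ^ m * norm (vderiv n \<psi> x) \<le> C" using assms schwartz_bound by blast
  have "\<bar>x\<bar> ^ m * norm (vderiv n (\<lambda>x. \<phi> x + \<psi> x) x) \<le> B + C" for x
  proof -
    have "\<bar>x\<bar> ^ m * norm (vderiv n (\<lambda>x. \<phi> x + \<psi> x) x)
        \<le> \<bar>x\<bar> ^ m * (norm (vderiv n \<phi> x) + norm (vderiv n \<psi> x))"
      by (simp add: vderiv_add schwartz_smooth assms mult_left_mono norm_triangle_ineq)
    also have "\<dots> \<le> B + C" using B[of x] C[of x] by (simp add: distrib_left)
    finally show ?thesis .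
  qed
  then show "\<exists>B. \<forall>x. \<bar>x\<bar> ^ m * norm (vderiv n (\<lambda>x. \<phi> x + \<psi> x) x) \<le> B" by blast
qed

text \<open>The uniformity in the index \<open>N\<close> serves to let frequency cutoffs tend to 1.\<close>

lemma schwartz_mult_family_bound:
  fixes a :: "'i \<Rightarrow> real \<Rightarrow> complex"
  assumes "\<And>N. smooth_fun (a N)" "\<And>j. \<exists>B. \<forall>N x. norm (vderiv j (a N) x) \<le> B" "\<phi> \<in> schwartz"
  shows "\<exists>B. \<forall>N x. \<bar>x\<bar> ^ l * norm (vderiv m (\<lambda>x. a N x * \<phi> x) x) \<le> B"
  using assms
proof (induction m arbitrary: a \<phi>)
  case 0
  obtain B where B: "\<And>N x. norm (a N x) \<le> B" using 0(2)[of 0] by auto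
  obtain C where C: "\<And>x. \<bar>x\<bar> ^ l * norm (\<phi> x) \<le> C"
    using schwartz_bound[OF 0(3), of l 0] by auto
  have "\<bar>x\<bar> ^ l * norm (a N x * \<phi> x) \<le> B * C" for N x
  proof -
    have "norm (a N x) * (\<bar>x\<bar> ^ l * norm (\<phi> x)) \<le> B * C"
      by (intro mult_mono B C) (auto intro: order_trans[OF norm_ge_zero B])
    then show ?thesis by (simp add: norm_mult mult_ac)
  qed
  then show ?case by auto
next
  case (Suc m)
  let ?\<phi>' = "vderiv (Suc 0) \<phi>" and ?a' = "\<lambda>N. vderiv (Suc 0) (a N)"
  have s: "smooth_fun \<phi>" "\<And>N. smooth_fun (?a' N)" "smooth_fun ?\<phi>'"
    using Suc.prems by (auto intro: schwartz_smooth smooth_fun_vderiv)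
  obtain B where B: "\<And>N x. \<bar>x\<bar> ^ l * norm (vderiv m (\<lambda>x. a N x * ?\<phi>' x) x) \<le> B"
    using Suc.IH[OF Suc.prems(1,2) schwartz_vderiv[OF Suc.prems(3)]] by blast
  have "\<exists>B. \<forall>N x. norm (vderiv j (?a' N) x) \<le> B" for j
    using Suc.prems(2)[of "j + 1"] by (simp add: vderiv_vderiv)
  then obtain C where C: "\<And>N x. \<bar>x\<bar> ^ l * norm (vderiv m (\<lambda>x. ?a' N x * \<phi> x) x) \<le> C"
    using Suc.IH[of ?a', OF s(2) _ Suc.prems(3)] by blast
  have "\<bar>x\<bar> ^ l * norm (vderiv (Suc m) (\<lambda>x. a N x * \<phi> x) x) \<le> B + C" for N x
  proof -
    have "vderiv (Suc m) (\<lambda>x. a N x * \<phi> x) x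
        = vderiv m (\<lambda>x. a N x * ?\<phi>' x) x + vderiv m (\<lambda>x. ?a' N x * \<phi> x) x"
      unfolding vderiv_Suc_right[of m] vderiv_1_mult[OF Suc.prems(1) s(1)]
      by (intro vderiv_add smooth_fun_mult s Suc.prems)
    then have "\<bar>x\<bar> ^ l * norm (vderiv (Suc m) (\<lambda>x. a N x * \<phi> x) x)
        \<le> \<bar>x\<bar> ^ l * (norm (vderiv m (\<lambda>x. a N x * ?\<phi>' x) x) + norm (vderiv m (\<lambda>x. ?a' N x * \<phi> x) x))"
      by (simp add: mult_left_mono norm_triangle_ineq)
    also have "\<dots> \<le> B + C" using B[of x N] C[of x N] by (simp add: distrib_left)
    finally show ?thesis .
  qed
  then show ?case by blast
qed

lemma schwartz_mult:
  assumes "smooth_fun a" "\<And>j. bounded (range (vderiv j a))" "\<phi> \<in> schwartz"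
  shows "(\<lambda>x. a x * \<phi> x) \<in> schwartz"
proof (rule schwartzI)
  show "smooth_fun (\<lambda>x. a x * \<phi> x)" by (intro smooth_fun_mult schwartz_smooth assms)
  show "\<exists>B. \<forall>x. \<bar>x\<bar> ^ m * norm (vderiv n (\<lambda>x. a x * \<phi> x) x) \<le> B" for m n
    using schwartz_mult_family_bound[where a = "\<lambda>_::unit. a" and \<phi> = \<phi> and l = m and m = n] assms
    by (auto simp: bounded_iff)
qed

lemma schwartz_cmult: "\<phi> \<in> schwartz \<Longrightarrow> (\<lambda>x. c * \<phi> x) \<in> schwartz"
  by (rule schwartz_mult) (auto simp: smooth_fun_const vderiv_const bounded_iff intro!: exI[of _ "norm c"])

lemma schwartz_diff: "\<phi> \<in> schwartz \<Longrightarrow> \<psi> \<in> schwartz \<Longrightarrow> (\<lambda>x. \<phi> x - \<psi> x) \<in> schwartz"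
  using schwartz_add[OF _ schwartz_cmult[of \<psi> "-1"], of \<phi>] by simp

lemma schwartz_0: "(\<lambda>_. 0) \<in> schwartz"
  by (rule schwartzI) (auto simp: smooth_fun_const vderiv_const)

lemma schwartz_sum:
  "finite A \<Longrightarrow> (\<And>i. i \<in> A \<Longrightarrow> f i \<in> schwartz) \<Longrightarrow> (\<lambda>x. \<Sum>i\<in>A. f i x) \<in> schwartz"
  by (induction A rule: finite_induct) (auto intro: schwartz_add schwartz_0)

lemma smooth_fun_of_real: "smooth_fun (\<lambda>x. complex_of_real x)"
  by (rule smooth_funI[where D = "\<lambda>j x. if j = 0 then of_real x else if j = 1 then 1 else 0"])
    (auto intro!: derivative_eq_intros has_vector_derivative_of_real)

text \<open>The factor is unbounded, so \<open>schwartz_mult\<close> does not apply; it is absorbed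
  into the weight, whose power goes from \<open>m\<close> to \<open>Suc m\<close>.\<close>

lemma schwartz_mult_of_real:
  assumes "\<phi> \<in> schwartz"
  shows "(\<lambda>x. of_real x * \<phi> x) \<in> schwartz"
proof (rule schwartzI)
  show "smooth_fun (\<lambda>x. of_real x * \<phi> x)"
    by (intro smooth_fun_mult schwartz_smooth assms smooth_fun_of_real)
  fix m n
  show "\<exists>B. \<forall>x. \<bar>x\<bar> ^ m * norm (vderiv n (\<lambda>x. of_real x * \<phi> x) x) \<le> B"
    using assms
  proof (induction n arbitrary: \<phi>)
    case 0
    obtain B where "\<And>x. \<bar>x\<bar> ^ Suc m * norm (vderiv 0 \<phi> x) \<le> B" using 0 schwartz_bound by blast
    then show ?case by (auto simp: norm_mult mult_ac)
  next
    case (Suc n)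
    let ?\<phi>' = "vderiv (Suc 0) \<phi>"
    have s: "smooth_fun \<phi>" "smooth_fun ?\<phi>'"
      using Suc.prems by (auto intro: schwartz_smooth smooth_fun_vderiv)
    obtain B where B: "\<And>x. \<bar>x\<bar> ^ m * norm (vderiv n (\<lambda>x. of_real x * ?\<phi>' x) x) \<le> B"
      using Suc.IH[OF schwartz_vderiv[OF Suc.prems]] by blast
    obtain C where C: "\<And>x. \<bar>x\<bar> ^ m * norm (vderiv n \<phi> x) \<le> C"
      using Suc.prems schwartz_bound by blast
    have d1: "vderiv (Suc 0) (\<lambda>x. complex_of_real x) = (\<lambda>_. 1)"
      by (rule vderiv_1_eqI) (auto intro!: derivative_eq_intros has_vector_derivative_of_real)
    have "\<bar>x\<bar> ^ m * norm (vderiv (Suc n) (\<lambda>x. of_real x * \<phi> x) x) \<le> B + C" for x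
    proof -
      have "vderiv (Suc n) (\<lambda>x. of_real x * \<phi> x) x
          = vderiv n (\<lambda>x. of_real x * ?\<phi>' x) x + vderiv n \<phi> x"
        unfolding vderiv_Suc_right[of n] vderiv_1_mult[OF smooth_fun_of_real s(1)] d1 mult_1
        by (intro vderiv_add smooth_fun_mult s smooth_fun_of_real)
      then have "\<bar>x\<bar> ^ m * norm (vderiv (Suc n) (\<lambda>x. of_real x * \<phi> x) x)
          \<le> \<bar>x\<bar> ^ m * (norm (vderiv n (\<lambda>x. of_real x * ?\<phi>' x) x) + norm (vderiv n \<phi> x))"
        by (simp add: mult_left_mono norm_triangle_ineq)
      also have "\<dots> \<le> B + C" using B[of x] C[of x] by (simp add: distrib_left)
      finally show ?thesis .
    qed
    then show ?case by blast
  qed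
qed

lemma schwartz_mult_of_real_power: "\<phi> \<in> schwartz \<Longrightarrow> (\<lambda>x. (c * of_real x) ^ n * \<phi> x) \<in> schwartz"
proof (induction n)
  case (Suc n)
  have "(\<lambda>x. (c * of_real x) ^ Suc n * \<phi> x) = (\<lambda>x. c * (of_real x * ((c * of_real x) ^ n * \<phi> x)))"
    by (simp add: mult.assoc)
  then show ?case using schwartz_cmult[OF schwartz_mult_of_real[OF Suc.IH[OF Suc.prems]], of c] by simp
qed simp

lemma schwartz_compact_support:
  assumes "smooth_fun \<phi>" "\<And>x. r < \<bar>x\<bar> \<Longrightarrow> \<phi> x = 0"
  shows "\<phi> \<in> schwartz"
proof (rule schwartzI[OF assms(1)])
  fix m n
  have "continuous_on {-r..r} (vderiv n \<phi>)" using assms(1) by (rule smooth_fun_continuous)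
  then have "compact (vderiv n \<phi> ` {-r..r})" by (intro compact_continuous_image) auto
  then have "bounded (vderiv n \<phi> ` {-r..r})" by (rule compact_imp_bounded)
  then obtain B where B: "\<And>x. x \<in> {-r..r} \<Longrightarrow> norm (vderiv n \<phi> x) \<le> B"
    unfolding bounded_iff by blast
  have "\<bar>x\<bar> ^ m * norm (vderiv n \<phi> x) \<le> \<bar>r\<bar> ^ m * max B 0" for x
  proof (cases "x \<in> {-r..r}")
    case True
    then have "norm (vderiv n \<phi> x) \<le> max B 0" "\<bar>x\<bar> \<le> \<bar>r\<bar>" using B[of x] by auto
    then show ?thesis by (intro mult_mono power_mono) auto
  next
    case False
    have "open {x. r < \<bar>x\<bar>}" by (intro open_Collect_less continuous_intros)
    moreover have "x \<in> {x. r < \<bar>x\<bar>}" using False by auto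
    ultimately have "vderiv n \<phi> x = 0"
      using assms(2) by (intro vderiv_vanish[of "{x. r < \<bar>x\<bar>}"]) auto
    then show ?thesis by simp
  qed
  then show "\<exists>B. \<forall>x. \<bar>x\<bar> ^ m * norm (vderiv n \<phi> x) \<le> B" by blast
qed

lemma schwartz_affine:
  assumes "\<phi> \<in> schwartz" "a \<noteq> 0"
  shows "(\<lambda>x. \<phi> (a * x + c)) \<in> schwartz"
proof (rule schwartzI)
  show "smooth_fun (\<lambda>x. \<phi> (a * x + c))" by (intro smooth_fun_affine schwartz_smooth assms)
  fix m n
  obtain B where B: "\<And>x. \<bar>x\<bar> ^ m * norm (vderiv n \<phi> x) \<le> B" using assms schwartz_bound by blast
  obtain C where C: "\<And>x. \<bar>x\<bar> ^ 0 * norm (vderiv n \<phi> x) \<le> C" using assms schwartz_bound by blast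
  have "\<bar>x\<bar> ^ m * norm (vderiv n (\<lambda>x. \<phi> (a * x + c)) x)
      \<le> (2 / \<bar>a\<bar>) ^ m * \<bar>a\<bar> ^ n * (B + \<bar>c\<bar> ^ m * C)" for x
  proof -
    let ?y = "a * x + c"
    \<comment> \<open>The weight in \<open>x\<close> has to be expressed through the argument
      \<open>?y\<close>; passing to a maximum before taking powers avoids expanding the power of a
      sum.\<close>
    have "\<bar>a\<bar> * \<bar>x\<bar> \<le> \<bar>?y\<bar> + \<bar>c\<bar>"
      by (simp flip: abs_mult)
    also have "\<dots> \<le> 2 * max \<bar>?y\<bar> \<bar>c\<bar>" by (simp add: max_def)
    finally have "\<bar>x\<bar> \<le> 2 / \<bar>a\<bar> * max \<bar>?y\<bar> \<bar>c\<bar>" using assms(2) by (simp add: field_simps)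
    then have "\<bar>x\<bar> ^ m \<le> (2 / \<bar>a\<bar>) ^ m * max \<bar>?y\<bar> \<bar>c\<bar> ^ m"
      by (metis power_mono abs_ge_zero power_mult_distrib)
    also have "\<dots> \<le> (2 / \<bar>a\<bar>) ^ m * (\<bar>?y\<bar> ^ m + \<bar>c\<bar> ^ m)"
      by (intro mult_left_mono) (auto simp: max_def)
    finally have "\<bar>x\<bar> ^ m * (\<bar>a\<bar> ^ n * norm (vderiv n \<phi> ?y))
        \<le> (2 / \<bar>a\<bar>) ^ m * (\<bar>?y\<bar> ^ m + \<bar>c\<bar> ^ m) * (\<bar>a\<bar> ^ n * norm (vderiv n \<phi> ?y))"
      by (rule mult_right_mono) simp
    also have "\<dots> = (2 / \<bar>a\<bar>) ^ m * \<bar>a\<bar> ^ n *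
        (\<bar>?y\<bar> ^ m * norm (vderiv n \<phi> ?y) + \<bar>c\<bar> ^ m * norm (vderiv n \<phi> ?y))"
      by (simp add: algebra_simps)
    also have "\<dots> \<le> (2 / \<bar>a\<bar>) ^ m * \<bar>a\<bar> ^ n * (B + \<bar>c\<bar> ^ m * C)"
      using B[of ?y] C[of ?y] by (intro mult_left_mono add_mono) auto
    finally show ?thesis
      by (simp add: vderiv_affine schwartz_smooth assms power_abs)
  qed
  then show "\<exists>B. \<forall>x. \<bar>x\<bar> ^ m * norm (vderiv n (\<lambda>x. \<phi> (a * x + c)) x) \<le> B" by blast
qed

text \<open>The weights of power 0 and 2 together give the integrable majorant
  \<open>1 / (1 + x\<^sup>2)\<close>, on which most of the dominated integrals below rely.\<close>

lemma schwartz_decay: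
  assumes "\<phi> \<in> schwartz"
  obtains B where "B \<ge> 0" "\<And>x. norm (\<phi> x) \<le> B / (1 + x\<^sup>2)"
proof -
  obtain B where B: "\<And>x. \<bar>x\<bar> ^ 2 * norm (vderiv 0 \<phi> x) \<le> B" using assms schwartz_bound by blast
  obtain C where C: "\<And>x. \<bar>x\<bar> ^ 0 * norm (vderiv 0 \<phi> x) \<le> C" using assms schwartz_bound by blast
  have "norm (\<phi> x) \<le> (B + C) / (1 + x\<^sup>2)" for x
    using B[of x] C[of x] by (simp add: field_simps add_pos_nonneg)
  moreover have "B + C \<ge> 0" using B[of 0] order_trans[OF norm_ge_zero, of "\<phi> 0" C] C[of 0] by simp
  ultimately show ?thesis using that by blast
qed

lemma integrable_inverse_1_plus_square: "integrable lborel (\<lambda>x::real. 1 / (1 + x\<^sup>2))"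
proof -
  \<comment> \<open>The fact cited for this is the library's one of the same name, a set integral
    over the extended interval.\<close>
  have "set_integrable lborel (einterval (-\<infinity>) \<infinity>) (\<lambda>x::real. 1 / (1 + x\<^sup>2))"
    using integrable_inverse_1_plus_square by (simp add: divide_inverse)
  then show ?thesis by (simp add: set_integrable_def)
qed

lemma integrable_decay:
  fixes f :: "real \<Rightarrow> 'a::{banach, second_countable_topology}"
  assumes "f \<in> borel_measurable borel" "\<And>x. norm (f x) \<le> B / (1 + x\<^sup>2)"
  shows "integrable lborel f"
proof (rule Bochner_Integration.integrable_bound)
  show "integrable lborel (\<lambda>x. B * (1 / (1 + x\<^sup>2)))"
    by (intro integrable_mult_right integrable_inverse_1_plus_square)
  show "AE x in lborel. norm (f x) \<le> norm (B * (1 / (1 + x\<^sup>2)))"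
    using assms(2) by (intro AE_I2) (metis abs_ge_self order_trans real_norm_def times_divide_eq_right mult.right_neutral)
qed (use assms(1) in simp)

lemma schwartz_measurable: "\<phi> \<in> schwartz \<Longrightarrow> \<phi> \<in> borel_measurable borel"
  using smooth_fun_continuous_0[OF schwartz_smooth] by (intro borel_measurable_continuous_onI)

lemma schwartz_integrable: "\<phi> \<in> schwartz \<Longrightarrow> integrable lborel \<phi>"
  by (metis integrable_decay schwartz_decay schwartz_measurable)

section \<open>The Fourier transform on Schwartz functions\<close>

text \<open>Difference quotients along sequences are the form to which dominated convergence
  applies.\<close>

lemma has_vector_derivative_iff_quotient:
  fixes f :: "real \<Rightarrow> 'a::real_normed_vector"
  shows "(f has_vector_derivative D) (at x) \<longleftrightarrow> ((\<lambda>y. (f y - f x) /\<^sub>R (y - x)) \<longlongrightarrow> D) (at x)"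
proof -
  have "norm ((f y - f x) /\<^sub>R (y - x) - D) = norm (f y - f x - (y - x) *\<^sub>R D) / norm (y - x)"
    if "y \<noteq> x" for y
  proof -
    have "(f y - f x) /\<^sub>R (y - x) - D = (f y - f x - (y - x) *\<^sub>R D) /\<^sub>R (y - x)"
      using that by (simp add: scaleR_diff_right)
    then show ?thesis by (simp add: divide_inverse mult.commute)
  qed
  then have "((\<lambda>y. norm ((f y - f x) /\<^sub>R (y - x) - D)) \<longlongrightarrow> 0) (at x) \<longleftrightarrow>
      ((\<lambda>y. norm (f y - f x - (y - x) *\<^sub>R D) / norm (y - x)) \<longlongrightarrow> 0) (at x)"
    by (intro tendsto_cong) (auto simp: eventually_at_filter)
  then show ?thesis
    unfolding has_vector_derivative_def has_derivative_iff_norm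
    by (simp add: bounded_linear_scaleR_left tendsto_norm_zero_iff LIM_zero_iff)
qed

text \<open>The mean value inequality on the ball where the derivative is controlled bounds the
  difference quotients by \<open>w\<close>, so dominated convergence applies along every sequence
  tending to \<open>t0\<close>.\<close>

lemma has_vector_derivative_integral:
  fixes f :: "real \<Rightarrow> 'b \<Rightarrow> 'a::{banach, second_countable_topology}"
  assumes "e > 0"
    and D: "\<And>t y. \<bar>t - t0\<bar> < e \<Longrightarrow> ((\<lambda>t. f t y) has_vector_derivative f' t y) (at t)"
    and B: "\<And>t y. \<bar>t - t0\<bar> < e \<Longrightarrow> norm (f' t y) \<le> w y"
    and w: "integrable M w" and int: "\<And>t. integrable M (f t)"
    and meas: "f' t0 \<in> borel_measurable M"
  shows "((\<lambda>t. LINT y|M. f t y) has_vector_derivative (LINT y|M. f' t0 y)) (at t0)"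
  unfolding has_vector_derivative_iff_quotient
proof (rule tendsto_at_iff_sequentially[THEN iffD2], intro allI impI)
  fix X :: "nat \<Rightarrow> real"
  assume X0: "\<forall>i. X i \<in> UNIV - {t0}" and X: "X \<longlonglongrightarrow> t0"
  obtain N where N: "\<And>n. n \<ge> N \<Longrightarrow> \<bar>X n - t0\<bar> < e"
    using X \<open>e > 0\<close> unfolding LIMSEQ_def dist_real_def by meson
  \<comment> \<open>The index is shifted by \<open>N\<close> so that all terms lie where the
    domination holds; \<open>LIMSEQ_offset\<close> takes the shift back.\<close>
  let ?q = "\<lambda>n y. (f (X (n + N)) y - f t0 y) /\<^sub>R (X (n + N) - t0)"
  have lip: "norm (f t y - f t0 y) \<le> w y * \<bar>t - t0\<bar>" if "\<bar>t - t0\<bar> < e" for t y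
  proof -
    have "norm (f t y - f t0 y) \<le> w y * norm (t - t0)"
    proof (rule differentiable_bound[where S = "ball t0 e" and f' = "\<lambda>s h. h *\<^sub>R f' s y"])
      show "((\<lambda>t. f t y) has_derivative (\<lambda>h. h *\<^sub>R f' s y)) (at s within ball t0 e)"
        if "s \<in> ball t0 e" for s
        using D[of s y] that
        by (auto simp: has_vector_derivative_def dist_real_def abs_minus_commute intro: has_derivative_at_withinI)
      show "onorm (\<lambda>h. h *\<^sub>R f' s y) \<le> w y" if "s \<in> ball t0 e" for s
        using B[of s y] that by (intro onorm_le) (simp add: mult.commute mult_left_mono dist_real_def abs_minus_commute)
    qed (use that \<open>e > 0\<close> in \<open>auto simp: dist_real_def abs_minus_commute\<close>)
    then show ?thesis by simp
  qed
  have "(\<lambda>n. LINT y|M. ?q n y) \<longlonglongrightarrow> (LINT y|M. f' t0 y)"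
  proof (rule integral_dominated_convergence[where w = w])
    show "AE y in M. (\<lambda>n. ?q n y) \<longlonglongrightarrow> f' t0 y"
    proof (rule AE_I2)
      fix y
      have "((\<lambda>t. (f t y - f t0 y) /\<^sub>R (t - t0)) \<longlongrightarrow> f' t0 y) (at t0)"
        using D[of t0 y] \<open>e > 0\<close> by (simp add: has_vector_derivative_iff_quotient)
      then show "(\<lambda>n. ?q n y) \<longlonglongrightarrow> f' t0 y"
        using X0 X by (intro LIMSEQ_ignore_initial_segment) (auto simp: tendsto_at_iff_sequentially o_def)
    qed
    show "AE y in M. norm (?q n y) \<le> w y" for n
    proof (rule AE_I2)
      fix y
      have "norm (f (X (n + N)) y - f t0 y) \<le> w y * \<bar>X (n + N) - t0\<bar>"
        by (rule lip) (simp add: N)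
      moreover have "X (n + N) \<noteq> t0" using X0 by auto
      ultimately show "norm (?q n y) \<le> w y"
        by (simp add: mult.commute[of "inverse _"] divide_inverse[symmetric] pos_divide_le_eq del: scaleR_diff_right)
    qed
  qed (use w meas int in \<open>auto intro!: borel_measurable_scaleR borel_measurable_diff\<close>)
  then have "(\<lambda>n. ((LINT y|M. f (X (n + N)) y) - (LINT y|M. f t0 y)) /\<^sub>R (X (n + N) - t0))
      \<longlonglongrightarrow> (LINT y|M. f' t0 y)"
    using int by simp
  then have "(\<lambda>n. ((LINT y|M. f (X n) y) - (LINT y|M. f t0 y)) /\<^sub>R (X n - t0)) \<longlonglongrightarrow> (LINT y|M. f' t0 y)"
    by (rule LIMSEQ_offset)
  then show "((\<lambda>t. ((LINT y|M. f t y) - (LINT y|M. f t0 y)) /\<^sub>R (t - t0)) \<circ> X) \<longlonglongrightarrow> (LINT y|M. f' t0 y)"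
    by (simp add: o_def)
qed

text \<open>Provides one integrable majorant for all shifts by at most 1. The 3 arises from x^2 <= 2
  (x + h)^2 + 2 h^2 together with h^2 <= 1.\<close>

lemma inverse_1_plus_square_shift:
  fixes x h :: real
  assumes "\<bar>h\<bar> \<le> 1"
  shows "1 / (1 + (x + h)\<^sup>2) \<le> 3 / (1 + x\<^sup>2)"
proof -
  have h: "h\<^sup>2 \<le> 1" using assms by (simp add: abs_square_le_1)
  have "0 \<le> (x + 2 * h)\<^sup>2" by simp
  then have "x\<^sup>2 \<le> 2 * (x + h)\<^sup>2 + 2 * h\<^sup>2" by (simp add: power2_eq_square algebra_simps)
  with h have "1 + x\<^sup>2 \<le> 3 * (1 + (x + h)\<^sup>2)" by (smt (verit) zero_le_power2)
  then show ?thesis by (simp add: field_simps add_pos_nonneg)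
qed

lemma integral_translate:
  fixes f :: "real \<Rightarrow> 'a::{banach, second_countable_topology}"
  shows "(LINT x|lborel. f (x + h)) = (LINT x|lborel. f x)"
  using lborel_integral_real_affine[of 1 f h] by (simp add: add.commute)

lemma integrable_translate:
  fixes f :: "real \<Rightarrow> 'a::{banach, second_countable_topology}"
  shows "integrable lborel f \<Longrightarrow> integrable lborel (\<lambda>x. f (x + h))"
  using lborel_integrable_real_affine[of f 1 h] by (simp add: add.commute)

lemma integral_reflect:
  fixes f :: "real \<Rightarrow> 'a::{banach, second_countable_topology}"
  shows "(LINT y|lborel. f (x - y)) = (LINT y|lborel. f y)"
  using lborel_integral_real_affine[of "-1" f x] by simp

lemma integrable_reflect:
  fixes f :: "real \<Rightarrow> 'a::{banach, second_countable_topology}"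
  shows "integrable lborel f \<Longrightarrow> integrable lborel (\<lambda>y. f (x - y))"
  using lborel_integrable_real_affine[of f "-1" x] by simp

text \<open>The integral of \<open>\<phi> (x + h)\<close> does not depend on \<open>h\<close>;
  differentiating it under the integral at \<open>h = 0\<close> gives the claim. This plays the role
  of integration by parts.\<close>

lemma schwartz_integral_vderiv:
  assumes "\<phi> \<in> schwartz"
  shows "(LINT x|lborel. vderiv (Suc 0) \<phi> x) = 0"
proof -
  obtain B where B: "B \<ge> 0" "\<And>x. norm (vderiv (Suc 0) \<phi> x) \<le> B / (1 + x\<^sup>2)"
    using schwartz_decay[OF schwartz_vderiv[OF assms]] by blast
  have "((\<lambda>h. LINT x|lborel. \<phi> (x + h)) has_vector_derivative
      (LINT x|lborel. vderiv (Suc 0) \<phi> (x + 0))) (at 0)"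
  proof (rule has_vector_derivative_integral[where e = 1 and w = "\<lambda>x. (3 * B) * (1 / (1 + x\<^sup>2))"])
    fix t x :: real
    show "((\<lambda>t. \<phi> (x + t)) has_vector_derivative vderiv (Suc 0) \<phi> (x + t)) (at t)"
      using has_vector_derivative_affine[OF smooth_fun_has_vderiv_0[OF schwartz_smooth[OF assms]],
          where a = 1 and x = t and c = x] by (simp add: add.commute)
    show "norm (vderiv (Suc 0) \<phi> (x + t)) \<le> (3 * B) * (1 / (1 + x\<^sup>2))" if "\<bar>t - 0\<bar> < 1"
    proof -
      have "norm (vderiv (Suc 0) \<phi> (x + t)) \<le> B * (1 / (1 + (x + t)\<^sup>2))" using B(2)[of "x + t"] by simp
      also have "\<dots> \<le> B * (3 / (1 + x\<^sup>2))"
        using that by (intro mult_left_mono inverse_1_plus_square_shift B) auto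
      finally show ?thesis by (simp add: mult.commute)
    qed
    show "integrable lborel (\<lambda>x. \<phi> (x + t))"
      by (intro integrable_translate schwartz_integrable assms)
    show "(\<lambda>x. vderiv (Suc 0) \<phi> (x + 0)) \<in> borel_measurable lborel"
      using schwartz_measurable[OF schwartz_vderiv[OF assms]] by simp
    show "integrable lborel (\<lambda>x. (3 * B) * (1 / (1 + x\<^sup>2)))"
      by (intro integrable_mult_right integrable_inverse_1_plus_square)
  qed simp
  then have "((\<lambda>h::real. LINT x|lborel. \<phi> x) has_vector_derivative
      (LINT x|lborel. vderiv (Suc 0) \<phi> x)) (at 0)"
    by (simp add: integral_translate)
  then show ?thesis by (rule vector_derivative_unique_at) (rule has_vector_derivative_const)
qed

lemma smooth_fun_exp:
  fixes c :: complex
  shows "smooth_fun (\<lambda>x. exp (c * of_real x))"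
    and "vderiv j (\<lambda>x. exp (c * of_real x)) = (\<lambda>x. c ^ j * exp (c * of_real x))"
proof -
  have D: "((\<lambda>x. c ^ i * exp (c * of_real x)) has_vector_derivative c ^ Suc i * exp (c * of_real x)) (at x)"
    for i and x :: real
    by (rule has_vector_derivative_real_field) (auto intro!: derivative_eq_intros)
  show "smooth_fun (\<lambda>x. exp (c * of_real x))"
    by (rule smooth_funI[where D = "\<lambda>i x. c ^ i * exp (c * of_real x)"]) (use D in auto)
  show "vderiv j (\<lambda>x. exp (c * of_real x)) = (\<lambda>x. c ^ j * exp (c * of_real x))"
    by (rule vderiv_eqI[where D = "\<lambda>i x. c ^ i * exp (c * of_real x)" and k = j]) (use D in auto)
qed

lemma schwartz_exp_mult:
  assumes "Re c = 0" "\<phi> \<in> schwartz"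
  shows "(\<lambda>x. exp (c * of_real x) * \<phi> x) \<in> schwartz"
proof (rule schwartz_mult[OF smooth_fun_exp(1) _ assms(2)])
  show "bounded (range (vderiv j (\<lambda>x. exp (c * complex_of_real x))))" for j
    unfolding smooth_fun_exp(2) bounded_iff using assms(1)
    by (intro exI[of _ "norm c ^ j"]) (auto simp: norm_mult norm_power)
qed

lemma norm_exp_i [simp]: "norm (exp (- (\<i> * complex_of_real y))) = 1" "norm (exp (\<i> * complex_of_real y)) = 1"
  by auto

lemma fourier_integrable:
  assumes "integrable lborel f"
  shows "integrable lborel (\<lambda>x. exp (- \<i> * complex_of_real (x * \<xi>)) * f x)"
proof (rule Bochner_Integration.integrable_bound[OF assms])
  have [measurable]: "f \<in> borel_measurable borel" using assms by auto
  show "(\<lambda>x. exp (- \<i> * complex_of_real (x * \<xi>)) * f x) \<in> borel_measurable lborel"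
    by measurable
qed (auto simp: norm_mult)

lemma norm_fourier_le:
  assumes "integrable lborel f"
  shows "norm (fourier f \<xi>) \<le> (LINT x|lborel. norm (f x))"
proof -
  have "norm (fourier f \<xi>) \<le> (LINT x|lborel. norm (exp (- \<i> * complex_of_real (x * \<xi>)) * f x))"
    unfolding fourier_def by (rule integral_norm_bound)
  then show ?thesis by (simp add: norm_mult)
qed

lemma fourier_has_vector_derivative:
  assumes "\<phi> \<in> schwartz"
  shows "(fourier \<phi> has_vector_derivative fourier (\<lambda>x. (- \<i>) * of_real x * \<phi> x) \<xi>) (at \<xi>)"
proof -
  let ?\<psi> = "\<lambda>x. (- \<i>) * of_real x * \<phi> x"
  have s: "?\<psi> \<in> schwartz"
    using schwartz_cmult[OF schwartz_mult_of_real[OF assms], of "- \<i>"] by (simp add: mult.assoc)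
  show ?thesis
    unfolding fourier_def
  proof (rule has_vector_derivative_integral[where e = 1 and w = "\<lambda>x. norm (?\<psi> x)"])
    show "((\<lambda>t. exp (- \<i> * complex_of_real (x * t)) * \<phi> x) has_vector_derivative
        exp (- \<i> * complex_of_real (x * t)) * ?\<psi> x) (at t)" for t x
    proof -
      have "((\<lambda>z. exp (- \<i> * (of_real x * z)) * \<phi> x) has_field_derivative
        exp (- \<i> * complex_of_real (x * t)) * ?\<psi> x) (at (of_real t))"
        by (auto intro!: derivative_eq_intros)
      from has_vector_derivative_real_field[OF this] show ?thesis by simp
    qed
    show "integrable lborel (\<lambda>x. exp (- \<i> * complex_of_real (x * t)) * \<phi> x)" for t
      by (intro fourier_integrable schwartz_integrable assms)
    show "(\<lambda>x. exp (- \<i> * complex_of_real (x * \<xi>)) * ?\<psi> x) \<in> borel_measurable lborel"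
      using fourier_integrable[OF schwartz_integrable[OF s]] by (rule borel_measurable_integrable)
    show "integrable lborel (\<lambda>x. norm (?\<psi> x))"
      using schwartz_integrable[OF s] by (rule integrable_norm)
  qed (auto simp: norm_mult)
qed

lemma fourier_smooth:
  assumes "\<phi> \<in> schwartz"
  shows "smooth_fun (fourier \<phi>)"
    and "vderiv n (fourier \<phi>) = fourier (\<lambda>x. ((- \<i>) * of_real x) ^ n * \<phi> x)"
proof -
  have D: "(fourier (\<lambda>x. ((- \<i>) * of_real x) ^ j * \<phi> x) has_vector_derivative
      fourier (\<lambda>x. ((- \<i>) * of_real x) ^ Suc j * \<phi> x) \<xi>) (at \<xi>)" for j \<xi>
    using fourier_has_vector_derivative[OF schwartz_mult_of_real_power[OF assms, of "- \<i>" j], of \<xi>]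
    by (simp add: mult.assoc)
  show "smooth_fun (fourier \<phi>)"
    by (rule smooth_funI[where D = "\<lambda>j. fourier (\<lambda>x. ((- \<i>) * of_real x) ^ j * \<phi> x)"]) (use D in auto)
  show "vderiv n (fourier \<phi>) = fourier (\<lambda>x. ((- \<i>) * of_real x) ^ n * \<phi> x)"
    by (rule vderiv_eqI[where D = "\<lambda>j. fourier (\<lambda>x. ((- \<i>) * of_real x) ^ j * \<phi> x)" and k = n])
      (use D in auto)
qed

text \<open>The derivative of the product of \<open>\<phi>\<close> with the character has integral
  0, and the product rule splits it into the two sides.\<close>

lemma fourier_vderiv:
  assumes "\<phi> \<in> schwartz"
  shows "fourier (vderiv (Suc 0) \<phi>) \<xi> = \<i> * of_real \<xi> * fourier \<phi> \<xi>"
proof -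
  let ?e = "\<lambda>x. exp (- \<i> * complex_of_real (x * \<xi>))"
  have e: "?e = (\<lambda>x. exp ((- \<i> * of_real \<xi>) * of_real x))" by (simp add: mult_ac)
  have se: "smooth_fun ?e" unfolding e by (rule smooth_fun_exp)
  have de: "vderiv (Suc 0) ?e = (\<lambda>x. - \<i> * of_real \<xi> * ?e x)"
    unfolding e smooth_fun_exp(2) by (simp add: mult_ac)
  have "(\<lambda>x. ?e x * \<phi> x) \<in> schwartz"
    using schwartz_exp_mult[of "- \<i> * of_real \<xi>" \<phi>] assms by (simp add: mult_ac)
  then have "0 = (LINT x|lborel. vderiv (Suc 0) (\<lambda>x. ?e x * \<phi> x) x)"
    by (simp add: schwartz_integral_vderiv)
  also have "\<dots> = (LINT x|lborel. ?e x * vderiv (Suc 0) \<phi> x - \<i> * of_real \<xi> * (?e x * \<phi> x))"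
    unfolding vderiv_1_mult[OF se schwartz_smooth[OF assms]] de by (simp add: mult.assoc)
  also have "\<dots> = fourier (vderiv (Suc 0) \<phi>) \<xi> - \<i> * of_real \<xi> * fourier \<phi> \<xi>"
    unfolding fourier_def
    by (simp only: Bochner_Integration.integral_diff[OF
          fourier_integrable[OF schwartz_integrable[OF schwartz_vderiv[OF assms]]]
          integrable_mult_right[OF fourier_integrable[OF schwartz_integrable[OF assms]]]]
        integral_mult_right_zero)
  finally show ?thesis by simp
qed

lemma norm_fourier_vderiv:
  "\<phi> \<in> schwartz \<Longrightarrow> \<bar>\<xi>\<bar> ^ m * norm (fourier \<phi> \<xi>) = norm (fourier (vderiv m \<phi>) \<xi>)"
proof (induction m arbitrary: \<phi>)
  case (Suc m)
  have "norm (fourier (vderiv (Suc m) \<phi>) \<xi>) = \<bar>\<xi>\<bar> ^ m * norm (fourier (vderiv (Suc 0) \<phi>) \<xi>)"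
    unfolding vderiv_Suc_right[of m] using Suc.IH[OF schwartz_vderiv[OF Suc.prems]] by simp
  then show ?case by (simp add: fourier_vderiv[OF Suc.prems] norm_mult)
qed simp

text \<open>Weights and derivatives exchange their roles under the transform. The bound is an
  integral rather than a supremum, so that dominated convergence can later send it to 0.\<close>

lemma fourier_seminorm_le:
  assumes "\<phi> \<in> schwartz"
  shows "\<bar>\<xi>\<bar> ^ m * norm (vderiv n (fourier \<phi>) \<xi>)
    \<le> (LINT x|lborel. norm (vderiv m (\<lambda>x. ((- \<i>) * of_real x) ^ n * \<phi> x) x))"
proof -
  have s: "(\<lambda>x. ((- \<i>) * of_real x) ^ n * \<phi> x) \<in> schwartz"
    by (rule schwartz_mult_of_real_power[OF assms])
  show ?thesis
    unfolding fourier_smooth(2)[OF assms] norm_fourier_vderiv[OF s]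
    by (intro norm_fourier_le schwartz_integrable schwartz_vderiv s)
qed

lemma schwartz_fourier: "\<phi> \<in> schwartz \<Longrightarrow> fourier \<phi> \<in> schwartz"
  by (rule schwartzI) (blast intro: fourier_smooth fourier_seminorm_le)+

section \<open>Fourier inversion and multipliers\<close>

lemma inv_fourier_eq: "inv_fourier \<phi> x = fourier \<phi> (- x) / of_real (2 * pi)"
  by (simp add: inv_fourier_def fourier_def mult.commute)

lemma schwartz_inv_fourier:
  assumes "\<phi> \<in> schwartz"
  shows "inv_fourier \<phi> \<in> schwartz"
proof -
  have "(\<lambda>x. (1 / of_real (2 * pi)) * fourier \<phi> ((-1) * x + 0)) \<in> schwartz"
    by (intro schwartz_cmult schwartz_affine schwartz_fourier assms) auto
  moreover have "inv_fourier \<phi> = (\<lambda>x. (1 / of_real (2 * pi)) * fourier \<phi> ((-1) * x + 0))"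
    by (auto simp: inv_fourier_eq)
  ultimately show ?thesis by simp
qed

text \<open>This is the characteristic function of the standard normal distribution, read as a
  Lebesgue integral.\<close>

lemma std_normal_fourier:
  "(LINT x|lborel. std_normal_density x *\<^sub>R exp (\<i> * of_real (t * x))) = of_real (exp (- t\<^sup>2 / 2))"
proof -
  have "of_real (exp (- t\<^sup>2 / 2)) = char std_normal_distribution t"
    by (simp add: char_std_normal_distribution)
  also have "\<dots> = (LINT x|lborel. std_normal_density x *\<^sub>R exp (\<i> * of_real (t * x)))"
    unfolding char_def by (subst integral_density) (auto simp: mult_ac)
  finally show ?thesis by simp
qed

text \<open>The Gaussian factor \<open>exp (- (e \<xi>)\<^sup>2 / 2)\<close> makes the double integral absolutely
  convergent; it is removed by letting \<open>e\<close> tend to 0.\<close>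

lemma fourier_gaussian:
  assumes "\<phi> \<in> schwartz" "e > 0"
  shows "(LINT \<xi>|lborel. of_real (exp (- (e * \<xi>)\<^sup>2 / 2)) * fourier \<phi> \<xi>)
    = of_real (2 * pi) * (LINT y|lborel. std_normal_density y *\<^sub>R \<phi> (e * y))"
proof -
  let ?g = "\<lambda>\<xi>. exp (- (e * \<xi>)\<^sup>2 / 2)"
  let ?f = "\<lambda>\<xi> x. of_real (?g \<xi>) * (exp (- \<i> * complex_of_real (x * \<xi>)) * \<phi> x)"
  have [measurable]: "\<phi> \<in> borel_measurable borel" by (rule schwartz_measurable[OF assms(1)])
  have g: "?g \<xi> = sqrt (2 * pi) * std_normal_density (e * \<xi>)" for \<xi>
    by (simp add: std_normal_density_def)
  have intg: "integrable lborel ?g"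
    unfolding g using lborel_integrable_real_affine[of std_normal_density e 0] assms(2)
    by (intro integrable_mult_right) (simp add: integrable_normal_density)
  have int: "integrable (lborel \<Otimes>\<^sub>M lborel) (case_prod ?f)"
  proof (rule lborel_pair.Fubini_integrable)
    show "case_prod ?f \<in> borel_measurable (lborel \<Otimes>\<^sub>M lborel)" by measurable
    have "(\<lambda>\<xi>. LINT x|lborel. norm (case (\<xi>, x) of (\<xi>, x) \<Rightarrow> ?f \<xi> x))
        = (\<lambda>\<xi>. ?g \<xi> * (LINT x|lborel. norm (\<phi> x)))"
      by (simp add: norm_mult)
    then show "integrable lborel (\<lambda>\<xi>. LINT x|lborel. norm (case (\<xi>, x) of (\<xi>, x) \<Rightarrow> ?f \<xi> x))"
      using intg by simp
    show "AE \<xi> in lborel. integrable lborel (\<lambda>x. case (\<xi>, x) of (\<xi>, x) \<Rightarrow> ?f \<xi> x)"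
      using fourier_integrable[OF schwartz_integrable[OF assms(1)]] by simp
  qed
  \<comment> \<open>The substitution \<open>\<xi> = y / e\<close> turns the damping factor into a
    standard Gaussian, which is its own transform up to a constant; the two factors
    \<open>sqrt (2 * pi)\<close> combine to \<open>2 * pi\<close>.\<close>
  have inner: "(LINT \<xi>|lborel. ?f \<xi> x) = of_real (2 * pi / e) * (std_normal_density (x / e) *\<^sub>R \<phi> x)" for x
  proof -
    have "(LINT \<xi>|lborel. ?f \<xi> x) = (LINT \<xi>|lborel. of_real (?g \<xi>) * exp (- \<i> * complex_of_real (x * \<xi>))) * \<phi> x"
      by (simp add: mult.assoc[symmetric])
    also have "(LINT \<xi>|lborel. of_real (?g \<xi>) * exp (- \<i> * complex_of_real (x * \<xi>)))
        = (LINT y|lborel. of_real (?g (y / e)) * exp (- \<i> * complex_of_real (x * (y / e)))) / of_real e"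
      using lborel_integral_real_affine[of "1 / e" "\<lambda>\<xi>. of_real (?g \<xi>) * exp (- \<i> * complex_of_real (x * \<xi>))" 0] assms(2)
      by (simp add: scaleR_conv_of_real)
    also have "(LINT y|lborel. of_real (?g (y / e)) * exp (- \<i> * complex_of_real (x * (y / e))))
        = (LINT y|lborel. of_real (sqrt (2 * pi)) * (std_normal_density y *\<^sub>R exp (\<i> * of_real ((- x / e) * y))))"
      unfolding g using assms(2) by (simp add: scaleR_conv_of_real mult.assoc)
    also have "\<dots> = of_real (sqrt (2 * pi)) * of_real (exp (- (- x / e)\<^sup>2 / 2))"
      by (simp only: integral_mult_right_zero std_normal_fourier)
    also have "exp (- (- x / e)\<^sup>2 / 2) = sqrt (2 * pi) * std_normal_density (x / e)"
      by (simp add: std_normal_density_def)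
    also have "of_real (sqrt (2 * pi)) * of_real (sqrt (2 * pi) * std_normal_density (x / e))
        = complex_of_real (2 * pi * std_normal_density (x / e))"
      by (simp flip: of_real_mult)
    finally show ?thesis by (simp add: scaleR_conv_of_real)
  qed
  have "(LINT \<xi>|lborel. of_real (?g \<xi>) * fourier \<phi> \<xi>) = (LINT \<xi>|lborel. LINT x|lborel. ?f \<xi> x)"
    unfolding fourier_def by simp
  also have "\<dots> = (LINT x|lborel. LINT \<xi>|lborel. ?f \<xi> x)"
    by (rule lborel_pair.Fubini_integral[OF int, symmetric])
  also have "\<dots> = of_real (2 * pi / e) * (LINT x|lborel. std_normal_density (x / e) *\<^sub>R \<phi> x)"
    unfolding inner by (simp only: integral_mult_right_zero)
  also have "(LINT x|lborel. std_normal_density (x / e) *\<^sub>R \<phi> x)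
      = e *\<^sub>R (LINT y|lborel. std_normal_density y *\<^sub>R \<phi> (e * y))"
    using lborel_integral_real_affine[of e "\<lambda>x. std_normal_density (x / e) *\<^sub>R \<phi> x" 0] assms(2) by simp
  finally show ?thesis using assms(2) by (simp add: scaleR_conv_of_real)
qed

text \<open>Inversion at the origin, from \<open>fourier_gaussian\<close> as \<open>e\<close> tends
  to 0: on the left the damping factor tends to 1, on the right \<open>\<phi> (e * y)\<close> tends
  to \<open>\<phi> 0\<close> under a probability density.\<close>

lemma integral_fourier:
  assumes "\<phi> \<in> schwartz"
  shows "(LINT \<xi>|lborel. fourier \<phi> \<xi>) = of_real (2 * pi) * \<phi> 0"
proof -
  have [measurable]: "\<phi> \<in> borel_measurable borel" "fourier \<phi> \<in> borel_measurable borel"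
    by (intro schwartz_measurable schwartz_fourier assms)+
  have cont: "isCont \<phi> 0"
    using smooth_fun_continuous_0[OF schwartz_smooth[OF assms], of UNIV]
    by (simp add: continuous_on_eq_continuous_at)
  define e where "e n = inverse (real (Suc n))" for n
  have e: "e \<longlonglongrightarrow> 0" "e n > 0" for n
    using LIMSEQ_inverse_real_of_nat by (auto simp: e_def[abs_def])
  have mult_e: "(\<lambda>n. e n * y) \<longlonglongrightarrow> 0" for y using tendsto_mult_right[OF e(1), of y] by simp
  obtain B where B: "B \<ge> 0" "\<And>x. norm (\<phi> x) \<le> B / (1 + x\<^sup>2)" using schwartz_decay[OF assms] by blast
  have B': "norm (\<phi> x) \<le> B" for x
  proof -
    have "B / (1 + x\<^sup>2) \<le> B / 1" by (intro divide_left_mono B) (auto simp: add_pos_nonneg)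
    with B(2)[of x] show ?thesis by simp
  qed
  have "(\<lambda>n. LINT \<xi>|lborel. of_real (exp (- (e n * \<xi>)\<^sup>2 / 2)) * fourier \<phi> \<xi>)
      \<longlonglongrightarrow> (LINT \<xi>|lborel. of_real (exp (- (0::real)\<^sup>2 / 2)) * fourier \<phi> \<xi>)"
  proof (rule integral_dominated_convergence[where w = "\<lambda>\<xi>. norm (fourier \<phi> \<xi>)"])
    show "AE \<xi> in lborel. (\<lambda>n. of_real (exp (- (e n * \<xi>)\<^sup>2 / 2)) * fourier \<phi> \<xi>)
        \<longlonglongrightarrow> of_real (exp (- (0::real)\<^sup>2 / 2)) * fourier \<phi> \<xi>"
      by (intro AE_I2 tendsto_intros mult_e) simp
    show "integrable lborel (\<lambda>\<xi>. norm (fourier \<phi> \<xi>))"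
      by (intro integrable_norm schwartz_integrable schwartz_fourier assms)
  qed (auto simp: norm_mult mult_left_le_one_le)
  moreover have "(\<lambda>n. LINT y|lborel. std_normal_density y *\<^sub>R \<phi> (e n * y))
      \<longlonglongrightarrow> (LINT y|lborel. std_normal_density y *\<^sub>R \<phi> 0)"
  proof (rule integral_dominated_convergence[where w = "\<lambda>y. std_normal_density y * B"])
    show "AE y in lborel. (\<lambda>n. std_normal_density y *\<^sub>R \<phi> (e n * y)) \<longlonglongrightarrow> std_normal_density y *\<^sub>R \<phi> 0"
      by (intro AE_I2 tendsto_intros isCont_tendsto_compose[OF cont] mult_e)
    show "AE y in lborel. norm (std_normal_density y *\<^sub>R \<phi> (e n * y)) \<le> std_normal_density y * B" for n
      using B' by (intro AE_I2) (simp add: mult_left_mono)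
  qed (auto intro!: integrable_mult_left integrable_normal_density)
  then have "(\<lambda>n. of_real (2 * pi) * (LINT y|lborel. std_normal_density y *\<^sub>R \<phi> (e n * y)))
      \<longlonglongrightarrow> of_real (2 * pi) * (LINT y|lborel. std_normal_density y *\<^sub>R \<phi> 0)"
    by (rule tendsto_mult_left)
  ultimately have "(LINT \<xi>|lborel. of_real (exp (- (0::real)\<^sup>2 / 2)) * fourier \<phi> \<xi>)
      = of_real (2 * pi) * (LINT y|lborel. std_normal_density y *\<^sub>R \<phi> 0)"
    by (subst (asm) fourier_gaussian[OF assms e(2)]) (rule LIMSEQ_unique)
  moreover have "(LINT y|lborel. std_normal_density y *\<^sub>R \<phi> 0) = \<phi> 0"
    by (simp add: integral_normal_density)
  ultimately show ?thesis by simp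
qed

text \<open>Translation by \<open>x\<close> multiplies the transform by a character, which reduces
  inversion at \<open>x\<close> to inversion at the origin.\<close>

lemma inv_fourier_fourier:
  assumes "\<phi> \<in> schwartz"
  shows "inv_fourier (fourier \<phi>) = \<phi>"
proof
  fix x
  have "exp (\<i> * complex_of_real (x * \<xi>)) * fourier \<phi> \<xi> = fourier (\<lambda>y. \<phi> (y + x)) \<xi>" for \<xi>
  proof -
    have "fourier \<phi> \<xi> = (LINT y|lborel. exp (- \<i> * complex_of_real ((y + x) * \<xi>)) * \<phi> (y + x))"
      unfolding fourier_def by (rule integral_translate[symmetric])
    also have "\<dots> = (LINT y|lborel. exp (- \<i> * complex_of_real (x * \<xi>)) * (exp (- \<i> * complex_of_real (y * \<xi>)) * \<phi> (y + x)))"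
      by (simp add: distrib_right distrib_left exp_add mult_ac exp_diff exp_minus divide_inverse)
    also have "\<dots> = exp (- \<i> * complex_of_real (x * \<xi>)) * fourier (\<lambda>y. \<phi> (y + x)) \<xi>"
      unfolding fourier_def by (rule integral_mult_right_zero)
    finally show ?thesis by (simp add: exp_minus)
  qed
  then have "inv_fourier (fourier \<phi>) x = (LINT \<xi>|lborel. fourier (\<lambda>y. \<phi> (y + x)) \<xi>) / of_real (2 * pi)"
    by (simp add: inv_fourier_def)
  also have "\<dots> = \<phi> x"
    using integral_fourier[OF schwartz_affine[OF assms, of 1 x]] by simp
  finally show "inv_fourier (fourier \<phi>) x = \<phi> x" .
qed

text \<open>Reflecting the integration variable exchanges the two transforms up to the factor
  \<open>2 * pi\<close>, so the other order of inversion applies.\<close>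

lemma fourier_inv_fourier:
  assumes "\<phi> \<in> schwartz"
  shows "fourier (inv_fourier \<phi>) = \<phi>"
proof
  fix x
  have "fourier (inv_fourier \<phi>) x = (LINT y|lborel. exp (- \<i> * complex_of_real (y * x)) * inv_fourier \<phi> y)"
    by (simp add: fourier_def)
  also have "\<dots> = (LINT y|lborel. exp (- \<i> * complex_of_real ((0 - y) * x)) * inv_fourier \<phi> (0 - y))"
    by (rule integral_reflect[symmetric])
  also have "\<dots> = inv_fourier (fourier \<phi>) x"
  proof -
    have "exp (- \<i> * complex_of_real ((0 - y) * x)) * inv_fourier \<phi> (0 - y)
        = exp (\<i> * complex_of_real (x * y)) * fourier \<phi> y / of_real (2 * pi)" for y
      by (simp add: inv_fourier_eq mult.commute)
    then show ?thesis by (simp only: integral_divide_zero inv_fourier_def[of "fourier \<phi>"])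
  qed
  finally show "fourier (inv_fourier \<phi>) x = \<phi> x" by (simp add: inv_fourier_fourier[OF assms])
qed

text \<open>Fubini. The kernel appears transposed, with \<open>x\<close> as the integration
  variable, because \<open>box\<close> acts on a distribution through its test function.\<close>

lemma fourier_mult_inv_fourier:
  assumes "a \<in> schwartz" "\<phi> \<in> schwartz"
  shows "fourier (\<lambda>\<xi>. a \<xi> * inv_fourier \<phi> \<xi>) y = (LINT x|lborel. inv_fourier a (x - y) * \<phi> x)"
proof -
  have [measurable]: "a \<in> borel_measurable borel" "\<phi> \<in> borel_measurable borel"
    by (intro schwartz_measurable assms)+
  let ?f = "\<lambda>\<xi> x. exp (\<i> * complex_of_real ((x - y) * \<xi>)) * a \<xi> * \<phi> x / of_real (2 * pi)"
  have int: "integrable (lborel \<Otimes>\<^sub>M lborel) (case_prod ?f)"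
  proof (rule lborel_pair.Fubini_integrable)
    show "case_prod ?f \<in> borel_measurable (lborel \<Otimes>\<^sub>M lborel)" by measurable
    have "(\<lambda>\<xi>. LINT x|lborel. norm (case (\<xi>, x) of (\<xi>, x) \<Rightarrow> ?f \<xi> x))
        = (\<lambda>\<xi>. norm (a \<xi>) * ((LINT x|lborel. norm (\<phi> x)) / (2 * pi)))"
      by (simp add: norm_mult norm_divide)
    then show "integrable lborel (\<lambda>\<xi>. LINT x|lborel. norm (case (\<xi>, x) of (\<xi>, x) \<Rightarrow> ?f \<xi> x))"
      using schwartz_integrable[OF assms(1)] by (simp only: integrable_mult_left integrable_norm)
    have "integrable lborel (?f \<xi>)" for \<xi>
    proof (rule Bochner_Integration.integrable_bound)
      show "integrable lborel (\<lambda>x. (a \<xi> / of_real (2 * pi)) * \<phi> x)"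
        by (intro integrable_mult_right schwartz_integrable assms)
    qed (auto simp: norm_mult norm_divide)
    then show "AE \<xi> in lborel. integrable lborel (\<lambda>x. case (\<xi>, x) of (\<xi>, x) \<Rightarrow> ?f \<xi> x)"
      by simp
  qed
  have "fourier (\<lambda>\<xi>. a \<xi> * inv_fourier \<phi> \<xi>) y = (LINT \<xi>|lborel. LINT x|lborel. ?f \<xi> x)"
  proof -
    have "exp (- \<i> * complex_of_real (\<xi> * y)) * (a \<xi> * inv_fourier \<phi> \<xi>) = (LINT x|lborel. ?f \<xi> x)" for \<xi>
    proof -
      have "(LINT x|lborel. ?f \<xi> x) = (LINT x|lborel. (exp (- \<i> * complex_of_real (\<xi> * y)) * a \<xi> / of_real (2 * pi)) *
          (exp (\<i> * complex_of_real (\<xi> * x)) * \<phi> x))"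
      proof -
        have "exp (\<i> * complex_of_real ((x - y) * \<xi>))
            = exp (- \<i> * complex_of_real (\<xi> * y)) * exp (\<i> * complex_of_real (\<xi> * x))" for x
          by (simp add: exp_add[symmetric] algebra_simps)
        then show ?thesis by (simp add: mult_ac)
      qed
      also have "\<dots> = (exp (- \<i> * complex_of_real (\<xi> * y)) * a \<xi> / of_real (2 * pi)) *
          (LINT x|lborel. exp (\<i> * complex_of_real (\<xi> * x)) * \<phi> x)"
        by (rule integral_mult_right_zero)
      finally show ?thesis by (simp add: inv_fourier_def)
    qed
    then show ?thesis by (simp add: fourier_def)
  qed
  also have "\<dots> = (LINT x|lborel. LINT \<xi>|lborel. ?f \<xi> x)"
    by (rule lborel_pair.Fubini_integral[OF int, symmetric])
  also have "\<dots> = (LINT x|lborel. inv_fourier a (x - y) * \<phi> x)"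
  proof -
    have "(LINT \<xi>|lborel. ?f \<xi> x) = inv_fourier a (x - y) * \<phi> x" for x
      by (simp add: inv_fourier_def)
    then show ?thesis by simp
  qed
  finally show ?thesis .
qed

section \<open>Convolution and testing\<close>

text \<open>The first factor is the smooth kernel, which takes all derivatives; the second one is
  merely bounded and measurable in what follows.\<close>

definition conv :: "(real \<Rightarrow> complex) \<Rightarrow> (real \<Rightarrow> complex) \<Rightarrow> real \<Rightarrow> complex" where
  "conv A g x = (LINT y|lborel. A (x - y) * g y)"

context
  fixes g :: "real \<Rightarrow> complex" and M :: real
  assumes g_meas [measurable]: "g \<in> borel_measurable borel" and g_bound: "\<And>x. norm (g x) \<le> M"
begin

lemma bounded_nonneg: "M \<ge> 0"
  using order_trans[OF norm_ge_zero g_bound[of 0]] .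

lemma integrable_mult_bounded:
  assumes "integrable lborel f"
  shows "integrable lborel (\<lambda>x. f x * g x)" "integrable lborel (\<lambda>x. g x * f x)"
proof -
  have [measurable]: "f \<in> borel_measurable borel" using borel_measurable_integrable[OF assms] by simp
  show *: "integrable lborel (\<lambda>x. f x * g x)"
  proof (rule Bochner_Integration.integrable_bound[where f = "\<lambda>x. M * norm (f x)"])
    show "AE x in lborel. norm (f x * g x) \<le> norm (M * norm (f x))"
      using g_bound bounded_nonneg by (intro AE_I2) (auto simp: norm_mult mult.commute[of M] mult_left_mono)
  qed (use assms in \<open>auto intro!: integrable_mult_right\<close>)
  then show "integrable lborel (\<lambda>x. g x * f x)" by (simp add: mult.commute)
qed

lemma conv_integrable:
  assumes "A \<in> schwartz"
  shows "integrable lborel (\<lambda>y. A (x - y) * g y)"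
  by (intro integrable_mult_bounded(1) integrable_reflect schwartz_integrable assms)

lemma norm_integral_mult_bounded:
  assumes "integrable lborel f"
  shows "norm (LINT x|lborel. f x * g x) \<le> M * (LINT x|lborel. norm (f x))"
proof -
  have "norm (LINT x|lborel. f x * g x) \<le> (LINT x|lborel. norm (f x * g x))"
    by (rule integral_norm_bound)
  also have "\<dots> \<le> (LINT x|lborel. M * norm (f x))"
    using integrable_norm[OF integrable_mult_bounded(1)[OF assms]] assms g_bound
    by (intro integral_mono) (auto intro!: integrable_mult_right simp: norm_mult mult.commute[of M] mult_left_mono)
  finally show ?thesis by simp
qed

lemma norm_conv_le:
  assumes "A \<in> schwartz"
  shows "norm (conv A g x) \<le> M * (LINT y|lborel. norm (A y))"
  using norm_integral_mult_bounded[OF integrable_reflect[OF schwartz_integrable[OF assms]], of x]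
  by (simp add: conv_def integral_reflect[of "\<lambda>y. norm (A y)"])

lemma conv_has_vector_derivative:
  assumes "A \<in> schwartz"
  shows "(conv A g has_vector_derivative conv (vderiv (Suc 0) A) g x) (at x)"
proof -
  obtain B where B: "B \<ge> 0" "\<And>x. norm (vderiv (Suc 0) A x) \<le> B / (1 + x\<^sup>2)"
    using schwartz_decay[OF schwartz_vderiv[OF assms]] by blast
  have [measurable]: "vderiv (Suc 0) A \<in> borel_measurable borel"
    by (intro schwartz_measurable schwartz_vderiv assms)
  have "((\<lambda>x. LINT y|lborel. A (x - y) * g y) has_vector_derivative
      (LINT y|lborel. vderiv (Suc 0) A (x - y) * g y)) (at x)"
  \<comment> \<open>The kernel's derivative at \<open>t - y\<close> is compared with the majorant
    centred at \<open>x - y\<close>; since \<open>t\<close> stays within distance 1 of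
    \<open>x\<close>, this costs the factor 3.\<close>
  proof (rule has_vector_derivative_integral[where e = 1 and w = "\<lambda>y. (3 * B * M) * (1 / (1 + (x - y)\<^sup>2))"])
    fix t y :: real
    show "((\<lambda>t. A (t - y) * g y) has_vector_derivative vderiv (Suc 0) A (t - y) * g y) (at t)"
      using has_vector_derivative_affine[OF smooth_fun_has_vderiv_0[OF schwartz_smooth[OF assms]],
          where a = 1 and x = t and c = "- y"]
      by (auto intro!: has_vector_derivative_mult_left)
    show "norm (vderiv (Suc 0) A (t - y) * g y) \<le> (3 * B * M) * (1 / (1 + (x - y)\<^sup>2))"
      if "\<bar>t - x\<bar> < 1"
    proof -
      have "norm (vderiv (Suc 0) A (t - y)) \<le> B * (1 / (1 + ((x - y) + (t - x))\<^sup>2))"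
        using B(2)[of "t - y"] by simp
      also have "\<dots> \<le> B * (3 / (1 + (x - y)\<^sup>2))"
        using that by (intro mult_left_mono inverse_1_plus_square_shift B) auto
      finally have "norm (vderiv (Suc 0) A (t - y)) * norm (g y) \<le> B * (3 / (1 + (x - y)\<^sup>2)) * M"
        using g_bound B(1) by (intro mult_mono) auto
      then show ?thesis by (simp add: norm_mult mult_ac)
    qed
    show "integrable lborel (\<lambda>y. A (t - y) * g y)" by (rule conv_integrable[OF assms])
    show "integrable lborel (\<lambda>y. (3 * B * M) * (1 / (1 + (x - y)\<^sup>2)))"
      using integrable_reflect[OF integrable_inverse_1_plus_square, of x] by (intro integrable_mult_right)
    show "(\<lambda>y. vderiv (Suc 0) A (x - y) * g y) \<in> borel_measurable lborel" by measurable
  qed simp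
  then show ?thesis by (simp add: conv_def[abs_def])
qed

lemma conv_smooth:
  assumes "A \<in> schwartz"
  shows "smooth_fun (conv A g)" and "vderiv j (conv A g) = conv (vderiv j A) g"
proof -
  have D: "(conv (vderiv i A) g has_vector_derivative conv (vderiv (Suc i) A) g x) (at x)" for i x
    using conv_has_vector_derivative[OF schwartz_vderiv[OF assms], of i x] by (simp add: vderiv_vderiv)
  show "smooth_fun (conv A g)"
    by (rule smooth_funI[where D = "\<lambda>i. conv (vderiv i A) g"]) (use D in auto)
  show "vderiv j (conv A g) = conv (vderiv j A) g"
    by (rule vderiv_eqI[where D = "\<lambda>i. conv (vderiv i A) g" and k = j]) (use D in auto)
qed

lemma conv_measurable: "A \<in> schwartz \<Longrightarrow> conv A g \<in> borel_measurable borel"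
  by (intro borel_measurable_continuous_onI smooth_fun_continuous_0 conv_smooth)

text \<open>By duality the multiplier \<open>a\<close> acts on \<open>g\<close> as convolution with
  \<open>inv_fourier a\<close>. Since \<open>g\<close> is only bounded, absolute convergence comes
  from the kernel and the test function.\<close>

lemma integral_mult_multiplier:
  assumes "a \<in> schwartz" "\<phi> \<in> schwartz"
  shows "(LINT y|lborel. g y * fourier (\<lambda>\<xi>. a \<xi> * inv_fourier \<phi> \<xi>) y)
    = (LINT x|lborel. conv (inv_fourier a) g x * \<phi> x)"
proof -
  let ?A = "inv_fourier a"
  have A: "?A \<in> schwartz" by (rule schwartz_inv_fourier[OF assms(1)])
  have [measurable]: "?A \<in> borel_measurable borel" "\<phi> \<in> borel_measurable borel"
    by (intro schwartz_measurable A assms)+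
  let ?f = "\<lambda>x y. ?A (x - y) * g y * \<phi> x"
  have int: "integrable (lborel \<Otimes>\<^sub>M lborel) (case_prod ?f)"
  proof (rule lborel_pair.Fubini_integrable)
    show meas: "case_prod ?f \<in> borel_measurable (lborel \<Otimes>\<^sub>M lborel)" by measurable
    show "integrable lborel (\<lambda>x. LINT y|lborel. norm (case (x, y) of (x, y) \<Rightarrow> ?f x y))"
    proof (rule Bochner_Integration.integrable_bound)
      show "integrable lborel (\<lambda>x. (M * (LINT y|lborel. norm (?A y))) * norm (\<phi> x))"
        by (intro integrable_mult_right integrable_norm schwartz_integrable assms)
      show "(\<lambda>x. LINT y|lborel. norm (case (x, y) of (x, y) \<Rightarrow> ?f x y)) \<in> borel_measurable lborel"
        by measurable
      show "AE x in lborel. norm (LINT y|lborel. norm (case (x, y) of (x, y) \<Rightarrow> ?f x y))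
          \<le> norm ((M * (LINT y|lborel. norm (?A y))) * norm (\<phi> x))"
      proof (rule AE_I2)
        fix x
        have "norm (?f x y) \<le> (M * norm (\<phi> x)) * norm (?A (x - y))" for y
          using mult_right_mono[OF g_bound[of y], of "norm (\<phi> x) * norm (?A (x - y))"]
          by (simp add: norm_mult mult_ac)
        then have "(LINT y|lborel. norm (?f x y)) \<le> (LINT y|lborel. (M * norm (\<phi> x)) * norm (?A (x - y)))"
          by (intro integral_mono integrable_norm integrable_mult_left integrable_mult_right conv_integrable
              integrable_reflect schwartz_integrable A)
        also have "\<dots> = (M * (LINT y|lborel. norm (?A y))) * norm (\<phi> x)"
          by (simp add: integral_reflect[of "\<lambda>y. norm (?A y)"] mult_ac)
        finally have "(LINT y|lborel. norm (?f x y)) \<le> (M * (LINT y|lborel. norm (?A y))) * norm (\<phi> x)" .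
        moreover have "0 \<le> (LINT y|lborel. norm (?f x y))" by simp
        ultimately show "norm (LINT y|lborel. norm (case (x, y) of (x, y) \<Rightarrow> ?f x y))
          \<le> norm ((M * (LINT y|lborel. norm (?A y))) * norm (\<phi> x))" by simp
      qed
    qed
    show "AE x in lborel. integrable lborel (\<lambda>y. case (x, y) of (x, y) \<Rightarrow> ?f x y)"
      by (simp add: integrable_mult_left conv_integrable[OF A])
  qed
  have "g y * fourier (\<lambda>\<xi>. a \<xi> * inv_fourier \<phi> \<xi>) y = (LINT x|lborel. ?f x y)" for y
    unfolding fourier_mult_inv_fourier[OF assms] integral_mult_right_zero[symmetric] by (simp add: mult_ac)
  then have "(LINT y|lborel. g y * fourier (\<lambda>\<xi>. a \<xi> * inv_fourier \<phi> \<xi>) y) = (LINT y|lborel. LINT x|lborel. ?f x y)"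
    by simp
  also have "\<dots> = (LINT x|lborel. LINT y|lborel. ?f x y)"
    by (rule lborel_pair.Fubini_integral[OF int])
  also have "\<dots> = (LINT x|lborel. conv ?A g x * \<phi> x)"
    by (simp add: conv_def)
  finally show ?thesis .
qed

lemma represents_reg_dist: "represents g (reg_dist g)"
  unfolding represents_def by (auto intro: integrable_mult_bounded schwartz_integrable)

lemma tempered_reg_dist: "tempered (reg_dist g)"
  unfolding tempered_def
proof (intro conjI ballI allI)
  have int: "integrable lborel (\<lambda>x. g x * \<phi> x)" if "\<phi> \<in> schwartz" for \<phi>
    by (intro integrable_mult_bounded schwartz_integrable that)
  show "reg_dist g (\<lambda>x. \<phi> x + \<psi> x) = reg_dist g \<phi> + reg_dist g \<psi>" if "\<phi> \<in> schwartz" "\<psi> \<in> schwartz" for \<phi> \<psi>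
    unfolding reg_dist_def distrib_left by (intro Bochner_Integration.integral_add int that)
  show "reg_dist g (\<lambda>x. c * \<phi> x) = c * reg_dist g \<phi>" for c \<phi>
    unfolding reg_dist_def mult.left_commute[of "g _"] by (rule integral_mult_right_zero)
  \<comment> \<open>The seminorms with weights of power 0 and 2 and no derivative bound
    \<open>\<phi>\<close> by a multiple of \<open>1 / (1 + x\<^sup>2)\<close>, whose integral is the
    second factor of \<open>K\<close>.\<close>
  define K where "K = M * (LINT x|lborel. 1 / (1 + (x::real)\<^sup>2))"
  have "norm (reg_dist g \<phi>) \<le> K * (\<Sum>m\<le>2. \<Sum>n\<le>2. SUP x. norm ((x ^ m) *\<^sub>R vderiv n \<phi> x))"
    if \<phi>: "\<phi> \<in> schwartz" for \<phi>
  proof -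
    define p where "p m n = (SUP x. norm ((x ^ m) *\<^sub>R vderiv n \<phi> x))" for m n
    have bdd: "bdd_above (range (\<lambda>x. norm ((x ^ m) *\<^sub>R vderiv n \<phi> x)))" for m n
    proof -
      obtain B where "\<And>x. \<bar>x\<bar> ^ m * norm (vderiv n \<phi> x) \<le> B" using schwartz_bound[OF \<phi>] by blast
      then show ?thesis by (intro bdd_aboveI2[where M = B]) (simp add: power_abs)
    qed
    have le: "norm ((x ^ m) *\<^sub>R vderiv n \<phi> x) \<le> p m n" for x m n
      unfolding p_def by (rule cSUP_upper[OF UNIV_I bdd])
    have nonneg: "0 \<le> p m n" for m n using order_trans[OF norm_ge_zero le] .
    have pt: "norm (\<phi> x) \<le> (p 0 0 + p 2 0) * (1 / (1 + x\<^sup>2))" for x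
      using le[of x 0 0] le[of x 2 0] by (simp add: field_simps add_pos_nonneg)
    have "norm (reg_dist g \<phi>) \<le> M * (LINT x|lborel. norm (\<phi> x))"
      unfolding reg_dist_def mult.commute[of "g _"]
      by (intro norm_integral_mult_bounded schwartz_integrable \<phi>)
    also have "(LINT x|lborel. norm (\<phi> x)) \<le> (LINT x|lborel. (p 0 0 + p 2 0) * (1 / (1 + x\<^sup>2)))"
      using pt by (intro integral_mono integrable_norm schwartz_integrable \<phi> integrable_mult_right
          integrable_inverse_1_plus_square)
    also have "\<dots> = (p 0 0 + p 2 0) * (LINT x|lborel. 1 / (1 + (x::real)\<^sup>2))"
      by (rule integral_mult_right_zero)
    finally have "norm (reg_dist g \<phi>) \<le> K * (p 0 0 + p 2 0)"
      using bounded_nonneg by (simp add: K_def mult.assoc mult.commute[of "p 0 0 + p 2 0"] mult_left_mono)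
    also have "\<dots> \<le> K * (\<Sum>m\<le>2. \<Sum>n\<le>2. p m n)"
    proof (rule mult_left_mono)
      have "{..2::nat} = {0, 1, 2}" by auto
      then show "p 0 0 + p 2 0 \<le> (\<Sum>m\<le>2. \<Sum>n\<le>2. p m n)"
        using nonneg by (simp add: add_nonneg_nonneg)
      show "0 \<le> K" using bounded_nonneg by (simp add: K_def)
    qed
    finally show ?thesis by (simp add: p_def)
  qed
  then show "\<exists>C N. \<forall>\<phi>\<in>schwartz.
      norm (reg_dist g \<phi>) \<le> C * (\<Sum>m\<le>N. \<Sum>n\<le>N. SUP x. norm ((x ^ m) *\<^sub>R vderiv n \<phi> x))"
    by blast
qed

end

section \<open>Bounded representatives of distributions\<close>

lemma esssup_lborel_le:
  fixes g :: "real \<Rightarrow> complex"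
  assumes "g \<in> borel_measurable borel" "\<And>x. norm (g x) \<le> c"
  shows "esssup lborel (\<lambda>x. ennreal (norm (g x))) \<le> ennreal c"
  using assms by (intro esssup_I) (auto simp: ennreal_leI)

lemma Linf_dist_le:
  assumes "g \<in> borel_measurable borel" "\<And>x. norm (g x) \<le> c" "represents g u"
  shows "Linf_dist u \<le> ennreal c"
  unfolding Linf_dist_def
  by (rule INF_lower2[where i = g]) (use assms esssup_lborel_le[of g c] in auto)

text \<open>The infimum may not be attained, hence the strict inequality. Setting the representative
  to 0 on the null set where it exceeds \<open>c\<close> makes the bound hold at every point and
  changes no integral.\<close>

lemma Linf_dist_obtain:
  assumes "Linf_dist u < ennreal c"
  obtains g where "g \<in> borel_measurable borel" "\<And>x. norm (g x) \<le> c" "represents g u"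
proof -
  obtain f where f: "f \<in> borel_measurable borel" "represents f u"
      "esssup lborel (\<lambda>x. ennreal (norm (f x))) < ennreal c"
    using assms unfolding Linf_dist_def INF_less_iff by auto
  have c: "c > 0" using assms by (metis ennreal_eq_0_iff not_gr_zero not_less not_less_zero order.strict_trans1 linorder_not_le)
  have [measurable]: "f \<in> borel_measurable borel" by (rule f)
  have "AE x in lborel. ennreal (norm (f x)) \<le> esssup lborel (\<lambda>x. ennreal (norm (f x)))"
    by (rule esssup_AE)
  then have ae: "AE x in lborel. norm (f x) \<le> c"
  proof eventually_elim
    case (elim x)
    with f(3) have "ennreal (norm (f x)) \<le> ennreal c" by (meson le_less_trans less_imp_le)
    then show ?case using c by (simp add: ennreal_le_iff)
  qed
  define g where "g x = (if norm (f x) \<le> c then f x else 0)" for x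
  have g: "g \<in> borel_measurable borel" unfolding g_def by measurable
  have [measurable]: "g \<in> borel_measurable borel" by (rule g)
  have "represents g u"
    unfolding represents_def
  proof (intro ballI conjI)
    fix \<phi> assume \<phi>: "\<phi> \<in> schwartz"
    have [measurable]: "\<phi> \<in> borel_measurable borel" by (rule schwartz_measurable[OF \<phi>])
    have eq: "AE x in lborel. f x * \<phi> x = g x * \<phi> x"
      using ae by eventually_elim (simp add: g_def)
    have int: "integrable lborel (\<lambda>x. f x * \<phi> x)" and u: "u \<phi> = (LINT x|lborel. f x * \<phi> x)"
      using f(2) \<phi> by (auto simp: represents_def reg_dist_def)
    have "integrable lborel (\<lambda>x. f x * \<phi> x) \<longleftrightarrow> integrable lborel (\<lambda>x. g x * \<phi> x)"
      by (rule integrable_cong_AE) (use eq in measurable)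
    with int show "integrable lborel (\<lambda>x. g x * \<phi> x)" by simp
    have "(LINT x|lborel. f x * \<phi> x) = (LINT x|lborel. g x * \<phi> x)"
      by (rule integral_cong_AE) (use eq in measurable)
    with u show "u \<phi> = reg_dist g \<phi>" by (simp add: reg_dist_def)
  qed
  with g c show ?thesis by (intro that[of g]) (auto simp: g_def)
qed

section \<open>Modulation spaces\<close>

text \<open>The Weierstrass test for sums over the integers. Symmetric intervals are cofinal among
  the finite sets, so unordered sums become sequential limits, and the tail of \<open>b\<close>
  bounds the error uniformly in \<open>x\<close>.\<close>

lemma uniform_limit_infsum_int:
  fixes g :: "int \<Rightarrow> 'b \<Rightarrow> 'a::banach"
  assumes b: "b summable_on UNIV" and le: "\<And>k x. norm (g k x) \<le> b k"
  shows "uniform_limit UNIV (\<lambda>N x. \<Sum>k\<in>{-int N..int N}. g k x) (\<lambda>x. \<Sum>\<^sub>\<infinity>k. g k x) sequentially"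
    and "norm (\<Sum>\<^sub>\<infinity>k. g k x) \<le> (\<Sum>\<^sub>\<infinity>k. b k)"
proof -
  let ?A = "\<lambda>N. {-int N..int N}"
  have abs: "(\<lambda>k. norm (g k x)) summable_on S" for x S
  proof (rule summable_on_comparison_test[where f = b])
    show "b summable_on S" using b by (rule summable_on_subset_banach) simp
  qed (use le in auto)
  have sum: "(\<lambda>k. g k x) summable_on S" for x S
    using abs by (rule abs_summable_summable)
  have bS: "b summable_on S" for S using b by (rule summable_on_subset_banach) simp
  have norm_le: "norm (\<Sum>\<^sub>\<infinity>k\<in>S. g k x) \<le> (\<Sum>\<^sub>\<infinity>k\<in>S. b k)" for x S
    using norm_infsum_bound[OF abs[of x S]] infsum_mono[OF abs[of x S] bS le] by (rule order_trans)
  show "norm (\<Sum>\<^sub>\<infinity>k. g k x) \<le> (\<Sum>\<^sub>\<infinity>k. b k)" by (rule norm_le)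
  have lim: "filterlim ?A (finite_subsets_at_top UNIV) sequentially"
    unfolding filterlim_finite_subsets_at_top
  proof (intro allI impI)
    fix X :: "int set" assume X: "finite X \<and> X \<subseteq> UNIV"
    obtain N where N: "\<And>k. k \<in> X \<Longrightarrow> \<bar>k\<bar> \<le> N"
      using X finite_nat_iff_bounded_le by (metis Max_ge finite_imageI image_eqI)
    show "\<forall>\<^sub>F n in sequentially. finite (?A n) \<and> X \<subseteq> ?A n \<and> ?A n \<subseteq> UNIV"
      using eventually_ge_at_top[of "nat N"]
    proof eventually_elim
      case (elim n)
      have "X \<subseteq> ?A n"
      proof
        fix k assume "k \<in> X"
        from N[OF this] elim show "k \<in> ?A n" by auto
      qed
      then show ?case by simp
    qed
  qed
  have "(\<lambda>N. \<Sum>k\<in>?A N. b k) \<longlonglongrightarrow> (\<Sum>\<^sub>\<infinity>k. b k)"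
    using filterlim_compose[OF infsum_tendsto[OF b] lim] by (simp add: o_def)
  then have tail: "(\<lambda>N. (\<Sum>\<^sub>\<infinity>k. b k) - (\<Sum>k\<in>?A N. b k)) \<longlonglongrightarrow> 0"
    by (auto intro: tendsto_eq_intros)
  have diff: "norm ((\<Sum>k\<in>?A N. g k x) - (\<Sum>\<^sub>\<infinity>k. g k x)) \<le> (\<Sum>\<^sub>\<infinity>k. b k) - (\<Sum>k\<in>?A N. b k)" for N x
  proof -
    have "(\<Sum>\<^sub>\<infinity>k. g k x) = (\<Sum>\<^sub>\<infinity>k\<in>?A N. g k x) + (\<Sum>\<^sub>\<infinity>k\<in>UNIV - ?A N. g k x)"
      by (subst infsum_Un_disjoint[symmetric]) (auto simp: sum intro!: arg_cong[where f = "infsum _"])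
    moreover have "(\<Sum>\<^sub>\<infinity>k. b k) = (\<Sum>\<^sub>\<infinity>k\<in>?A N. b k) + (\<Sum>\<^sub>\<infinity>k\<in>UNIV - ?A N. b k)"
      by (subst infsum_Un_disjoint[symmetric]) (auto simp: bS intro!: arg_cong[where f = "infsum _"])
    ultimately show ?thesis using norm_le[of x "UNIV - ?A N"] by simp
  qed
  show "uniform_limit UNIV (\<lambda>N x. \<Sum>k\<in>?A N. g k x) (\<lambda>x. \<Sum>\<^sub>\<infinity>k. g k x) sequentially"
  proof (rule uniform_limitI)
    fix e :: real assume "e > 0"
    from order_tendstoD(2)[OF tail this]
    show "\<forall>\<^sub>F N in sequentially. \<forall>x\<in>UNIV. dist (\<Sum>k\<in>?A N. g k x) (\<Sum>\<^sub>\<infinity>k. g k x) < e"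
      by eventually_elim (auto simp: dist_norm intro: le_less_trans[OF diff])
  qed
qed

text \<open>Differentiability is local, so \<open>has_derivative_sequence\<close> is applied on a
  ball of radius 1; the limit \<open>h\<close> that it produces agrees there with \<open>g\<close>
  by uniqueness of limits.\<close>

lemma has_vector_derivative_uniform_limit:
  fixes f :: "nat \<Rightarrow> real \<Rightarrow> 'a::banach"
  assumes D: "\<And>n x. (f n has_vector_derivative f' n x) (at x)"
    and f': "\<And>r. uniform_limit {-r..r} f' g' sequentially"
    and f: "\<And>x. (\<lambda>n. f n x) \<longlonglongrightarrow> g x"
  shows "(g has_vector_derivative g' x) (at x)"
proof -
  define S where "S = ball x 1"
  have "\<exists>h. \<forall>y\<in>S. (\<lambda>n. f n y) \<longlonglongrightarrow> h y \<and> (h has_derivative (\<lambda>t. t *\<^sub>R g' y)) (at y within S)"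
  proof (rule has_derivative_sequence[where f' = "\<lambda>n y t. t *\<^sub>R f' n y" and ?x0.0 = x and l = "g x"])
    show "convex S" "x \<in> S" by (auto simp: S_def)
    show "(f n has_derivative (\<lambda>t. t *\<^sub>R f' n y)) (at y within S)" for n y
      using D[of n y] by (auto simp: has_vector_derivative_def intro: has_derivative_at_withinI)
    show "(\<lambda>n. f n x) \<longlonglongrightarrow> g x" by (rule f)
    fix e :: real assume e: "e > 0"
    have "uniform_limit {-(\<bar>x\<bar> + 1)..\<bar>x\<bar> + 1} f' g' sequentially" by (rule f')
    from uniform_limitD[OF this e]
    show "\<forall>\<^sub>F n in sequentially. \<forall>y\<in>S. \<forall>h. norm (h *\<^sub>R f' n y - h *\<^sub>R g' y) \<le> e * norm h"
    proof eventually_elim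
      case (elim n)
      show ?case
      proof (intro ballI allI)
        fix y h assume "y \<in> S"
        then have "y \<in> {-(\<bar>x\<bar> + 1)..\<bar>x\<bar> + 1}" by (auto simp: S_def dist_real_def)
        with elim have "norm (f' n y - g' y) \<le> e" by (auto simp: dist_norm intro: less_imp_le)
        then show "norm (h *\<^sub>R f' n y - h *\<^sub>R g' y) \<le> e * norm h"
          by (simp flip: scaleR_diff_right add: mult.commute[of e] mult_left_mono)
      qed
    qed
  qed
  then obtain h where h: "\<And>y. y \<in> S \<Longrightarrow> (\<lambda>n. f n y) \<longlonglongrightarrow> h y"
      "\<And>y. y \<in> S \<Longrightarrow> (h has_derivative (\<lambda>t. t *\<^sub>R g' y)) (at y within S)" by blast
  have gh: "g y = h y" if "y \<in> S" for y using LIMSEQ_unique[OF f h(1)[OF that]] .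
  have "(h has_vector_derivative g' x) (at x)"
  proof -
    have "x \<in> S" "open S" by (auto simp: S_def)
    from h(2)[OF this(1)] at_within_open[OF this] show ?thesis
      unfolding has_vector_derivative_def by (simp only:)
  qed
  then show ?thesis
    by (rule has_vector_derivative_transform_within_open[where S = S]) (auto simp: S_def gh)
qed

lemma box_apply:
  "box \<eta> k u \<phi> = u (fourier (\<lambda>\<xi>. complex_of_real (\<eta> (\<xi> - of_int k)) * inv_fourier \<phi> \<xi>))"
  by (simp add: box_def inv_fourier_dist_def mult_dist_def fourier_dist_def)

lemma tempered_add:
  "tempered u \<Longrightarrow> \<phi> \<in> schwartz \<Longrightarrow> \<psi> \<in> schwartz \<Longrightarrow> u (\<lambda>x. \<phi> x + \<psi> x) = u \<phi> + u \<psi>"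
  by (simp add: tempered_def)

lemma tempered_cmult:
  "tempered u \<Longrightarrow> \<phi> \<in> schwartz \<Longrightarrow> u (\<lambda>x. c * \<phi> x) = c * u \<phi>"
  by (simp add: tempered_def)

lemma tempered_sum:
  assumes "tempered u" "finite A" "\<And>i. i \<in> A \<Longrightarrow> f i \<in> schwartz"
  shows "u (\<lambda>x. \<Sum>i\<in>A. f i x) = (\<Sum>i\<in>A. u (f i))"
  using assms(2,3)
proof (induction A rule: finite_induct)
  case empty
  show ?case using tempered_cmult[OF assms(1) schwartz_0, of 0] by simp
next
  case (insert i A)
  then have "u (\<lambda>x. f i x + (\<Sum>i\<in>A. f i x)) = u (f i) + u (\<lambda>x. \<Sum>i\<in>A. f i x)"
    using schwartz_sum[of A f] by (intro tempered_add assms(1)) (simp_all add: insert)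
  with insert show ?case by simp
qed

lemma fourier_sum:
  assumes "finite A" "\<And>i. i \<in> A \<Longrightarrow> f i \<in> schwartz"
  shows "fourier (\<lambda>x. \<Sum>i\<in>A. f i x) = (\<lambda>\<xi>. \<Sum>i\<in>A. fourier (f i) \<xi>)"
proof
  fix \<xi>
  have "fourier (\<lambda>x. \<Sum>i\<in>A. f i x) \<xi>
      = (LINT x|lborel. (\<Sum>i\<in>A. exp (- \<i> * complex_of_real (x * \<xi>)) * f i x))"
    by (simp add: fourier_def sum_distrib_left)
  also have "\<dots> = (\<Sum>i\<in>A. fourier (f i) \<xi>)"
    unfolding fourier_def
    by (rule Bochner_Integration.integral_sum) (intro fourier_integrable schwartz_integrable assms)
  finally show "fourier (\<lambda>x. \<Sum>i\<in>A. f i x) \<xi> = (\<Sum>i\<in>A. fourier (f i) \<xi>)" .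
qed

lemma fourier_diff:
  assumes "f \<in> schwartz" "g \<in> schwartz"
  shows "fourier (\<lambda>x. f x - g x) = (\<lambda>\<xi>. fourier f \<xi> - fourier g \<xi>)"
proof
  fix \<xi>
  have "fourier (\<lambda>x. f x - g x) \<xi>
      = (LINT x|lborel. exp (- \<i> * complex_of_real (x * \<xi>)) * f x - exp (- \<i> * complex_of_real (x * \<xi>)) * g x)"
    by (simp add: fourier_def right_diff_distrib)
  also have "\<dots> = fourier f \<xi> - fourier g \<xi>"
    unfolding fourier_def
    by (rule Bochner_Integration.integral_diff) (intro fourier_integrable schwartz_integrable assms)+
  finally show "fourier (\<lambda>x. f x - g x) \<xi> = fourier f \<xi> - fourier g \<xi>" .
qed

lemma tempered_diff:
  assumes "tempered u" "f \<in> schwartz" "g \<in> schwartz"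
  shows "u (\<lambda>x. f x - g x) = u f - u g"
proof -
  have "u (\<lambda>x. f x + (-1) * g x) = u f + u (\<lambda>x. (-1) * g x)"
    by (rule tempered_add[OF assms(1,2) schwartz_cmult[OF assms(3)]])
  also have "u (\<lambda>x. (-1) * g x) = (-1) * u g"
    by (rule tempered_cmult[OF assms(1,3)])
  finally show ?thesis by simp
qed

section \<open>Mollifiers, and pointwise bounds obtained by testing\<close>

context
  fixes \<eta> :: "real \<Rightarrow> real"
  assumes partition: "unit_partition \<eta>"
begin

lemma partition_smooth: "smooth_fun \<eta>"
  using partition by (simp add: unit_partition_def)

lemma partition_support: "\<eta> \<xi> \<noteq> 0 \<Longrightarrow> \<bar>\<xi>\<bar> < 1"
  using partition closure_subset[of "{\<xi>. \<eta> \<xi> \<noteq> 0}"] unfolding unit_partition_def by fastforce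

text \<open>An integer outside \<open>{-int N..int N}\<close> has distance at least 1 from
  \<open>\<xi>\<close>, where \<open>\<eta>\<close> vanishes; the infinite sum collapses to these
  indices.\<close>

lemma partition_sum:
  assumes "\<bar>\<xi>\<bar> \<le> real N"
  shows "(\<Sum>k\<in>{-int N..int N}. \<eta> (\<xi> - of_int k)) = 1"
proof -
  have "\<eta> (\<xi> - of_int k) = 0" if "k \<notin> {-int N..int N}" for k
  proof (rule ccontr)
    assume "\<eta> (\<xi> - of_int k) \<noteq> 0"
    then have "\<bar>\<xi> - of_int k\<bar> < 1" by (rule partition_support)
    with assms that show False by auto
  qed
  then have "((\<lambda>k. \<eta> (\<xi> - of_int k)) has_sum 1) {-int N..int N}"
    using has_sum_cong_neutral[of "{-int N..int N}" UNIV "\<lambda>k. \<eta> (\<xi> - of_int k)" "\<lambda>k. \<eta> (\<xi> - of_int k)" 1]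
      partition by (auto simp: unit_partition_def)
  then show ?thesis
    using has_sum_unique[OF has_sum_finite] by blast
qed

text \<open>The partition function is a smooth bump that is already at hand; squaring makes it
  nonnegative, as \<open>\<eta>\<close> itself may change sign.\<close>

definition mollifier :: "real \<Rightarrow> real" where "mollifier x = (\<eta> x)\<^sup>2"

lemma mollifier_smooth: "smooth_fun mollifier"
  unfolding mollifier_def[abs_def] power2_eq_square by (intro smooth_fun_mult partition_smooth)

lemma mollifier_nonneg: "0 \<le> mollifier x"
  by (simp add: mollifier_def)

lemma mollifier_support: "mollifier x \<noteq> 0 \<Longrightarrow> \<bar>x\<bar> < 1"
  using partition_support by (auto simp: mollifier_def)

lemma mollifier_schwartz: "(\<lambda>x. complex_of_real (mollifier x)) \<in> schwartz"
proof (rule schwartz_compact_support[where r = 1])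
  show "smooth_fun (\<lambda>x. complex_of_real (mollifier x))"
    by (rule smooth_fun_linear[OF bounded_linear_of_real mollifier_smooth])
  show "complex_of_real (mollifier x) = 0" if "1 < \<bar>x\<bar>" for x
    using mollifier_support[of x] that by (cases "mollifier x = 0") auto
qed

lemma mollifier_integrable: "integrable lborel mollifier"
  using integrable_norm[OF schwartz_integrable[OF mollifier_schwartz]] mollifier_nonneg by simp

text \<open>\<open>partition_sum\<close> with \<open>N = 0\<close> says that
  \<open>\<eta> 0 = 1\<close>. If the integral were 0, the function would vanish almost everywhere,
  hence everywhere because its zero set is closed.\<close>

lemma mollifier_integral_pos: "(LINT x|lborel. mollifier x) > 0"
proof -
  have "\<exists>k\<in>{-int 0..int 0}. \<eta> (0 - of_int k) \<noteq> 0"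
  proof (rule ccontr)
    assume "\<not> ?thesis"
    then show False using partition_sum[of 0 0] by simp
  qed
  then have pos: "mollifier 0 > 0" by (simp add: mollifier_def)
  show ?thesis
  proof (rule ccontr)
    assume "\<not> ?thesis"
    moreover have "(LINT x|lborel. mollifier x) \<ge> 0" by (simp add: mollifier_nonneg)
    ultimately have "(LINT x|lborel. mollifier x) = 0" by linarith
    then have "AE x in lborel. mollifier x = 0"
      using integral_nonneg_eq_0_iff_AE[OF mollifier_integrable AE_I2[OF mollifier_nonneg]] by blast
    then have ae: "AE x in lebesgue. x \<in> {x. mollifier x = 0}"
      using AE_completion[of "\<lambda>x. mollifier x = 0" lborel] by simp
    have "continuous_on UNIV mollifier" by (rule smooth_fun_continuous_0[OF mollifier_smooth])
    then have "closed {x. mollifier x = 0}" by (intro closed_Collect_eq continuous_on_const)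
    from mem_closed_if_AE_lebesgue[OF this, of 0] ae have "mollifier 0 = 0" by simp
    with pos show False by simp
  qed
qed

text \<open>The test functions are mollifiers shrinking to \<open>x\<close>: after rescaling, the
  left side tends to \<open>norm (G x)\<close> times the mass of the mollifier and the right side is
  \<open>M\<close> times that mass.\<close>

lemma norm_le_by_testing:
  assumes G: "continuous_on UNIV G"
    and test: "\<And>\<phi>. \<phi> \<in> schwartz \<Longrightarrow> norm (LINT x|lborel. G x * \<phi> x) \<le> M * (LINT x|lborel. norm (\<phi> x))"
  shows "norm (G x) \<le> M"
proof -
  let ?b = "\<lambda>x. complex_of_real (mollifier x)" and ?I = "LINT x|lborel. mollifier x"
  define e where "e n = inverse (real (Suc n))" for n
  have e: "e \<longlonglongrightarrow> 0" "e n > 0" "e n \<le> 1" for n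
    using LIMSEQ_inverse_real_of_nat by (auto simp: e_def[abs_def] inverse_le_1_iff)
  have [measurable]: "G \<in> borel_measurable borel" "mollifier \<in> borel_measurable borel"
    using G smooth_fun_continuous_0[OF mollifier_smooth]
    by (auto intro: borel_measurable_continuous_onI)
  have bound: "norm (LINT y|lborel. G (x + e n * y) * ?b y) \<le> M * ?I" for n
  proof -
    let ?\<phi> = "\<lambda>y. ?b ((1 / e n) * y + (- x / e n))"
    have "?\<phi> \<in> schwartz" using e(2)[of n] by (intro schwartz_affine mollifier_schwartz) auto
    from test[OF this] have "norm (LINT y|lborel. G y * ?\<phi> y) \<le> M * (LINT y|lborel. norm (?\<phi> y))" .
    moreover have "(LINT y|lborel. G y * ?\<phi> y) = e n *\<^sub>R (LINT y|lborel. G (x + e n * y) * ?b y)"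
      using e(2)[of n] lborel_integral_real_affine[of "e n" "\<lambda>y. G y * ?\<phi> y" x]
      by (simp add: field_simps)
    moreover have "(LINT y|lborel. norm (?\<phi> y)) = e n * ?I"
      using e(2)[of n] lborel_integral_real_affine[of "e n" "\<lambda>y. norm (?\<phi> y)" x] mollifier_nonneg
      by (simp add: field_simps)
    ultimately show ?thesis
      using e(2)[of n] by (simp add: mult.left_commute)
  qed
  \<comment> \<open>\<open>G\<close> is not assumed bounded; a bound on
    \<open>{x - 1..x + 1}\<close> is enough, since the scales are at most 1 and the mollifier lives
    on the unit interval around 0.\<close>
  have "compact (G ` {x - 1..x + 1})"
    by (intro compact_continuous_image continuous_on_subset[OF G]) auto
  then have "bounded (G ` {x - 1..x + 1})" by (rule compact_imp_bounded)
  then obtain C where C: "\<And>y. y \<in> {x - 1..x + 1} \<Longrightarrow> norm (G y) \<le> C"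
    unfolding bounded_iff by blast
  have "(\<lambda>n. LINT y|lborel. G (x + e n * y) * ?b y) \<longlonglongrightarrow> (LINT y|lborel. G x * ?b y)"
  proof (rule integral_dominated_convergence[where w = "\<lambda>y. C * mollifier y"])
    show "integrable lborel (\<lambda>y. C * mollifier y)" by (intro integrable_mult_right mollifier_integrable)
    have "isCont G x" using G by (simp add: continuous_on_eq_continuous_at)
    moreover have "(\<lambda>n. x + e n * y) \<longlonglongrightarrow> x" for y
      using tendsto_add[OF tendsto_const tendsto_mult_right[OF e(1), of y], of x] by simp
    ultimately have "(\<lambda>n. G (x + e n * y)) \<longlonglongrightarrow> G x" for y
      by (rule isCont_tendsto_compose)
    then show "AE y in lborel. (\<lambda>n. G (x + e n * y) * ?b y) \<longlonglongrightarrow> G x * ?b y"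
      by (intro AE_I2 tendsto_mult_right)
    show "AE y in lborel. norm (G (x + e n * y) * ?b y) \<le> C * mollifier y" for n
    proof (rule AE_I2)
      fix y
      show "norm (G (x + e n * y) * ?b y) \<le> C * mollifier y"
      proof (cases "mollifier y = 0")
        case False
        then have "\<bar>y\<bar> < 1" by (rule mollifier_support)
        then have "\<bar>e n * y\<bar> \<le> 1" using e(2,3)[of n] by (simp add: abs_mult mult_le_one)
        then have "norm (G (x + e n * y)) \<le> C" by (intro C) (auto simp: abs_le_iff)
        then show ?thesis using mollifier_nonneg by (simp add: norm_mult mult_right_mono)
      qed simp
    qed
  qed measurable
  then have "norm (LINT y|lborel. G x * ?b y) \<le> M * ?I"
    using bound by (intro LIMSEQ_le_const2[OF tendsto_norm]) auto
  then have "norm (G x) * ?I \<le> M * ?I"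
    using mollifier_integral_pos by (simp add: norm_mult)
  then show ?thesis using mollifier_integral_pos by simp
qed

text \<open>The case \<open>M = 0\<close> of \<open>norm_le_by_testing\<close>, applied to the
  difference.\<close>

lemma eq_by_testing:
  assumes "continuous_on UNIV f" "continuous_on UNIV g" "represents f u" "represents g u"
  shows "f = g"
proof
  fix x
  have "norm (f x - g x) \<le> 0"
  proof (rule norm_le_by_testing[where G = "\<lambda>x. f x - g x"])
    fix \<phi> assume \<phi>: "\<phi> \<in> schwartz"
    have "(LINT x|lborel. (f x - g x) * \<phi> x) = (LINT x|lborel. f x * \<phi> x) - (LINT x|lborel. g x * \<phi> x)"
      unfolding left_diff_distrib
      using assms \<phi> by (intro Bochner_Integration.integral_diff) (auto simp: represents_def)
    then show "norm (LINT x|lborel. (f x - g x) * \<phi> x) \<le> 0 * (LINT x|lborel. norm (\<phi> x))"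
      using assms \<phi> by (auto simp: represents_def reg_dist_def)
  qed (intro continuous_intros assms)
  then show "f x = g x" by simp
qed

text \<open>Compares the continuous form of a block with a near-optimal measurable representative
  from \<open>Linf_dist_obtain\<close>.\<close>

lemma norm_le_representative:
  assumes "continuous_on UNIV G" "represents G u" "g \<in> borel_measurable borel" "\<And>x. norm (g x) \<le> M" "represents g u"
  shows "norm (G x) \<le> M"
proof (rule norm_le_by_testing[OF assms(1)])
  fix \<phi> assume \<phi>: "\<phi> \<in> schwartz"
  then have "u \<phi> = (LINT x|lborel. G x * \<phi> x)" "u \<phi> = (LINT x|lborel. g x * \<phi> x)"
    using assms(2,5) by (auto simp: represents_def reg_dist_def)
  then have "(LINT x|lborel. G x * \<phi> x) = (LINT x|lborel. \<phi> x * g x)"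
    by (simp add: mult.commute)
  then show "norm (LINT x|lborel. G x * \<phi> x) \<le> M * (LINT x|lborel. norm (\<phi> x))"
    using norm_integral_mult_bounded[OF assms(3,4) schwartz_integrable[OF \<phi>]] by simp
qed

end

text \<open>Each derivative falls either on the character, at the price of a factor
  \<open>\<bar>k\<bar>\<close>, or on \<open>\<phi>\<close>. The second case is the reason for
  generalising over \<open>\<phi>\<close>.\<close>

lemma modulated_vderiv_integral:
  assumes "\<phi> \<in> schwartz"
  shows "\<exists>C\<ge>0. \<forall>k::real. (LINT x|lborel. norm (vderiv j (\<lambda>x. exp (\<i> * of_real k * of_real x) * \<phi> x) x))
    \<le> C * (1 + \<bar>k\<bar>) ^ j"
  using assms
proof (induction j arbitrary: \<phi>)
  case 0
  have "norm (exp (\<i> * of_real k * complex_of_real x)) = 1" for k x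
    using norm_exp_i(2)[of "k * x"] by (simp add: mult.assoc)
  then have "(LINT x|lborel. norm (exp (\<i> * of_real k * complex_of_real x) * \<phi> x)) = (LINT x|lborel. norm (\<phi> x))" for k
    by (simp add: norm_mult)
  then show ?case by (intro exI[of _ "LINT x|lborel. norm (\<phi> x)"]) simp
next
  case (Suc j)
  let ?\<phi>' = "vderiv (Suc 0) \<phi>" and ?e = "\<lambda>k x. exp (\<i> * of_real k * complex_of_real x)"
  have \<phi>': "?\<phi>' \<in> schwartz" by (rule schwartz_vderiv[OF Suc.prems])
  have e\<phi>: "(\<lambda>x. ?e k x * \<psi> x) \<in> schwartz" if "\<psi> \<in> schwartz" for k \<psi>
    by (rule schwartz_exp_mult) (use that in auto)
  obtain C1 where C1: "C1 \<ge> 0" "\<And>k. (LINT x|lborel. norm (vderiv j (\<lambda>x. ?e k x * ?\<phi>' x) x)) \<le> C1 * (1 + \<bar>k\<bar>) ^ j"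
    using Suc.IH[OF \<phi>'] by blast
  obtain C2 where C2: "C2 \<ge> 0" "\<And>k. (LINT x|lborel. norm (vderiv j (\<lambda>x. ?e k x * \<phi> x) x)) \<le> C2 * (1 + \<bar>k\<bar>) ^ j"
    using Suc.IH[OF Suc.prems] by blast
  have "(LINT x|lborel. norm (vderiv (Suc j) (\<lambda>x. ?e k x * \<phi> x) x)) \<le> (C1 + C2) * (1 + \<bar>k\<bar>) ^ Suc j" for k
  proof -
    let ?f = "\<lambda>x. ?e k x * ?\<phi>' x" and ?g = "\<lambda>x. ?e k x * \<phi> x"
    have f: "?f \<in> schwartz" and g: "?g \<in> schwartz" using e\<phi> \<phi>' Suc.prems by auto
    have "vderiv (Suc 0) ?g = (\<lambda>x. ?f x + (\<i> * of_real k) * ?g x)"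
      unfolding vderiv_1_mult[OF smooth_fun_exp(1) schwartz_smooth[OF Suc.prems]] smooth_fun_exp(2)
      by (simp add: mult.assoc)
    then have eq: "vderiv (Suc j) ?g x = vderiv j ?f x + (\<i> * of_real k) * vderiv j ?g x" for x
      unfolding vderiv_Suc_right[of j]
      using vderiv_add[OF schwartz_smooth[OF f] schwartz_smooth[OF schwartz_cmult[OF g]], of j "\<i> * of_real k" x]
        vderiv_linear[OF bounded_linear_mult_right schwartz_smooth[OF g], of j "\<i> * of_real k" x]
      by simp
    have "(LINT x|lborel. norm (vderiv (Suc j) ?g x))
        \<le> (LINT x|lborel. norm (vderiv j ?f x) + \<bar>k\<bar> * norm (vderiv j ?g x))"
    proof (rule integral_mono)
      show "norm (vderiv (Suc j) ?g x) \<le> norm (vderiv j ?f x) + \<bar>k\<bar> * norm (vderiv j ?g x)" for x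
        unfolding eq using norm_triangle_ineq[of "vderiv j ?f x" "(\<i> * of_real k) * vderiv j ?g x"]
        by (simp add: norm_mult)
    qed (intro Bochner_Integration.integrable_add integrable_mult_right integrable_norm
        schwartz_integrable schwartz_vderiv f g)+
    also have "\<dots> = (LINT x|lborel. norm (vderiv j ?f x)) + \<bar>k\<bar> * (LINT x|lborel. norm (vderiv j ?g x))"
      by (subst Bochner_Integration.integral_add)
        (intro integrable_mult_right integrable_norm schwartz_integrable schwartz_vderiv f g
          | simp only: integral_mult_right_zero)+
    also have "\<dots> \<le> C1 * (1 + \<bar>k\<bar>) ^ j + \<bar>k\<bar> * (C2 * (1 + \<bar>k\<bar>) ^ j)"
      by (intro add_mono C1 mult_left_mono C2) auto
    also have "\<dots> \<le> (C1 + C2) * (1 + \<bar>k\<bar>) ^ Suc j"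
      using C1(1) C2(1) by (simp add: algebra_simps)
    finally show ?thesis .
  qed
  then show ?case using C1(1) C2(1) by (intro exI[of _ "C1 + C2"]) auto
qed

section \<open>Frequency blocks and reconstruction from them\<close>

context
  fixes \<eta> :: "real \<Rightarrow> real"
  assumes partition: "unit_partition \<eta>"
begin

definition block :: "int \<Rightarrow> real \<Rightarrow> complex" where
  "block k \<xi> = complex_of_real (\<eta> (\<xi> - of_int k))"

text \<open>The index set is spelt so as to match \<open>partition_sum\<close> with
  \<open>N = 1\<close>, which makes this sum of three neighbours equal to 1 wherever
  \<open>block k\<close> does not vanish.\<close>

definition wide_block :: "int \<Rightarrow> real \<Rightarrow> complex" where
  "wide_block k \<xi> = (\<Sum>l\<in>{-int 1..int 1}. block (k + l) \<xi>)"

lemma block_smooth: "smooth_fun (block k)"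
  and vderiv_block: "vderiv j (block k) \<xi> = of_real (vderiv j \<eta> (\<xi> - of_int k))"
proof -
  have s: "smooth_fun (\<lambda>\<xi>. \<eta> (\<xi> - of_int k))"
    using smooth_fun_affine[OF partition_smooth[OF partition], of 1 "- of_int k"] by simp
  show "smooth_fun (block k)"
    unfolding block_def[abs_def] by (rule smooth_fun_linear[OF bounded_linear_of_real s])
  show "vderiv j (block k) \<xi> = of_real (vderiv j \<eta> (\<xi> - of_int k))"
    unfolding block_def[abs_def] vderiv_linear[OF bounded_linear_of_real s]
    using vderiv_affine[OF partition_smooth[OF partition], of j 1 "- of_int k" \<xi>] by simp
qed

lemma block_schwartz: "block k \<in> schwartz"
proof (rule schwartz_compact_support[OF block_smooth])
  fix \<xi> :: real assume "\<bar>of_int k\<bar> + 1 < \<bar>\<xi>\<bar>"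
  then have "\<not> \<bar>\<xi> - of_int k\<bar> < 1" by linarith
  then show "block k \<xi> = 0"
    using partition_support[OF partition] by (auto simp: block_def)
qed

lemma wide_block_schwartz: "wide_block k \<in> schwartz"
  unfolding wide_block_def[abs_def] by (intro schwartz_sum block_schwartz) simp

lemma block_mult_wide_block: "block k \<xi> * wide_block k \<xi> = block k \<xi>"
proof (cases "\<eta> (\<xi> - of_int k) = 0")
  case False
  then have "\<bar>\<xi> - of_int k\<bar> \<le> real 1" using partition_support[OF partition] by (simp add: less_imp_le)
  from partition_sum[OF partition this]
  have "wide_block k \<xi> = 1"
    by (simp add: wide_block_def block_def diff_diff_add flip: of_real_sum del: of_nat_1)
  then show ?thesis by simp
qed (simp add: block_def)

lemma box_block: "box \<eta> k u \<phi> = u (fourier (\<lambda>\<xi>. block k \<xi> * inv_fourier \<phi> \<xi>))"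
  by (simp add: box_apply block_def)

lemma block_mult_schwartz: "\<psi> \<in> schwartz \<Longrightarrow> (\<lambda>\<xi>. block k \<xi> * \<psi> \<xi>) \<in> schwartz"
  and wide_block_mult_schwartz: "\<psi> \<in> schwartz \<Longrightarrow> (\<lambda>\<xi>. wide_block k \<xi> * \<psi> \<xi>) \<in> schwartz"
proof -
  have *: "(\<lambda>\<xi>. a \<xi> * \<psi> \<xi>) \<in> schwartz" if a: "a \<in> schwartz" and \<psi>: "\<psi> \<in> schwartz" for a \<psi>
  proof (rule schwartz_mult[OF schwartz_smooth[OF a] _ \<psi>])
    fix j
    obtain B where "\<And>x. \<bar>x\<bar> ^ 0 * norm (vderiv j a x) \<le> B" using schwartz_bound[OF a] by blast
    then show "bounded (range (vderiv j a))" by (auto simp: bounded_iff)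
  qed
  show "\<psi> \<in> schwartz \<Longrightarrow> (\<lambda>\<xi>. block k \<xi> * \<psi> \<xi>) \<in> schwartz" by (rule *[OF block_schwartz])
  show "\<psi> \<in> schwartz \<Longrightarrow> (\<lambda>\<xi>. wide_block k \<xi> * \<psi> \<xi>) \<in> schwartz" by (rule *[OF wide_block_schwartz])
qed

lemma represents_conv:
  assumes A: "A \<in> schwartz" and g: "g \<in> borel_measurable borel" "\<And>x. norm (g x) \<le> c"
    and "\<And>\<phi>. \<phi> \<in> schwartz \<Longrightarrow> u \<phi> = (LINT x|lborel. conv A g x * \<phi> x)"
  shows "represents (conv A g) u"
  unfolding represents_def reg_dist_def
  using assms(4) integrable_mult_bounded(2)[OF conv_measurable[OF g A] norm_conv_le[OF g A] schwartz_integrable]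
  by auto

text \<open>Bernstein's trick: since \<open>wide_block k\<close> is 1 on the support of \<open>block k\<close>, convolving with its
  kernel does not change a frequency block.\<close>

lemma represents_box_conv:
  assumes g: "g \<in> borel_measurable borel" "\<And>x. norm (g x) \<le> c" "represents g (box \<eta> k u)"
  shows "represents (conv (inv_fourier (wide_block k)) g) (box \<eta> k u)"
proof (rule represents_conv[OF schwartz_inv_fourier[OF wide_block_schwartz] g(1,2)])
  fix \<phi> assume \<phi>: "\<phi> \<in> schwartz"
  let ?\<psi> = "\<lambda>\<xi>. wide_block k \<xi> * inv_fourier \<phi> \<xi>"
  have \<psi>: "?\<psi> \<in> schwartz" by (intro wide_block_mult_schwartz schwartz_inv_fourier \<phi>)
  have "box \<eta> k u \<phi> = box \<eta> k u (fourier ?\<psi>)"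
    unfolding box_block inv_fourier_fourier[OF \<psi>] mult.assoc[symmetric] block_mult_wide_block ..
  also have "\<dots> = (LINT y|lborel. g y * fourier ?\<psi> y)"
    using g(3) schwartz_fourier[OF \<psi>] by (simp add: represents_def reg_dist_def)
  also have "\<dots> = (LINT x|lborel. conv (inv_fourier (wide_block k)) g x * \<phi> x)"
    by (rule integral_mult_multiplier[OF g(1,2) wide_block_schwartz \<phi>])
  finally show "box \<eta> k u \<phi> = (LINT x|lborel. conv (inv_fourier (wide_block k)) g x * \<phi> x)" .
qed

lemma represents_box_reg_dist:
  assumes g: "g \<in> borel_measurable borel" "\<And>x. norm (g x) \<le> c"
  shows "represents (conv (inv_fourier (block k)) g) (box \<eta> k (reg_dist g))"
  by (rule represents_conv[OF schwartz_inv_fourier[OF block_schwartz] g])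
    (simp add: box_block reg_dist_def integral_mult_multiplier[OF g block_schwartz])

text \<open>A shift in frequency is a modulation in space, so all kernels are modulations of a
  single Schwartz function.\<close>

lemma inv_fourier_wide_block:
  "inv_fourier (wide_block k) x = exp (\<i> * of_real (of_int k) * of_real x) * inv_fourier (wide_block 0) x"
proof -
  have shift: "wide_block k (\<xi> + of_int k) = wide_block 0 \<xi>" for \<xi>
    by (simp add: wide_block_def block_def algebra_simps)
  have "(LINT \<xi>|lborel. exp (\<i> * complex_of_real (x * \<xi>)) * wide_block k \<xi>)
      = (LINT \<xi>|lborel. exp (\<i> * complex_of_real (x * (\<xi> + of_int k))) * wide_block k (\<xi> + of_int k))"
    by (rule integral_translate[symmetric])
  also have "\<dots> = (LINT \<xi>|lborel. exp (\<i> * of_real (of_int k) * of_real x) *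
      (exp (\<i> * complex_of_real (x * \<xi>)) * wide_block 0 \<xi>))"
    unfolding shift mult.assoc[symmetric] exp_add[symmetric] by (simp add: algebra_simps)
  also have "\<dots> = exp (\<i> * of_real (of_int k) * of_real x) *
      (LINT \<xi>|lborel. exp (\<i> * complex_of_real (x * \<xi>)) * wide_block 0 \<xi>)"
    by (rule integral_mult_right_zero)
  finally show ?thesis by (simp add: inv_fourier_def)
qed

text \<open>Only the modulation depends on \<open>k\<close>, which gives growth of order
  \<open>j\<close>. Since \<open>1 + \<bar>of_int k\<bar>\<close> is at least 1, adding up the
  constants yields one bound for all orders up to \<open>m\<close>.\<close>

lemma wide_block_kernel_bound:
  "\<exists>C\<ge>0. \<forall>k. \<forall>j\<le>m. (LINT x|lborel. norm (vderiv j (inv_fourier (wide_block k)) x)) \<le> C * (1 + \<bar>of_int k\<bar>) ^ m"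
proof -
  have "\<forall>j. \<exists>C\<ge>0. \<forall>k::int. (LINT x|lborel. norm (vderiv j (inv_fourier (wide_block k)) x)) \<le> C * (1 + \<bar>of_int k\<bar>) ^ j"
  proof
    fix j
    obtain C where "C \<ge> 0" "\<And>k::real. (LINT x|lborel. norm (vderiv j (\<lambda>x. exp (\<i> * of_real k * of_real x) * inv_fourier (wide_block 0) x) x))
        \<le> C * (1 + \<bar>k\<bar>) ^ j"
      using modulated_vderiv_integral[OF schwartz_inv_fourier[OF wide_block_schwartz[of 0]], of j] by blast
    moreover have "inv_fourier (wide_block k) = (\<lambda>x. exp (\<i> * of_real (of_int k) * of_real x) * inv_fourier (wide_block 0) x)" for k
      using inv_fourier_wide_block by blast
    ultimately show "\<exists>C\<ge>0. \<forall>k::int. (LINT x|lborel. norm (vderiv j (inv_fourier (wide_block k)) x)) \<le> C * (1 + \<bar>of_int k\<bar>) ^ j"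
      by (metis of_int_abs)
  qed
  then obtain C where C: "\<And>j. C j \<ge> 0"
      "\<And>j k. (LINT x|lborel. norm (vderiv j (inv_fourier (wide_block k)) x)) \<le> C j * (1 + \<bar>of_int k\<bar>) ^ j"
    by metis
  have "(LINT x|lborel. norm (vderiv j (inv_fourier (wide_block k)) x)) \<le> (\<Sum>i\<le>m. C i) * (1 + \<bar>of_int k\<bar>) ^ m"
    if "j \<le> m" for j k
  proof -
    have "C j * (1 + \<bar>of_int k\<bar>) ^ j \<le> (\<Sum>i\<le>m. C i) * (1 + \<bar>of_int k\<bar>) ^ m"
      using that C(1) by (intro mult_mono power_increasing member_le_sum sum_nonneg) auto
    with C(2)[where j = j and k = k] show ?thesis by linarith
  qed
  then show ?thesis using C(1) by (intro exI[of _ "\<Sum>i\<le>m. C i"]) (auto intro: sum_nonneg)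
qed

text \<open>The multiplier that describes the error of the symmetric partial sums of blocks.\<close>

definition high_pass :: "nat \<Rightarrow> real \<Rightarrow> complex" where
  "high_pass N \<xi> = 1 - (\<Sum>k\<in>{-int N..int N}. block k \<xi>)"

lemma high_pass_smooth: "smooth_fun (high_pass N)"
  unfolding high_pass_def[abs_def]
  by (intro smooth_fun_diff smooth_fun_sum block_smooth smooth_fun_const) simp

lemma high_pass_vanish: "\<bar>\<xi>\<bar> \<le> real N \<Longrightarrow> high_pass N \<xi> = 0"
  using partition_sum[OF partition] by (simp add: high_pass_def block_def flip: of_real_sum)

text \<open>At any frequency at most three blocks contribute, those with index within 1 of
  \<open>\<lfloor>\<xi>\<rfloor>\<close>; this makes the bound independent of
  \<open>N\<close>.\<close>

lemma high_pass_bound: "\<exists>B. \<forall>N \<xi>. norm (vderiv j (high_pass N) \<xi>) \<le> B"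
proof -
  obtain B where "\<And>x. \<bar>x\<bar> ^ 0 * norm (vderiv j (block 0) x) \<le> B"
    using schwartz_bound[OF block_schwartz[of 0]] by blast
  then have B: "\<bar>vderiv j \<eta> x\<bar> \<le> B" for x by (simp add: vderiv_block)
  have vanish: "vderiv j \<eta> x = 0" if "\<bar>x\<bar> > 1" for x
  proof (rule vderiv_vanish[where S = "{x. 1 < \<bar>x\<bar>}"])
    show "open {x::real. 1 < \<bar>x\<bar>}" by (intro open_Collect_less continuous_intros)
    show "\<eta> x = 0" if "x \<in> {x. 1 < \<bar>x\<bar>}" for x
      using partition_support[OF partition, of x] that by (cases "\<eta> x = 0") auto
  qed (use that in simp)
  have "norm (vderiv j (high_pass N) \<xi>) \<le> 1 + 3 * B" for N \<xi>
  proof -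
    let ?A = "{-int N..int N}" and ?S = "{\<lfloor>\<xi>\<rfloor> - 1..\<lfloor>\<xi>\<rfloor> + 1}"
    have "vderiv j (high_pass N) \<xi> = (if j = 0 then 1 else 0) - (\<Sum>k\<in>?A. of_real (vderiv j \<eta> (\<xi> - of_int k)))"
      unfolding high_pass_def[abs_def]
      by (subst vderiv_diff) (auto intro!: smooth_fun_sum block_smooth smooth_fun_const
          simp: vderiv_const vderiv_sum block_smooth vderiv_block)
    also have "norm \<dots> \<le> 1 + norm (\<Sum>k\<in>?A. complex_of_real (vderiv j \<eta> (\<xi> - of_int k)))"
      by (rule order_trans[OF norm_triangle_ineq4]) auto
    also have "norm (\<Sum>k\<in>?A. complex_of_real (vderiv j \<eta> (\<xi> - of_int k))) \<le> (\<Sum>k\<in>?A. \<bar>vderiv j \<eta> (\<xi> - of_int k)\<bar>)"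
      by (rule order_trans[OF norm_sum]) simp
    also have "\<dots> = (\<Sum>k\<in>?A \<inter> ?S. \<bar>vderiv j \<eta> (\<xi> - of_int k)\<bar>)"
    proof (rule sum.mono_neutral_right)
      show "\<forall>k\<in>?A - ?A \<inter> ?S. \<bar>vderiv j \<eta> (\<xi> - of_int k)\<bar> = 0"
      proof
        fix k assume "k \<in> ?A - ?A \<inter> ?S"
        then have "\<not> (\<lfloor>\<xi>\<rfloor> - 1 \<le> k \<and> k \<le> \<lfloor>\<xi>\<rfloor> + 1)" by auto
        then have "\<bar>\<xi> - of_int k\<bar> > 1" by linarith
        then show "\<bar>vderiv j \<eta> (\<xi> - of_int k)\<bar> = 0" by (simp add: vanish)
      qed
    qed auto
    also have "\<dots> \<le> (\<Sum>k\<in>?S. \<bar>vderiv j \<eta> (\<xi> - of_int k)\<bar>)"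
      by (rule sum_mono2) auto
    also have "\<dots> \<le> of_nat (card ?S) * B"
      by (rule sum_bounded_above) (rule B)
    finally show ?thesis by simp
  qed
  then show ?thesis by blast
qed

text \<open>Dominated convergence: at each frequency the integrand is eventually 0, and the weights
  of power 0 and 2 give a majorant that is the same for all \<open>N\<close>.\<close>

lemma high_pass_integral_tendsto:
  assumes "\<psi> \<in> schwartz"
  shows "(\<lambda>N. LINT \<xi>|lborel. norm (vderiv m (\<lambda>\<xi>. high_pass N \<xi> * \<psi> \<xi>) \<xi>)) \<longlonglongrightarrow> 0"
proof -
  let ?f = "\<lambda>N \<xi>. vderiv m (\<lambda>\<xi>. high_pass N \<xi> * \<psi> \<xi>) \<xi>"
  have s: "smooth_fun (\<lambda>\<xi>. high_pass N \<xi> * \<psi> \<xi>)" for N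
    by (intro smooth_fun_mult high_pass_smooth schwartz_smooth assms)
  obtain B where B: "\<And>N \<xi>. \<bar>\<xi>\<bar> ^ 0 * norm (?f N \<xi>) \<le> B"
    using schwartz_mult_family_bound[of high_pass, OF high_pass_smooth high_pass_bound assms] by blast
  obtain C where C: "\<And>N \<xi>. \<bar>\<xi>\<bar> ^ 2 * norm (?f N \<xi>) \<le> C"
    using schwartz_mult_family_bound[of high_pass, OF high_pass_smooth high_pass_bound assms] by blast
  have "(\<lambda>N. LINT \<xi>|lborel. norm (?f N \<xi>)) \<longlonglongrightarrow> (LINT \<xi>|(lborel::real measure). 0::real)"
  proof (rule integral_dominated_convergence[where w = "\<lambda>\<xi>. (B + C) * (1 / (1 + \<xi>\<^sup>2))"])
    show "integrable lborel (\<lambda>\<xi>::real. (B + C) * (1 / (1 + \<xi>\<^sup>2)))"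
      by (intro integrable_mult_right integrable_inverse_1_plus_square)
    show "(\<lambda>\<xi>. norm (?f N \<xi>)) \<in> borel_measurable lborel" for N
      using smooth_fun_continuous[OF s]
      by (simp add: borel_measurable_continuous_onI continuous_on_norm)
    show "AE \<xi> in lborel. norm (norm (?f N \<xi>)) \<le> (B + C) * (1 / (1 + \<xi>\<^sup>2))" for N
    proof (rule AE_I2)
      fix \<xi>
      have "norm (?f N \<xi>) * (1 + \<xi>\<^sup>2) \<le> B + C"
        using add_mono[OF B[of \<xi> N] C[of \<xi> N]] by (simp add: algebra_simps)
      then show "norm (norm (?f N \<xi>)) \<le> (B + C) * (1 / (1 + \<xi>\<^sup>2))"
        by (simp add: pos_le_divide_eq add_pos_nonneg)
    qed
    show "AE \<xi> in lborel. (\<lambda>N. norm (?f N \<xi>)) \<longlonglongrightarrow> 0"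
    proof (rule AE_I2)
      fix \<xi> :: real
      \<comment> \<open>The extra 1 places \<open>\<xi>\<close> in the open interval on which the
        cut function is identically 0, so that its derivatives vanish there as well.\<close>
      have "norm (?f N \<xi>) = 0" if "N \<ge> nat \<lceil>\<bar>\<xi>\<bar>\<rceil> + 1" for N
      proof -
        have "?f N \<xi> = 0"
        proof (rule vderiv_vanish[where S = "{-real N<..<real N}"])
          show "\<xi> \<in> {-real N<..<real N}" using that by auto linarith+
          show "high_pass N x * \<psi> x = 0" if "x \<in> {-real N<..<real N}" for x
            using high_pass_vanish[of x N] that by auto
        qed simp
        then show ?thesis by simp
      qed
      then show "(\<lambda>N. norm (?f N \<xi>)) \<longlonglongrightarrow> 0"
        by (intro tendsto_eventually) (auto simp: eventually_sequentially)
    qed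
  qed simp
  then show ?thesis by simp
qed

text \<open>The error is \<open>u\<close> applied to the transform of a high-pass cut of
  \<open>inv_fourier \<phi>\<close>. Temperedness bounds it by finitely many seminorms, and
  \<open>fourier_seminorm_le\<close> turns each into an integral that tends to 0.\<close>

lemma box_partial_sums:
  assumes u: "tempered u" and \<phi>: "\<phi> \<in> schwartz"
  shows "(\<lambda>N. \<Sum>k\<in>{-int N..int N}. box \<eta> k u \<phi>) \<longlonglongrightarrow> u \<phi>"
proof -
  let ?A = "\<lambda>N. {-int N..int N}"
  define \<psi> where "\<psi> = inv_fourier \<phi>"
  have \<psi>: "\<psi> \<in> schwartz" unfolding \<psi>_def by (rule schwartz_inv_fourier[OF \<phi>])
  let ?h = "\<lambda>N \<xi>. high_pass N \<xi> * \<psi> \<xi>"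
  have b\<psi>: "(\<lambda>\<xi>. block k \<xi> * \<psi> \<xi>) \<in> schwartz" for k by (rule block_mult_schwartz[OF \<psi>])
  have h_eq: "?h N = (\<lambda>\<xi>. \<psi> \<xi> - (\<Sum>k\<in>?A N. block k \<xi> * \<psi> \<xi>))" for N
    by (simp add: high_pass_def fun_eq_iff left_diff_distrib sum_distrib_right)
  have sum_S: "(\<lambda>\<xi>. \<Sum>k\<in>?A N. block k \<xi> * \<psi> \<xi>) \<in> schwartz" for N by (intro schwartz_sum b\<psi>) simp
  have h: "?h N \<in> schwartz" for N unfolding h_eq by (intro schwartz_diff \<psi> sum_S)
  have diff: "u (fourier (?h N)) = u \<phi> - (\<Sum>k\<in>?A N. box \<eta> k u \<phi>)" for N
  proof -
    have "fourier (?h N) = (\<lambda>\<xi>. fourier \<psi> \<xi> - (\<Sum>k\<in>?A N. fourier (\<lambda>\<xi>. block k \<xi> * \<psi> \<xi>) \<xi>))"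
      unfolding h_eq fourier_diff[OF \<psi> sum_S] by (subst fourier_sum) (auto intro: b\<psi>)
    moreover have "(\<lambda>\<xi>. \<Sum>k\<in>?A N. fourier (\<lambda>\<xi>. block k \<xi> * \<psi> \<xi>) \<xi>) \<in> schwartz"
      by (intro schwartz_sum schwartz_fourier b\<psi>) simp
    ultimately have "u (fourier (?h N)) = u (fourier \<psi>) - u (\<lambda>\<xi>. \<Sum>k\<in>?A N. fourier (\<lambda>\<xi>. block k \<xi> * \<psi> \<xi>) \<xi>)"
      by (simp add: tempered_diff[OF u schwartz_fourier[OF \<psi>]])
    also have "u (\<lambda>\<xi>. \<Sum>k\<in>?A N. fourier (\<lambda>\<xi>. block k \<xi> * \<psi> \<xi>) \<xi>) = (\<Sum>k\<in>?A N. box \<eta> k u \<phi>)"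
      unfolding box_block \<psi>_def[symmetric] by (intro tempered_sum[OF u] schwartz_fourier b\<psi>) simp
    finally show ?thesis by (simp add: \<psi>_def fourier_inv_fourier[OF \<phi>])
  qed
  obtain C M where CM: "\<And>\<phi>. \<phi> \<in> schwartz \<Longrightarrow>
      norm (u \<phi>) \<le> C * (\<Sum>m\<le>M. \<Sum>n\<le>M. SUP x. norm ((x ^ m) *\<^sub>R vderiv n \<phi> x))"
    using u unfolding tempered_def by blast
  let ?p = "\<lambda>N m n. SUP x. norm ((x ^ m) *\<^sub>R vderiv n (fourier (?h N)) x)"
  have p: "(\<lambda>N. ?p N m n) \<longlonglongrightarrow> 0" for m n
  proof -
    let ?\<psi>n = "\<lambda>\<xi>. ((- \<i>) * of_real \<xi>) ^ n * \<psi> \<xi>"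
    let ?I = "\<lambda>N. LINT \<xi>|lborel. norm (vderiv m (\<lambda>\<xi>. high_pass N \<xi> * ?\<psi>n \<xi>) \<xi>)"
    have le: "norm ((x ^ m) *\<^sub>R vderiv n (fourier (?h N)) x) \<le> ?I N" for x N
      using fourier_seminorm_le[OF h, of x m n N] by (simp add: power_abs mult.left_commute)
    show ?thesis
    proof (rule tendsto_sandwich[of "\<lambda>_. 0" _ _ ?I])
      show "\<forall>\<^sub>F N in sequentially. 0 \<le> ?p N m n"
      proof (intro always_eventually allI)
        fix N
        have "norm (((0::real) ^ m) *\<^sub>R vderiv n (fourier (?h N)) 0) \<le> ?p N m n"
          by (rule cSUP_upper) (auto intro!: bdd_aboveI2[where M = "?I N"] le simp del: norm_scaleR)
        then show "0 \<le> ?p N m n" using norm_ge_zero order_trans by blast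
      qed
      show "\<forall>\<^sub>F N in sequentially. ?p N m n \<le> ?I N"
        by (intro always_eventually allI cSUP_least le) auto
      show "?I \<longlonglongrightarrow> 0"
        by (intro high_pass_integral_tendsto schwartz_mult_of_real_power \<psi>)
    qed simp
  qed
  have "(\<lambda>N. C * (\<Sum>m\<le>M. \<Sum>n\<le>M. ?p N m n)) \<longlonglongrightarrow> C * (\<Sum>m\<le>M. \<Sum>n\<le>M. 0)"
    by (intro tendsto_mult_left tendsto_sum p)
  then have lim: "(\<lambda>N. C * (\<Sum>m\<le>M. \<Sum>n\<le>M. ?p N m n)) \<longlonglongrightarrow> 0"
    by (simp only: sum.neutral_const mult_zero_right)
  have "(\<lambda>N. u (fourier (?h N))) \<longlonglongrightarrow> 0"
    by (rule Lim_null_comparison[OF _ lim]) (intro always_eventually allI CM schwartz_fourier h)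
  then have "(\<lambda>N. u \<phi> - u (fourier (?h N))) \<longlonglongrightarrow> u \<phi> - 0" by (intro tendsto_diff tendsto_const)
  then show ?thesis by (simp add: diff)
qed

end

lemma Ck_fun_uniform_limit:
  fixes f :: "nat \<Rightarrow> real \<Rightarrow> 'a::banach"
  assumes f: "\<And>n. Ck_fun k (f n)"
    and lim: "\<And>j r. j \<le> k \<Longrightarrow> uniform_limit {-r..r} (\<lambda>n. vderiv j (f n)) (D j) sequentially"
  shows "Ck_fun k (D 0)" and "j \<le> k \<Longrightarrow> vderiv j (D 0) = D j"
proof -
  have pt: "(\<lambda>n. vderiv j (f n) x) \<longlonglongrightarrow> D j x" if "j \<le> k" for j x
    by (rule tendsto_uniform_limitI[OF lim[OF that, of "\<bar>x\<bar>"]]) auto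
  have D: "(D j has_vector_derivative D (Suc j) x) (at x)" if "j < k" for j x
    by (rule has_vector_derivative_uniform_limit[where f = "\<lambda>n. vderiv j (f n)" and f' = "\<lambda>n. vderiv (Suc j) (f n)"])
      (use that in \<open>auto intro: Ck_fun_has_vderiv f lim pt\<close>)
  have "isCont (D k) x" for x
  proof -
    have "continuous_on {-(\<bar>x\<bar> + 1)..\<bar>x\<bar> + 1} (D k)"
      using Ck_fun_continuous[OF f order_refl]
      by (intro uniform_limit_theorem[OF _ lim[OF order_refl]] always_eventually)
        (auto intro: continuous_on_subset)
    then show ?thesis by (rule continuous_on_interior) auto
  qed
  then have "continuous_on UNIV (D k)" by (simp add: continuous_at_imp_continuous_on)
  then show "Ck_fun k (D 0)" using D by (intro Ck_funI[of D]) auto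
  show "j \<le> k \<Longrightarrow> vderiv j (D 0) = D j" using D by (intro vderiv_eqI[where D = D and k = k]) auto
qed

lemma finite_sum_le_infsum_ennreal:
  fixes f :: "'a \<Rightarrow> ennreal"
  assumes "finite F"
  shows "sum f F \<le> (\<Sum>\<^sub>\<infinity>k. f k)"
  using infsum_mono_neutral[of f F f UNIV] assms by (simp add: nonneg_summable_on_complete)

text \<open>A bridge from sums in \<open>ennreal\<close>, in which \<open>mod_norm\<close> is
  formed, to real summable families, which can majorise a series of functions.\<close>

lemma infsum_ennreal_finite:
  fixes a :: "'a \<Rightarrow> real"
  assumes nonneg: "\<And>k. 0 \<le> a k" and fin: "(\<Sum>\<^sub>\<infinity>k. ennreal (a k)) < \<infinity>"
  shows "a summable_on UNIV" and "(\<Sum>\<^sub>\<infinity>k. a k) \<le> enn2real (\<Sum>\<^sub>\<infinity>k. ennreal (a k))"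
proof -
  have le: "sum a F \<le> enn2real (\<Sum>\<^sub>\<infinity>k. ennreal (a k))" if "finite F" for F
  proof -
    have "ennreal (sum a F) = (\<Sum>k\<in>F. ennreal (a k))" using nonneg by (simp add: sum_ennreal)
    also have "\<dots> \<le> (\<Sum>\<^sub>\<infinity>k. ennreal (a k))"
      by (rule finite_sum_le_infsum_ennreal[OF that])
    finally have "ennreal (sum a F) \<le> (\<Sum>\<^sub>\<infinity>k. ennreal (a k))" .
    then have "enn2real (ennreal (sum a F)) \<le> enn2real (\<Sum>\<^sub>\<infinity>k. ennreal (a k))"
      using fin by (intro enn2real_mono) auto
    then show ?thesis using nonneg by (simp add: sum_nonneg)
  qed
  show s: "a summable_on UNIV"
    by (rule nonneg_bdd_above_summable_on) (use nonneg le in \<open>auto intro!: bdd_aboveI2\<close>)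
  show "(\<Sum>\<^sub>\<infinity>k. a k) \<le> enn2real (\<Sum>\<^sub>\<infinity>k. ennreal (a k))"
    by (rule infsum_le_finite_sums[OF s]) (use le in auto)
qed

text \<open>Serves to distribute an arbitrarily small total error over all blocks.\<close>

lemma ex_positive_summable_int: "\<exists>d :: int \<Rightarrow> real. (\<forall>k. d k > 0) \<and> d summable_on UNIV"
proof -
  have "(\<lambda>n::nat. (1 / 2 :: real) ^ n) summable_on UNIV"
    by (rule norm_summable_imp_summable_on) (simp add: summable_geometric)
  then have "(\<lambda>k. (1 / 2 :: real) ^ int_encode k) summable_on UNIV"
    using summable_on_reindex_bij_betw[OF bij_int_encode, of "\<lambda>n. (1 / 2 :: real) ^ n"] by simp
  then show ?thesis by (intro exI[of _ "\<lambda>k. (1 / 2) ^ int_encode k"]) auto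
qed

text \<open>The power 5/2 of (1 + |k|)^2 <= 2 (1 + k^2): five derivatives of a block cost no more
  than the weight of order 5.\<close>

lemma power5_le_weight:
  fixes k :: real
  shows "(1 + \<bar>k\<bar>) ^ 5 \<le> 2 powr (5 / 2) * (1 + k\<^sup>2) powr (5 / 2)"
proof -
  have "0 \<le> (1 - \<bar>k\<bar>)\<^sup>2" by simp
  then have "(1 + \<bar>k\<bar>)\<^sup>2 \<le> 2 * (1 + k\<^sup>2)" by (simp add: power2_eq_square algebra_simps)
  then have "((1 + \<bar>k\<bar>)\<^sup>2) powr (5 / 2) \<le> (2 * (1 + k\<^sup>2)) powr (5 / 2)"
    by (intro powr_mono2) auto
  moreover have "((1 + \<bar>k\<bar>)\<^sup>2) powr (5 / 2) = (1 + \<bar>k\<bar>) ^ 5"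
  proof -
    have "0 < 1 + \<bar>k\<bar>" by simp
    from powr_realpow[OF this, of 2] powr_realpow[OF this, of 5]
    have "(1 + \<bar>k\<bar>)\<^sup>2 = (1 + \<bar>k\<bar>) powr 2" "(1 + \<bar>k\<bar>) ^ 5 = (1 + \<bar>k\<bar>) powr 5"
      by simp_all
    then show ?thesis by (simp only: powr_powr) simp
  qed
  moreover have "(2 * (1 + k\<^sup>2)) powr (5 / 2) = 2 powr (5 / 2) * (1 + k\<^sup>2) powr (5 / 2)"
    by (rule powr_mult)
  ultimately show ?thesis by simp
qed

section \<open>Regularity and closedness of the space of order 5\<close>

context
  fixes \<eta> :: "real \<Rightarrow> real"
  assumes partition: "unit_partition \<eta>"
begin

lemma mod_norm_block_finite:
  assumes "mod_norm \<eta> s u < \<infinity>"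
  shows "Linf_dist (box \<eta> k u) < \<infinity>"
proof -
  let ?w = "(1 + (of_int k)\<^sup>2 :: real) powr (s / 2)"
  have "(\<Sum>k\<in>{k}. ennreal ((1 + (of_int k)\<^sup>2) powr (s / 2)) * Linf_dist (box \<eta> k u)) \<le> mod_norm \<eta> s u"
    unfolding mod_norm_def by (rule finite_sum_le_infsum_ennreal) simp
  then have "ennreal ?w * Linf_dist (box \<eta> k u) < \<infinity>" using assms by (auto intro: le_less_trans)
  moreover have "?w > 0" using add_pos_nonneg[of "1::real" "(of_int k)\<^sup>2"] by simp
  ultimately show ?thesis by (auto simp: ennreal_mult_less_top ennreal_zero_less_top)
qed

text \<open>The distribution is rebuilt as the sum of smooth representatives of its blocks; the
  \<open>j\<close>-th derivative of the \<open>k\<close>-th block costs a factor \<open>(1 + \<bar>k\<bar>) ^ j\<close>.\<close>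

lemma mod_norm_regularity:
  "\<exists>C\<ge>0. \<forall>f u. continuous_on UNIV f \<longrightarrow> represents f u \<longrightarrow> tempered u \<longrightarrow> mod_norm \<eta> 5 u < \<infinity> \<longrightarrow>
     Ck_fun 5 f \<and> (\<forall>j\<le>5. \<forall>x. norm (vderiv j f x) \<le> C * enn2real (mod_norm \<eta> 5 u))"
proof -
  obtain C where C: "C \<ge> 0" "\<And>k j. j \<le> 5 \<Longrightarrow>
      (LINT x|lborel. norm (vderiv j (inv_fourier (wide_block \<eta> k)) x)) \<le> C * (1 + \<bar>of_int k\<bar>) ^ 5"
    using wide_block_kernel_bound[OF partition, of 5] by blast
  define K where "K = C * 2 powr (5 / 2)"
  have K: "K \<ge> 0" using C(1) by (simp add: K_def)
  obtain d :: "int \<Rightarrow> real" where d: "\<And>k. d k > 0" "d summable_on UNIV"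
    using ex_positive_summable_int by blast
  define D0 where "D0 = (\<Sum>\<^sub>\<infinity>k. d k)"
  have D0: "D0 \<ge> 0" unfolding D0_def using d(1) by (intro infsum_nonneg) (simp add: less_imp_le)
  have main: "Ck_fun 5 f \<and> (\<forall>j\<le>5. \<forall>x. norm (vderiv j f x) \<le> K * (enn2real (mod_norm \<eta> 5 u) + e * D0))"
    if f: "continuous_on UNIV f" "represents f u" and u: "tempered u" "mod_norm \<eta> 5 u < \<infinity>" and e: "e > 0"
    for f u and e :: real
  proof -
    define w where "w k = (1 + (of_int k)\<^sup>2 :: real) powr (5 / 2)" for k :: int
    have w: "w k > 0" for k
      using add_pos_nonneg[of "1::real" "(of_int k)\<^sup>2"] by (simp add: w_def)
    define L where "L k = enn2real (Linf_dist (box \<eta> k u))" for k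
    have L: "Linf_dist (box \<eta> k u) = ennreal (L k)" "L k \<ge> 0" for k
      using mod_norm_block_finite[OF u(2), of k] by (auto simp: L_def)
    have norm_eq: "mod_norm \<eta> 5 u = (\<Sum>\<^sub>\<infinity>k. ennreal (w k * L k))"
      unfolding mod_norm_def using L w by (simp add: w_def ennreal_mult')
    have wL: "(\<lambda>k. w k * L k) summable_on UNIV" "(\<Sum>\<^sub>\<infinity>k. w k * L k) \<le> enn2real (mod_norm \<eta> 5 u)"
      using infsum_ennreal_finite[of "\<lambda>k. w k * L k"] L(2) w u(2) by (auto simp: norm_eq less_imp_le)
    \<comment> \<open>The slack allows for an infimum in \<open>Linf_dist\<close> that is not
      attained; divided by the weight, it contributes only \<open>e * D0\<close> to the weighted
      sum.\<close>
    define c where "c k = L k + e * d k / w k" for k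
    have "\<exists>g. g \<in> borel_measurable borel \<and> (\<forall>x. norm (g x) \<le> c k) \<and> represents g (box \<eta> k u)" for k
    proof -
      have "Linf_dist (box \<eta> k u) < ennreal (c k)"
        using L d(1)[of k] w[of k] e by (simp add: c_def ennreal_less_iff)
      then show ?thesis by (rule Linf_dist_obtain) blast
    qed
    then obtain g where g: "\<And>k. g k \<in> borel_measurable borel" "\<And>k x. norm (g k x) \<le> c k"
        "\<And>k. represents (g k) (box \<eta> k u)" by metis
    define J where "J k = inv_fourier (wide_block \<eta> k)" for k
    have J: "J k \<in> schwartz" for k
      unfolding J_def by (rule schwartz_inv_fourier[OF wide_block_schwartz[OF partition]])
    define G where "G k = conv (J k) (g k)" for k
    have G: "smooth_fun (G k)" "vderiv j (G k) = conv (vderiv j (J k)) (g k)" for k j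
      unfolding G_def using conv_smooth[OF g(1,2) J] by auto
    have Grep: "represents (G k) (box \<eta> k u)" for k
      unfolding G_def J_def by (rule represents_box_conv[OF partition g])
    define b where "b k = K * (w k * L k + e * d k)" for k
    have Gb: "norm (vderiv j (G k) x) \<le> b k" if "j \<le> 5" for j k x
    proof -
      have c0: "c k \<ge> 0" using order_trans[OF norm_ge_zero g(2)] .
      have "norm (vderiv j (G k) x) \<le> c k * (LINT y|lborel. norm (vderiv j (J k) y))"
        unfolding G by (rule norm_conv_le[OF g(1,2) schwartz_vderiv[OF J]])
      also have "\<dots> \<le> c k * (C * (1 + \<bar>of_int k\<bar>) ^ 5)"
        unfolding J_def using c0 C(2)[OF that] by (rule mult_left_mono[rotated])
      also have "\<dots> \<le> c k * (C * (2 powr (5 / 2) * w k))"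
        unfolding w_def using c0 C(1) power5_le_weight[of "of_int k"] by (intro mult_left_mono) auto
      also have "\<dots> = b k" using w[of k] by (simp add: b_def c_def K_def field_simps)
      finally show ?thesis .
    qed
    have ed: "(\<lambda>k. e * d k) summable_on UNIV" using d(2) by (rule summable_on_cmult_right)
    have b: "b summable_on UNIV"
      unfolding b_def[abs_def] by (intro summable_on_cmult_right summable_on_add wL ed)
    have bsum: "(\<Sum>\<^sub>\<infinity>k. b k) \<le> K * (enn2real (mod_norm \<eta> 5 u) + e * D0)"
    proof -
      have "(\<Sum>\<^sub>\<infinity>k. b k) = K * ((\<Sum>\<^sub>\<infinity>k. w k * L k) + e * D0)"
        unfolding b_def D0_def infsum_cmult_right' infsum_add[OF wL(1) ed] ..
      also have "\<dots> \<le> K * (enn2real (mod_norm \<eta> 5 u) + e * D0)"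
        using K wL(2) by (intro mult_left_mono) auto
      finally show ?thesis .
    qed
    let ?A = "\<lambda>N. {-int N..int N}"
    define F where "F N = (\<lambda>x. \<Sum>k\<in>?A N. G k x)" for N
    define D where "D j = (\<lambda>x. \<Sum>\<^sub>\<infinity>k. vderiv j (G k) x)" for j
    have F: "smooth_fun (F N)" "vderiv j (F N) = (\<lambda>x. \<Sum>k\<in>?A N. vderiv j (G k) x)" for N j
      unfolding F_def using G by (auto simp: smooth_fun_sum vderiv_sum)
    have lim: "uniform_limit UNIV (\<lambda>N. vderiv j (F N)) (D j) sequentially" if "j \<le> 5" for j
      unfolding F D_def by (rule uniform_limit_infsum_int(1)[OF b Gb[OF that]])
    have Dle: "norm (D j x) \<le> (\<Sum>\<^sub>\<infinity>k. b k)" if "j \<le> 5" for j x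
      unfolding D_def by (rule uniform_limit_infsum_int(2)[OF b Gb[OF that]])
    have CF: "Ck_fun 5 (F N)" for N using F(1) by (simp add: smooth_fun_def)
    have lim': "uniform_limit {-r..r} (\<lambda>N. vderiv j (F N)) (D j) sequentially" if "j \<le> 5" for j r
      by (rule uniform_limit_on_subset[OF lim[OF that]]) simp
    note Ck = Ck_fun_uniform_limit(1)[where f = F and D = D, OF CF lim']
      and vD = Ck_fun_uniform_limit(2)[where f = F and D = D, OF CF lim']
    have cont: "continuous_on UNIV (D 0)" using Ck_fun_continuous[OF Ck, of 0] by simp
    have Dmeas: "D 0 \<in> borel_measurable borel" by (rule borel_measurable_continuous_onI[OF cont])
    \<comment> \<open>Dominated convergence passes the pairing of the partial sums with
      \<open>\<phi>\<close> to that of \<open>D 0\<close>, while \<open>box_partial_sums\<close>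
      says that the same numbers tend to \<open>u \<phi>\<close>.\<close>
    have "represents (D 0) u"
      unfolding represents_def reg_dist_def
    proof (intro ballI conjI)
      fix \<phi> assume \<phi>: "\<phi> \<in> schwartz"
      have [measurable]: "\<phi> \<in> borel_measurable borel" "D 0 \<in> borel_measurable borel"
          "F N \<in> borel_measurable borel" for N
        by (auto intro: schwartz_measurable[OF \<phi>] Dmeas borel_measurable_continuous_onI smooth_fun_continuous_0 F)
      show "integrable lborel (\<lambda>x. D 0 x * \<phi> x)"
        by (rule integrable_mult_bounded(2)[OF Dmeas Dle schwartz_integrable[OF \<phi>]]) simp
      have FN: "norm (F N x) \<le> (\<Sum>\<^sub>\<infinity>k. b k)" for N x
      proof -
        have "norm (F N x) \<le> (\<Sum>k\<in>?A N. norm (G k x))" unfolding F_def by (rule norm_sum)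
        also have "\<dots> \<le> (\<Sum>k\<in>?A N. b k)" using Gb[of 0] by (intro sum_mono) auto
        also have "\<dots> \<le> (\<Sum>\<^sub>\<infinity>k. b k)"
          using order_trans[OF norm_ge_zero Gb[of 0]] by (intro finite_sum_le_infsum b) auto
        finally show ?thesis .
      qed
      have "(\<lambda>N. LINT x|lborel. F N x * \<phi> x) \<longlonglongrightarrow> (LINT x|lborel. D 0 x * \<phi> x)"
      proof (rule integral_dominated_convergence[where w = "\<lambda>x. (\<Sum>\<^sub>\<infinity>k. b k) * norm (\<phi> x)"])
        show "integrable lborel (\<lambda>x. (\<Sum>\<^sub>\<infinity>k. b k) * norm (\<phi> x))"
          by (intro integrable_mult_right integrable_norm schwartz_integrable \<phi>)
        show "AE x in lborel. norm (F N x * \<phi> x) \<le> (\<Sum>\<^sub>\<infinity>k. b k) * norm (\<phi> x)" for N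
          unfolding norm_mult by (intro AE_I2 mult_right_mono FN) simp
        show "AE x in lborel. (\<lambda>N. F N x * \<phi> x) \<longlonglongrightarrow> D 0 x * \<phi> x"
          using tendsto_uniform_limitI[OF lim[of 0] UNIV_I] by (intro AE_I2 tendsto_mult_right) simp
      qed measurable
      moreover have "(LINT x|lborel. F N x * \<phi> x) = (\<Sum>k\<in>?A N. box \<eta> k u \<phi>)" for N
      proof -
        have "(LINT x|lborel. F N x * \<phi> x) = (\<Sum>k\<in>?A N. LINT x|lborel. G k x * \<phi> x)"
          unfolding F_def sum_distrib_right
          using Grep \<phi> by (intro Bochner_Integration.integral_sum) (auto simp: represents_def)
        also have "\<dots> = (\<Sum>k\<in>?A N. box \<eta> k u \<phi>)"
          using Grep \<phi> by (simp add: represents_def reg_dist_def)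
        finally show ?thesis .
      qed
      ultimately have "(\<lambda>N. \<Sum>k\<in>?A N. box \<eta> k u \<phi>) \<longlonglongrightarrow> (LINT x|lborel. D 0 x * \<phi> x)" by simp
      with box_partial_sums[OF partition u(1) \<phi>] show "u \<phi> = (LINT x|lborel. D 0 x * \<phi> x)"
        by (rule LIMSEQ_unique)
    qed
    then have "f = D 0" by (rule eq_by_testing[OF partition f(1) cont f(2)])
    with Ck vD Dle bsum show ?thesis by (auto intro: order_trans)
  qed
  show ?thesis
  proof (intro exI[of _ K] conjI allI impI K)
    fix f u
    assume fu: "continuous_on UNIV f" "represents f u" "tempered u" "mod_norm \<eta> 5 u < \<infinity>"
    show "Ck_fun 5 f" using main[OF fu, of 1] by simp
    fix j :: nat and x assume j: "j \<le> 5"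
    show "norm (vderiv j f x) \<le> K * enn2real (mod_norm \<eta> 5 u)"
    proof (rule field_le_epsilon)
      fix e :: real assume "e > 0"
      \<comment> \<open>Makes the total slack \<open>K * e' * D0\<close> at most \<open>e\<close>;
        the added 1 keeps the denominator positive.\<close>
      define e' where "e' = e / (K * D0 + 1)"
      have pos: "K * D0 + 1 > 0" using K D0 by (simp add: add_nonneg_pos)
      have e': "e' > 0" using \<open>e > 0\<close> pos by (simp add: e'_def)
      have "norm (vderiv j f x) \<le> K * (enn2real (mod_norm \<eta> 5 u) + e' * D0)"
        using main[OF fu e'] j by blast
      also have "\<dots> = K * enn2real (mod_norm \<eta> 5 u) + e' * (K * D0)" by (simp add: algebra_simps)
      also have "e' * (K * D0) \<le> e' * (K * D0 + 1)" using e' by (intro mult_left_mono) auto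
      also have "\<dots> = e" using pos by (simp add: e'_def)
      finally show "norm (vderiv j f x) \<le> K * enn2real (mod_norm \<eta> 5 u) + e" by simp
    qed
  qed
qed

lemma mod_space_regular:
  assumes "f \<in> mod_space \<eta> 5"
  obtains M where "Ck_fun 5 f" "\<And>j x. j \<le> 5 \<Longrightarrow> norm (vderiv j f x) \<le> M"
proof -
  obtain u where "continuous_on UNIV f" "represents f u" "tempered u" "mod_norm \<eta> 5 u < \<infinity>"
    using assms by (auto simp: mod_space_def mod_dist_def)
  with mod_norm_regularity that show ?thesis by metis
qed

text \<open>Intended for differences of solutions. Boundedness makes \<open>reg_dist f\<close> a
  tempered distribution represented by \<open>f\<close>, but the constant \<open>C\<close> does not
  depend on the bound \<open>M\<close>.\<close>

lemma mod_fnorm_bound: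
  "\<exists>C\<ge>0. \<forall>f M. continuous_on UNIV f \<longrightarrow> (\<forall>x. norm (f x) \<le> M) \<longrightarrow> mod_fnorm \<eta> 5 f < \<infinity> \<longrightarrow>
     (\<forall>j\<le>5. \<forall>x. norm (vderiv j f x) \<le> C * enn2real (mod_fnorm \<eta> 5 f))"
proof -
  obtain C where C: "C \<ge> 0" "\<And>f u j x. \<lbrakk>continuous_on UNIV f; represents f u; tempered u; mod_norm \<eta> 5 u < \<infinity>; j \<le> 5\<rbrakk>
      \<Longrightarrow> norm (vderiv j f x) \<le> C * enn2real (mod_norm \<eta> 5 u)"
    using mod_norm_regularity by metis
  show ?thesis
  proof (intro exI[of _ C] conjI allI impI C)
    fix f M j x
    assume f: "continuous_on UNIV f" "\<forall>x. norm (f x) \<le> M" "mod_fnorm \<eta> 5 f < \<infinity>" "j \<le> (5::nat)"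
    have m: "f \<in> borel_measurable borel" by (rule borel_measurable_continuous_onI[OF f(1)])
    show "norm (vderiv j f x) \<le> C * enn2real (mod_fnorm \<eta> 5 f)"
      using f unfolding mod_fnorm_def
      by (intro C(2) represents_reg_dist[OF m, of M] tempered_reg_dist[OF m, of M]) auto
  qed
qed

text \<open>A Fatou property of the norm, block by block: convolution with a Schwartz kernel
  commutes with translations and with bounded pointwise limits, so each sup bound on a block of
  \<open>f\<close> is inherited by the same block of \<open>p\<close>.\<close>

lemma mod_space_translation_limit:
  assumes f: "f \<in> mod_space \<eta> 5" and p: "continuous_on UNIV p"
    and lim: "\<And>x. (\<lambda>n. f (x + y n)) \<longlonglongrightarrow> p x"
  shows "p \<in> mod_space \<eta> 5"
proof -
  obtain u where u: "continuous_on UNIV f" "represents f u" "tempered u" "mod_norm \<eta> 5 u < \<infinity>"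
    using f by (auto simp: mod_space_def mod_dist_def)
  obtain M where "\<And>j x. j \<le> 5 \<Longrightarrow> norm (vderiv j f x) \<le> M" using mod_space_regular[OF f] by blast
  from this[of 0] have fb: "norm (f x) \<le> M" for x by simp
  have pb: "norm (p x) \<le> M" for x
    using fb by (intro LIMSEQ_le_const2[OF tendsto_norm[OF lim[of x]]]) auto
  have fm: "f \<in> borel_measurable borel" and pm: "p \<in> borel_measurable borel"
    using u(1) p by (auto intro: borel_measurable_continuous_onI)
  \<comment> \<open>\<open>u\<close> and \<open>reg_dist f\<close> agree on Schwartz functions only;
    for Schwartz \<open>\<phi>\<close> the block evaluates its distribution at a Schwartz
    function.\<close>
  have box_eq: "box \<eta> k (reg_dist f) \<phi> = box \<eta> k u \<phi>" if "\<phi> \<in> schwartz" for k \<phi>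
  proof -
    have "fourier (\<lambda>\<xi>. block \<eta> k \<xi> * inv_fourier \<phi> \<xi>) \<in> schwartz"
      by (intro schwartz_fourier block_mult_schwartz[OF partition] schwartz_inv_fourier that)
    then show ?thesis using u(2) by (simp add: box_block[OF partition] represents_def)
  qed
  have Linf_le: "Linf_dist (box \<eta> k (reg_dist p)) \<le> Linf_dist (box \<eta> k u)" for k
  proof (rule ccontr)
    assume "\<not> ?thesis"
    then have less: "Linf_dist (box \<eta> k u) < Linf_dist (box \<eta> k (reg_dist p))" by simp
    \<comment> \<open>A number strictly in between gives \<open>Linf_dist_obtain\<close> room for a
      representative that is bounded everywhere.\<close>
    then obtain a where a: "Linf_dist (box \<eta> k u) < a" "a < Linf_dist (box \<eta> k (reg_dist p))"
      using dense by blast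
    from a(2) have "a \<noteq> \<top>" by auto
    then obtain c where c: "a = ennreal c" by (cases a) auto
    obtain g where g: "g \<in> borel_measurable borel" "\<And>x. norm (g x) \<le> c" "represents g (box \<eta> k u)"
      using Linf_dist_obtain a(1) unfolding c by blast
    let ?K = "inv_fourier (block \<eta> k)"
    have K: "?K \<in> schwartz" by (rule schwartz_inv_fourier[OF block_schwartz[OF partition]])
    have "represents (conv ?K f) (box \<eta> k u)"
      using represents_box_reg_dist[OF partition fm fb, of k] by (simp add: represents_def box_eq)
    then have Kf: "norm (conv ?K f x) \<le> c" for x
      by (rule norm_le_representative[OF partition smooth_fun_continuous_0[OF conv_smooth(1)[OF fm fb K]] _ g])
    have "(\<lambda>n. conv ?K f (x + y n)) \<longlonglongrightarrow> conv ?K p x" for x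
    proof -
      have eq: "conv ?K f (x + y n) = (LINT z|lborel. ?K (x - z) * f (z + y n))" for n
        unfolding conv_def
        using integral_translate[of "\<lambda>z. ?K (x + y n - z) * f z" "y n"] by simp
      have [measurable]: "?K \<in> borel_measurable borel" "f \<in> borel_measurable borel" "p \<in> borel_measurable borel"
        using fm pm schwartz_measurable[OF K] by auto
      show ?thesis
        unfolding eq conv_def[of _ p]
      proof (rule integral_dominated_convergence[where w = "\<lambda>z. norm (?K (x - z)) * M"])
        show "integrable lborel (\<lambda>z. norm (?K (x - z)) * M)"
          by (intro integrable_mult_left integrable_norm integrable_reflect schwartz_integrable K)
        show "AE z in lborel. (\<lambda>n. ?K (x - z) * f (z + y n)) \<longlonglongrightarrow> ?K (x - z) * p z"
          by (intro AE_I2 tendsto_mult_left lim)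
        show "AE z in lborel. norm (?K (x - z) * f (z + y n)) \<le> norm (?K (x - z)) * M" for n
          unfolding norm_mult by (intro AE_I2 mult_left_mono fb) simp
      qed measurable
    qed
    from LIMSEQ_le_const2[OF tendsto_norm[OF this]] have "norm (conv ?K p x) \<le> c" for x
      using Kf by blast
    then have "Linf_dist (box \<eta> k (reg_dist p)) \<le> ennreal c"
      by (rule Linf_dist_le[OF conv_measurable[OF pm pb K] _ represents_box_reg_dist[OF partition pm pb]])
    with a(2) c show False by simp
  qed
  have "mod_norm \<eta> 5 (reg_dist p) \<le> mod_norm \<eta> 5 u"
    unfolding mod_norm_def
    by (intro infsum_mono mult_left_mono Linf_le) (simp_all add: nonneg_summable_on_complete)
  with u(4) have "reg_dist p \<in> mod_dist \<eta> 5"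
    using tempered_reg_dist[OF pm pb] by (auto simp: mod_dist_def)
  with p represents_reg_dist[OF pm pb] show ?thesis by (auto simp: mod_space_def)
qed

end

section \<open>Linear differential equations\<close>

lemma ex_primitive:
  fixes g :: "real \<Rightarrow> 'a::banach"
  assumes "continuous_on UNIV g"
  shows "\<exists>G. G 0 = 0 \<and> (\<forall>x. (G has_vector_derivative g x) (at x))"
proof -
  define G where "G x = (if x \<ge> 0 then integral {0..x} g else - integral {x..0} g)" for x
  have int: "g integrable_on {a..b}" for a b
    by (intro integrable_continuous_real continuous_on_subset[OF assms]) auto
  have "(G has_vector_derivative g x) (at x)" for x
  proof -
    \<comment> \<open>Near \<open>x\<close>, on both sides of 0, \<open>G\<close> differs by a
      constant from the integral with the fixed lower end \<open>-r\<close>.\<close>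
    define r where "r = \<bar>x\<bar> + 1"
    have G: "G y = integral {-r..y} g - integral {-r..0} g" if "y \<in> {-r<..<r}" for y
    proof (cases "y \<ge> 0")
      case True
      have "integral {-r..0} g + integral {0..y} g = integral {-r..y} g"
        by (rule Henstock_Kurzweil_Integration.integral_combine) (use True that int in auto)
      with True show ?thesis by (simp add: G_def algebra_simps)
    next
      case False
      have "integral {-r..y} g + integral {y..0} g = integral {-r..0} g"
        by (rule Henstock_Kurzweil_Integration.integral_combine) (use False that int in auto)
      with False show ?thesis by (simp add: G_def algebra_simps)
    qed
    have x: "x \<in> {-r<..<r}" by (auto simp: r_def)
    have "((\<lambda>y. integral {-r..y} g) has_vector_derivative g x) (at x within {-r..r})"
      by (rule integral_has_vector_derivative) (use x continuous_on_subset[OF assms] in auto)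
    then have "((\<lambda>y. integral {-r..y} g) has_vector_derivative g x) (at x)"
      using x by (simp add: at_within_Icc_at)
    then have "((\<lambda>y. integral {-r..y} g - integral {-r..0} g) has_vector_derivative g x - 0) (at x)"
      by (intro has_vector_derivative_diff has_vector_derivative_const)
    from has_vector_derivative_transform_within_open[OF this open_greaterThanLessThan x G[symmetric]]
    show ?thesis by simp
  qed
  moreover have "G 0 = 0" by (simp add: G_def)
  ultimately show ?thesis by blast
qed

text \<open>The majorant is a function of \<open>\<bar>x\<bar>\<close>, so that one bound on the
  Picard iterates serves both directions; negative \<open>x\<close> is handled by
  reflection.\<close>

lemma norm_le_primitive:
  fixes f :: "real \<Rightarrow> 'a::real_normed_vector"
  assumes f: "\<And>s. (f has_vector_derivative f' s) (at s)" and "f 0 = 0"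
    and \<phi>: "\<And>s. (\<phi> has_vector_derivative \<phi>' s) (at s)" and "\<phi> 0 = 0"
    and le: "\<And>s. \<bar>s\<bar> < \<bar>x\<bar> \<Longrightarrow> norm (f' s) \<le> \<phi>' \<bar>s\<bar>"
  shows "norm (f x) \<le> \<phi> \<bar>x\<bar>"
proof -
  consider "x = 0" | "x > 0" | "x < 0" by linarith
  then show ?thesis
  proof cases
    case 2
    have "norm (f x - f 0) \<le> \<phi> x - \<phi> 0"
    proof (rule differentiable_bound_general)
      show "continuous_on {0..x} f" "continuous_on {0..x} \<phi>"
        using f \<phi> by (meson continuous_at_imp_continuous_on has_vector_derivative_continuous)+
      show "norm (f' s) \<le> \<phi>' s" if "0 < s" "s < x" for s using le[of s] that by simp
    qed (use 2 f \<phi> in auto)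
    with 2 assms(2,4) show ?thesis by simp
  next
    case 3
    have d: "((\<lambda>s. f (- s)) has_vector_derivative - f' (- s)) (at s)" for s
      using has_vector_derivative_affine[of f "f' (- s)" "-1" s 0] f by simp
    have "norm (f (- (- x)) - f (- 0)) \<le> \<phi> (- x) - \<phi> 0"
    proof (rule differentiable_bound_general[where f = "\<lambda>s. f (- s)" and f' = "\<lambda>s. - f' (- s)"])
      show "continuous_on {0..- x} (\<lambda>s. f (- s))" "continuous_on {0..- x} \<phi>"
        using d \<phi> by (meson continuous_at_imp_continuous_on has_vector_derivative_continuous)+
      show "norm (- f' (- s)) \<le> \<phi>' s" if "0 < s" "s < - x" for s using le[of "- s"] that by simp
    qed (use 3 d \<phi> in auto)
    with 3 assms(2,4) show ?thesis by simp
  qed (use assms in auto)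
qed

text \<open>Picard iteration as a series: \<open>D n\<close> is the integral operator applied
  \<open>n\<close> times to the constant \<open>c\<close>, bounded by a term of an exponential
  series. A general bilinear \<open>h\<close> covers coefficients acting from the left and, flipped,
  from the right.\<close>

lemma linear_ode_exists:
  fixes U :: "real \<Rightarrow> 'a::real_normed_vector" and h :: "'a \<Rightarrow> 'b \<Rightarrow> 'b::banach"
  assumes h: "bounded_bilinear h" and U: "continuous_on UNIV U"
  shows "\<exists>Y. Y 0 = c \<and> (\<forall>s. (Y has_vector_derivative h (U s) (Y s)) (at s))"
proof -
  interpret h: bounded_bilinear h by (rule h)
  obtain K where K: "K > 0" "\<And>a b. norm (h a b) \<le> norm a * norm b * K" using h.pos_bounded by blast
  have "\<exists>G. continuous_on UNIV G \<and> G 0 = 0 \<and> (\<forall>x. (G has_vector_derivative h (U x) (g x)) (at x))"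
    if g: "continuous_on UNIV g" for g :: "real \<Rightarrow> 'b"
  proof -
    obtain G where "G 0 = 0" "\<And>x. (G has_vector_derivative h (U x) (g x)) (at x)"
      using ex_primitive[OF h.continuous_on[OF U g]] by blast
    moreover from this(2) have "continuous_on UNIV G"
      by (meson continuous_at_imp_continuous_on has_vector_derivative_continuous)
    ultimately show ?thesis by blast
  qed
  then obtain P where P: "\<And>g. continuous_on UNIV g \<Longrightarrow> continuous_on UNIV (P g)"
      "\<And>g. continuous_on UNIV g \<Longrightarrow> P g 0 = 0"
      "\<And>g x. continuous_on UNIV g \<Longrightarrow> (P g has_vector_derivative h (U x) (g x)) (at x)" by metis
  define D where "D n = (P ^^ n) (\<lambda>_. c)" for n
  have D0: "D 0 = (\<lambda>_. c)" and DSuc: "D (Suc n) = P (D n)" for n by (simp_all add: D_def)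
  have Dc: "continuous_on UNIV (D n)" for n by (induction n) (auto simp: D0 DSuc P)
  have "\<exists>M\<ge>0. \<forall>x. \<bar>x\<bar> \<le> r \<longrightarrow> norm (U x) \<le> M" for r
  proof -
    have "bounded (U ` {-r..r})"
      by (intro compact_imp_bounded compact_continuous_image continuous_on_subset[OF U]) auto
    then obtain M where M: "\<forall>y\<in>U ` {-r..r}. norm y \<le> M" unfolding bounded_iff by blast
    have "norm (U x) \<le> max M 0" if "\<bar>x\<bar> \<le> r" for x
    proof -
      from that have "x \<in> {-r..r}" by auto
      with M show ?thesis by (auto simp: le_max_iff_disj)
    qed
    then show ?thesis by (intro exI[of _ "max M 0"]) auto
  qed
  then obtain M where M: "\<And>r. M r \<ge> 0" "\<And>r x. \<bar>x\<bar> \<le> r \<Longrightarrow> norm (U x) \<le> M r" by metis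
  have Dn: "norm (D n x) \<le> norm c * ((M r * K) ^ n / fact n) * \<bar>x\<bar> ^ n" if "\<bar>x\<bar> \<le> r" for n x r
    using that
  proof (induction n arbitrary: x)
    case (Suc n)
    let ?C = "norm c * ((M r * K) ^ n / fact n)"
    have "norm (D (Suc n) x) \<le> (\<lambda>s. M r * K * ?C * (s ^ Suc n / Suc n)) \<bar>x\<bar>"
    proof (rule norm_le_primitive)
      show "(D (Suc n) has_vector_derivative h (U s) (D n s)) (at s)" for s
        unfolding DSuc by (rule P(3)[OF Dc])
      show "D (Suc n) 0 = 0" unfolding DSuc by (rule P(2)[OF Dc])
      show "((\<lambda>s. M r * K * ?C * (s ^ Suc n / Suc n)) has_vector_derivative M r * K * (?C * s ^ n)) (at s)" for s
      proof -
        have "((\<lambda>s. s ^ Suc n / real (Suc n)) has_real_derivative s ^ n) (at s)"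
          using DERIV_cdivide[OF DERIV_pow[of "Suc n" s], of "real (Suc n)"] by (simp del: of_nat_Suc power_Suc)
        from DERIV_cmult[OF this, of "M r * K * ?C"] show ?thesis
          unfolding has_real_derivative_iff_has_vector_derivative[symmetric] by (simp only: mult.assoc)
      qed
      show "norm (h (U s) (D n s)) \<le> M r * K * (?C * \<bar>s\<bar> ^ n)" if "\<bar>s\<bar> < \<bar>x\<bar>" for s
      proof -
        have "\<bar>s\<bar> \<le> r" using that Suc.prems by simp
        then have "norm (U s) * norm (D n s) * K \<le> M r * (?C * \<bar>s\<bar> ^ n) * K"
          using M Suc.IH K(1) by (intro mult_right_mono mult_mono) auto
        with K(2)[of "U s" "D n s"] show ?thesis by (simp add: mult_ac)
      qed
    qed simp
    then show ?case by (simp add: field_simps del: of_nat_Suc)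
  qed (simp add: D0)
  define Y where "Y x = (\<Sum>n. D n x)" for x
  have S: "uniform_limit {-r..r} (\<lambda>n x. \<Sum>i<n. D i x) Y sequentially" for r
    unfolding Y_def
  proof (rule Weierstrass_m_test)
    show "norm (D n x) \<le> norm c * (inverse (fact n) * (M r * K * \<bar>r\<bar>) ^ n)" if "x \<in> {-r..r}" for n x
    proof -
      have x: "\<bar>x\<bar> \<le> r" using that by auto
      have "norm (D n x) \<le> norm c * ((M r * K) ^ n / fact n) * \<bar>x\<bar> ^ n" by (rule Dn[OF x])
      also have "\<dots> \<le> norm c * ((M r * K) ^ n / fact n) * \<bar>r\<bar> ^ n"
        using x M(1) K(1) by (intro mult_left_mono power_mono) auto
      finally show ?thesis by (simp add: power_mult_distrib divide_inverse mult_ac)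
    qed
    show "summable (\<lambda>n. norm c * (inverse (fact n) * (M r * K * \<bar>r\<bar>) ^ n))"
      by (intro summable_mult summable_exp)
  qed
  have Spt: "(\<lambda>n. \<Sum>i<n. D i x) \<longlonglongrightarrow> Y x" for x
    by (rule tendsto_uniform_limitI[OF S[of "\<bar>x\<bar>"]]) auto
  have der: "(Y has_vector_derivative h (U x) (Y x)) (at x)" for x
  proof (rule has_vector_derivative_uniform_limit)
    \<comment> \<open>Differentiation shifts the index by one: the derivative of the partial sum of
      length \<open>Suc n\<close> involves the partial sum of length \<open>n\<close>.\<close>
    show "((\<lambda>x. \<Sum>i<Suc n. D i x) has_vector_derivative h (U x) (\<Sum>i<n. D i x)) (at x)" for n x
    proof (induction n)
      case 0
      then show ?case by (simp add: D0 h.zero_right)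
    next
      case (Suc n)
      have "((\<lambda>x. (\<Sum>i<Suc n. D i x) + D (Suc n) x) has_vector_derivative
          h (U x) (\<Sum>i<n. D i x) + h (U x) (D n x)) (at x)"
        by (intro has_vector_derivative_add Suc) (simp add: DSuc P Dc)
      then show ?case by (simp add: h.add_right)
    qed
    show "(\<lambda>n. \<Sum>i<Suc n. D i x) \<longlonglongrightarrow> Y x" for x
      using Spt[of x] by (rule LIMSEQ_Suc)
    show "uniform_limit {-r..r} (\<lambda>n x. h (U x) (\<Sum>i<n. D i x)) (\<lambda>x. h (U x) (Y x)) sequentially" for r
    proof (rule uniform_limitI)
      fix e :: real assume "e > 0"
      have MK: "M r * K + 1 > 0" using M(1)[of r] K(1) by (simp add: add_nonneg_pos)
      then have "e / (M r * K + 1) > 0" using \<open>e > 0\<close> by simp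
      from uniform_limitD[OF S[of r] this]
      show "\<forall>\<^sub>F n in sequentially. \<forall>x\<in>{-r..r}. dist (h (U x) (\<Sum>i<n. D i x)) (h (U x) (Y x)) < e"
      proof eventually_elim
        case (elim n)
        show ?case
        proof
          fix x assume x: "x \<in> {-r..r}"
          let ?d = "norm ((\<Sum>i<n. D i x) - Y x)"
          have "dist (h (U x) (\<Sum>i<n. D i x)) (h (U x) (Y x)) \<le> norm (U x) * ?d * K"
            unfolding dist_norm h.diff_right[symmetric] by (rule K)
          also have "\<dots> \<le> M r * ?d * K"
            using x K(1) by (intro mult_right_mono M) auto
          also have "\<dots> \<le> (M r * K + 1) * ?d" by (simp add: algebra_simps)
          also have "\<dots> < (M r * K + 1) * (e / (M r * K + 1))"
            using elim x MK by (intro mult_strict_left_mono) (auto simp: dist_norm)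
          also have "\<dots> = e" using MK by simp
          finally show "dist (h (U x) (\<Sum>i<n. D i x)) (h (U x) (Y x)) < e" .
        qed
      qed
    qed
  qed
  have "D n 0 = (if n = 0 then c else 0)" for n by (cases n) (auto simp: D0 DSuc P Dc)
  then have "Y 0 = c" unfolding Y_def by (subst suminf_finite[of "{0}"]) auto
  with der show ?thesis by blast
qed

text \<open>\<open>exp (- 2 * K * s) * (f s \<bullet> f s)\<close> is nonincreasing; working with
  the square avoids differentiating the norm where \<open>f\<close> vanishes.\<close>

lemma gronwall_forward:
  fixes f :: "real \<Rightarrow> 'a::real_inner"
  assumes f: "\<And>s. (f has_vector_derivative f' s) (at s)"
    and le: "\<And>s. a \<le> s \<Longrightarrow> s \<le> b \<Longrightarrow> norm (f' s) \<le> K * norm (f s)" and "a \<le> b"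
  shows "norm (f b) \<le> exp (K * (b - a)) * norm (f a)"
proof -
  let ?g = "\<lambda>s. exp (- 2 * K * s) * (f s \<bullet> f s)"
  have "?g b \<le> ?g a"
  proof (rule DERIV_nonpos_imp_nonincreasing[OF \<open>a \<le> b\<close>])
    fix s assume s: "a \<le> s" "s \<le> b"
    have "((\<lambda>s. f s \<bullet> f s) has_real_derivative 2 * (f s \<bullet> f' s)) (at s)"
      unfolding has_real_derivative_iff_has_vector_derivative
      using bounded_bilinear.has_vector_derivative[OF bounded_bilinear_inner f f, of s]
      by (simp add: inner_commute)
    then have "(?g has_real_derivative exp (- 2 * K * s) * (2 * (f s \<bullet> f' s) - 2 * K * (f s \<bullet> f s))) (at s)"
      by (auto intro!: derivative_eq_intros simp: algebra_simps)
    moreover have "f s \<bullet> f' s \<le> K * (f s \<bullet> f s)"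
    proof -
      have "f s \<bullet> f' s \<le> norm (f s) * norm (f' s)" by (rule norm_cauchy_schwarz)
      also have "\<dots> \<le> norm (f s) * (K * norm (f s))" using le[OF s] by (intro mult_left_mono) auto
      finally show ?thesis by (simp add: dot_square_norm power2_eq_square mult_ac)
    qed
    ultimately show "\<exists>y. (?g has_real_derivative y) (at s) \<and> y \<le> 0"
      by (intro exI conjI) (auto intro!: mult_nonneg_nonpos)
  qed
  then have "exp (2 * K * b) * (exp (- 2 * K * b) * (norm (f b))\<^sup>2)
      \<le> exp (2 * K * b) * (exp (- 2 * K * a) * (norm (f a))\<^sup>2)"
    by (intro mult_left_mono) (auto simp: dot_square_norm)
  then have "(norm (f b))\<^sup>2 \<le> exp (2 * K * b - 2 * K * a) * (norm (f a))\<^sup>2"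
    by (simp add: mult.assoc[symmetric] exp_add[symmetric])
  also have "\<dots> = (exp (K * (b - a)) * norm (f a))\<^sup>2"
    by (simp add: power_mult_distrib exp_double[symmetric] algebra_simps)
  finally show ?thesis by (rule power2_le_imp_le) simp
qed

lemma gronwall:
  fixes f :: "real \<Rightarrow> 'a::real_inner"
  assumes f: "\<And>s. (f has_vector_derivative f' s) (at s)"
    and le: "\<And>s. s \<in> {min a b..max a b} \<Longrightarrow> norm (f' s) \<le> K * norm (f s)"
  shows "norm (f b) \<le> exp (K * \<bar>b - a\<bar>) * norm (f a)"
proof (cases "a \<le> b")
  case True
  then show ?thesis using gronwall_forward[OF f, of a b K] le by simp
next
  case False
  have "((\<lambda>s. f (- s)) has_vector_derivative - f' (- s)) (at s)" for s
    using has_vector_derivative_affine[of f "f' (- s)" "-1" s 0] f by simp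
  from gronwall_forward[where f = "\<lambda>s. f (- s)", OF this, of "- a" "- b" K] le False
  show ?thesis by simp
qed

section \<open>The transfer matrix\<close>

lemma norm_vec2_le: "norm (x :: 'a::real_normed_vector ^ 2) \<le> norm (x $ 1) + norm (x $ 2)"
  using L2_set_le_sum[of UNIV "\<lambda>i. norm (x $ i)"] by (simp add: norm_vec_def sum_2)

lemma norm_mat2_entries_le:
  "norm (A :: complex^2^2) \<le> norm (A $ 1 $ 1) + norm (A $ 1 $ 2) + norm (A $ 2 $ 1) + norm (A $ 2 $ 2)"
  using norm_vec2_le[of A] norm_vec2_le[of "A $ 1"] norm_vec2_le[of "A $ 2"] by simp

lemma norm_entry_le: "norm ((A :: complex^2^2) $ i $ j) \<le> norm A"
  using Finite_Cartesian_Product.norm_nth_le[of A i] Finite_Cartesian_Product.norm_nth_le[of "A $ i" j]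
  by (rule order_trans[rotated])

text \<open>The 8 counts two products in each of four entries.\<close>

lemma norm_matrix_mult_le:
  fixes A B :: "complex^2^2"
  shows "norm (A ** B) \<le> norm A * norm B * 8"
proof -
  have entry: "norm ((A ** B) $ i $ j) \<le> norm A * norm B * 2" for i j
  proof -
    have "norm (A $ i $ k * B $ k $ j) \<le> norm A * norm B" for k
      unfolding norm_mult by (intro mult_mono norm_entry_le) auto
    from add_mono[OF this[of 1] this[of 2]] show ?thesis
      using norm_triangle_ineq[of "A $ i $ 1 * B $ 1 $ j" "A $ i $ 2 * B $ 2 $ j"]
      by (simp add: matrix_matrix_mult_def sum_2)
  qed
  show ?thesis
    using norm_mat2_entries_le[of "A ** B"] entry[of 1 1] entry[of 1 2] entry[of 2 1] entry[of 2 2]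
    by linarith
qed

lemma norm_matrix_mult_le_left:
  fixes A B :: "complex^2^2"
  assumes "norm A \<le> a"
  shows "norm (A ** B) \<le> 8 * a * norm B"
proof -
  have "norm A * norm B \<le> a * norm B" using assms by (intro mult_right_mono) auto
  with norm_matrix_mult_le[of A B] show ?thesis by (simp add: mult.assoc)
qed

lemma norm_matrix_mult_le_right:
  fixes A B :: "complex^2^2"
  assumes "norm B \<le> b"
  shows "norm (A ** B) \<le> 8 * b * norm A"
proof -
  have "norm A * norm B \<le> norm A * b" using assms by (intro mult_left_mono) auto
  with norm_matrix_mult_le[of A B] show ?thesis by (simp add: mult_ac)
qed

interpretation matrix_mult: bounded_bilinear "(**) :: complex^2^2 \<Rightarrow> complex^2^2 \<Rightarrow> complex^2^2"
proof
  show "\<exists>K. \<forall>(A :: complex^2^2) (B :: complex^2^2). norm (A ** B) \<le> norm A * norm B * K"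
    by (intro exI[of _ 8] allI norm_matrix_mult_le)
qed (simp_all add: matrix_matrix_mult_def vec_eq_iff sum_2 algebra_simps)

lemma op_norm_bounded_linear: "bounded_linear (\<lambda>v. (A :: complex^2^2) *v v)"
  by (rule matrix_vector_mul_bounded_linear)

lemma op_norm_nonneg: "0 \<le> op_norm A"
  unfolding op_norm_def by (rule onorm_pos_le[OF op_norm_bounded_linear])

lemma op_norm_mult_le: "op_norm (A ** B) \<le> op_norm A * op_norm B"
  unfolding op_norm_def
  using onorm_compose[OF op_norm_bounded_linear[of A] op_norm_bounded_linear[of B]]
  by (simp add: o_def matrix_vector_mul_assoc)

lemma op_norm_triangle: "op_norm (A + B) \<le> op_norm A + op_norm B"
proof -
  have "(\<lambda>v. (A + B) *v v) = (\<lambda>v. A *v v + B *v v)"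
    by (simp add: fun_eq_iff vec_eq_iff matrix_vector_mult_def sum_2 algebra_simps)
  then show ?thesis
    unfolding op_norm_def
    using onorm_triangle[OF op_norm_bounded_linear[of A] op_norm_bounded_linear[of B]] by simp
qed

lemma op_norm_le_norm: "op_norm A \<le> 4 * norm A"
  unfolding op_norm_def
proof (rule onorm_le)
  fix v :: "complex^2"
  have entry: "norm ((A *v v) $ i) \<le> 2 * norm A * norm v" for i
  proof -
    have "norm (A $ i $ k * v $ k) \<le> norm A * norm v" for k
      unfolding norm_mult by (intro mult_mono norm_entry_le Finite_Cartesian_Product.norm_nth_le) auto
    from add_mono[OF this[of 1] this[of 2]] show ?thesis
      using norm_triangle_ineq[of "A $ i $ 1 * v $ 1" "A $ i $ 2 * v $ 2"]
      by (simp add: matrix_vector_mult_def sum_2 mult.assoc mult.commute[of "norm v"])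
  qed
  show "norm (A *v v) \<le> 4 * norm A * norm v"
    using norm_vec2_le[of "A *v v"] entry[of 1] entry[of 2] by linarith
qed

text \<open>An entry is a component of the image of a unit vector. With
  \<open>op_norm_le_norm\<close> this connects \<open>op_norm\<close>, in which the exponent is
  measured, with \<open>norm\<close>, in which the differential inequalities are proved.\<close>

lemma norm_le_op_norm: "norm A \<le> 4 * op_norm A"
proof -
  have entry: "norm (A $ i $ j) \<le> op_norm A" for i j
  proof -
    have "A $ i $ j = (A *v axis j 1) $ i"
      using exhaust_2[of j] by (auto simp: matrix_vector_mult_def sum_2 axis_def)
    then have "norm (A $ i $ j) \<le> norm (A *v axis j 1)"
      by (metis Finite_Cartesian_Product.norm_nth_le)
    also have "\<dots> \<le> op_norm A * norm (axis j (1::complex) :: complex^2)"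
      unfolding op_norm_def by (rule onorm[OF op_norm_bounded_linear])
    also have "\<dots> \<le> op_norm A * 1"
      by (intro mult_left_mono op_norm_nonneg) (use norm_vec2_le[of "axis j (1::complex)"] exhaust_2[of j] in \<open>auto simp: axis_def\<close>)
    finally show ?thesis by simp
  qed
  show ?thesis
    using norm_mat2_entries_le[of A] entry[of 1 1] entry[of 1 2] entry[of 2 1] entry[of 2 2] by linarith
qed

lemma mat2_entries [simp]:
  "mat2 a b c d $ 1 $ 1 = a" "mat2 a b c d $ 1 $ 2 = b" "mat2 a b c d $ 2 $ 1 = c" "mat2 a b c d $ 2 $ 2 = d"
  by (simp_all only: mat2_def vector_2)

lemma mat2_eq_iff:
  fixes A B :: "complex^2^2"
  shows "A = B \<longleftrightarrow> A $ 1 $ 1 = B $ 1 $ 1 \<and> A $ 1 $ 2 = B $ 1 $ 2 \<and> A $ 2 $ 1 = B $ 2 $ 1 \<and> A $ 2 $ 2 = B $ 2 $ 2"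
  unfolding vec_eq_iff forall_2 by (simp only: conj_assoc)

lemma mat2_mult:
  "mat2 a b c d ** mat2 a' b' c' d' = mat2 (a * a' + b * c') (a * b' + b * d') (c * a' + d * c') (c * b' + d * d')"
  by (simp add: mat2_eq_iff matrix_matrix_mult_def sum_2)

lemma mat2_add: "mat2 a b c d + mat2 a' b' c' d' = mat2 (a + a') (b + b') (c + c') (d + d')"
  and mat2_diff: "mat2 a b c d - mat2 a' b' c' d' = mat2 (a - a') (b - b') (c - c') (d - d')"
  and mat2_scaleR: "r *\<^sub>R mat2 a b c d = mat2 (r *\<^sub>R a) (r *\<^sub>R b) (r *\<^sub>R c) (r *\<^sub>R d)"
  and mat_1_eq: "mat 1 = mat2 1 0 0 1"
  by (simp_all add: mat2_eq_iff mat_def)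

lemma norm_mat2_le: "norm (mat2 a b c d) \<le> norm a + norm b + norm c + norm d"
  using norm_mat2_entries_le[of "mat2 a b c d"] by simp

lemma bounded_linear_mat2: "bounded_linear (\<lambda>(a, b, c, d). mat2 a b c d)"
proof (rule bounded_linear_intro[where K = 4])
  fix x :: "complex \<times> complex \<times> complex \<times> complex"
  obtain a b c d where x: "x = (a, b, c, d)" by (metis prod.exhaust)
  have "norm a \<le> norm x" "norm b \<le> norm x" "norm c \<le> norm x" "norm d \<le> norm x"
    unfolding x by (meson norm_fst_le norm_snd_le order_trans)+
  with norm_mat2_le[of a b c d] show "norm (case x of (a, b, c, d) \<Rightarrow> mat2 a b c d) \<le> norm x * 4"
    by (simp add: x)
qed (auto simp: mat2_add mat2_scaleR)

lemma has_vector_derivative_mat2: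
  assumes "(a has_vector_derivative a') (at x)" "(b has_vector_derivative b') (at x)"
    "(c has_vector_derivative c') (at x)" "(d has_vector_derivative d') (at x)"
  shows "((\<lambda>x. mat2 (a x) (b x) (c x) (d x)) has_vector_derivative mat2 a' b' c' d') (at x)"
  using bounded_linear.has_vector_derivative[OF bounded_linear_mat2
      has_vector_derivative_Pair[OF assms(1) has_vector_derivative_Pair[OF assms(2)
        has_vector_derivative_Pair[OF assms(3,4)]]]] by simp

lemma continuous_on_mat2:
  assumes "continuous_on S a" "continuous_on S b" "continuous_on S c" "continuous_on S d"
  shows "continuous_on S (\<lambda>x. mat2 (a x) (b x) (c x) (d x))"
  using bounded_linear.continuous_on[OF bounded_linear_mat2
      continuous_on_Pair[OF assms(1) continuous_on_Pair[OF assms(2) continuous_on_Pair[OF assms(3,4)]]]]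
  by simp

section \<open>The linear system, its fundamental solution and its inverse\<close>

lemma zs_matrix_eq:
  "zs_matrix \<kappa> p z x = mat2 (- \<i> * z) (\<i> * p x) (- \<i> * (of_real \<kappa> * cnj (p x))) (\<i> * z)"
  by (simp add: zs_matrix_def mat2_eq_iff cscale_def sigma3_def mat2_mult)

lemma zs_matrix_continuous:
  "continuous_on UNIV p \<Longrightarrow> continuous_on UNIV (zs_matrix \<kappa> p z)"
  unfolding zs_matrix_eq[abs_def] by (intro continuous_on_mat2 continuous_intros)

lemma norm_zs_matrix_le:
  assumes "\<kappa> \<in> {1, -1}"
  shows "norm (zs_matrix \<kappa> p z x) \<le> 2 * (norm z + norm (p x))"
  using assms norm_mat2_le[of "- \<i> * z" "\<i> * p x" "- \<i> * (of_real \<kappa> * cnj (p x))" "\<i> * z"]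
  by (auto simp: zs_matrix_eq norm_mult)

lemma zs_matrix_diff:
  "zs_matrix \<kappa> p z x - zs_matrix \<kappa> q z y = mat2 0 (\<i> * (p x - q y)) (- \<i> * (of_real \<kappa> * cnj (p x - q y))) 0"
  by (simp add: zs_matrix_eq mat2_diff algebra_simps)

lemma continuous_norm_bounded:
  assumes "continuous_on UNIV (U :: real \<Rightarrow> 'a::real_normed_vector)"
  obtains M where "M \<ge> 0" "\<And>s. s \<in> {a..b} \<Longrightarrow> norm (U s) \<le> M"
proof -
  have "bounded (U ` {a..b})"
    by (intro compact_imp_bounded compact_continuous_image continuous_on_subset[OF assms]) auto
  then obtain M where "\<forall>y\<in>U ` {a..b}. norm y \<le> M" unfolding bounded_iff by blast
  then show ?thesis by (intro that[of "max M 0"]) (auto simp: le_max_iff_disj)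
qed

lemma matrix_ode_unique:
  fixes Y1 Y2 :: "real \<Rightarrow> complex^2^2"
  assumes U: "continuous_on UNIV U"
    and Y1: "\<And>s. (Y1 has_vector_derivative U s ** Y1 s) (at s)"
    and Y2: "\<And>s. (Y2 has_vector_derivative U s ** Y2 s) (at s)" and "Y1 0 = Y2 0"
  shows "Y1 = Y2"
proof
  fix x :: real
  obtain M where M: "\<And>s. s \<in> {min 0 x..max 0 x} \<Longrightarrow> norm (U s) \<le> M"
    using continuous_norm_bounded[OF U] by blast
  have "norm (Y1 x - Y2 x) \<le> exp (8 * M * \<bar>x - 0\<bar>) * norm (Y1 0 - Y2 0)"
  proof (rule gronwall)
    show "((\<lambda>s. Y1 s - Y2 s) has_vector_derivative U s ** (Y1 s - Y2 s)) (at s)" for s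
      unfolding matrix_mult.diff_right by (intro has_vector_derivative_diff Y1 Y2)
    show "norm (U s ** (Y1 s - Y2 s)) \<le> 8 * M * norm (Y1 s - Y2 s)" if "s \<in> {min 0 x..max 0 x}" for s
      by (rule norm_matrix_mult_le_left[OF M[OF that]])
  qed
  with assms(4) show "Y1 x = Y2 x" by simp
qed

text \<open>Existence and uniqueness for the linear equation resolve the definite description in
  \<open>transfer\<close>.\<close>

lemma transfer_ode:
  assumes "continuous_on UNIV p"
  shows "((\<lambda>x. transfer \<kappa> p x 0 z) has_vector_derivative zs_matrix \<kappa> p z s ** transfer \<kappa> p s 0 z) (at s)"
    and "transfer \<kappa> p 0 0 z = mat 1"
proof -
  let ?P = "\<lambda>Y. (\<forall>s. (Y has_vector_derivative (zs_matrix \<kappa> p z s ** Y s)) (at s)) \<and> Y 0 = mat 1"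
  have U: "continuous_on UNIV (zs_matrix \<kappa> p z)" by (rule zs_matrix_continuous[OF assms])
  obtain Y where Y: "?P Y"
    using linear_ode_exists[OF matrix_mult.bounded_bilinear_axioms U] by blast
  have "The ?P = Y"
  proof (rule the_equality)
    show "X = Y" if "?P X" for X
      by (rule matrix_ode_unique[OF U]) (use that Y in auto)
  qed (rule Y)
  then have eq: "(\<lambda>x. transfer \<kappa> p x 0 z) = Y" by (auto simp: transfer_def)
  then have "transfer \<kappa> p x 0 z = Y x" for x by metis
  with eq Y show "((\<lambda>x. transfer \<kappa> p x 0 z) has_vector_derivative zs_matrix \<kappa> p z s ** transfer \<kappa> p s 0 z) (at s)"
    and "transfer \<kappa> p 0 0 z = mat 1" by simp_all
qed

text \<open>The inverse is built as the solution of the adjoint equation, which also gives it a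
  Gronwall bound. The product with the transfer matrix has derivative 0, and for square matrices a
  left inverse is a right inverse.\<close>

lemma transfer_inverse_exists:
  assumes p: "continuous_on UNIV p"
  obtains Z where "Z 0 = mat 1" "\<And>s. (Z has_vector_derivative - (Z s ** zs_matrix \<kappa> p z s)) (at s)"
    "\<And>s. Z s ** transfer \<kappa> p s 0 z = mat 1" "\<And>s. transfer \<kappa> p s 0 z ** Z s = mat 1"
proof -
  have U: "continuous_on UNIV (\<lambda>s. - zs_matrix \<kappa> p z s)"
    by (intro continuous_intros zs_matrix_continuous p)
  obtain Z where Z0: "Z 0 = mat 1" and "\<And>s. (Z has_vector_derivative Z s ** - zs_matrix \<kappa> p z s) (at s)"
    using linear_ode_exists[OF bounded_bilinear.flip[OF matrix_mult.bounded_bilinear_axioms] U] by blast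
  then have Z: "(Z has_vector_derivative - (Z s ** zs_matrix \<kappa> p z s)) (at s)" for s
    by (simp add: matrix_mult.minus_right)
  have "((\<lambda>s. Z s ** transfer \<kappa> p s 0 z) has_vector_derivative 0) (at s)" for s
    using matrix_mult.has_vector_derivative[OF Z[of s] transfer_ode(1)[OF p, of \<kappa> z s]]
    by (simp add: matrix_mult.minus_left matrix_mul_assoc)
  then obtain C where C: "\<And>s. Z s ** transfer \<kappa> p s 0 z = C"
    using has_vector_derivative_zero_constant[of UNIV "\<lambda>s. Z s ** transfer \<kappa> p s 0 z"] by auto
  from C[of 0] have "C = mat 1" by (simp add: Z0 transfer_ode(2)[OF p])
  with C have ZY: "Z s ** transfer \<kappa> p s 0 z = mat 1" for s by simp
  then have "transfer \<kappa> p s 0 z ** Z s = mat 1" for s by (simp add: matrix_left_right_inverse)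
  with Z0 Z ZY that show ?thesis by blast
qed

lemma norm_mat_1: "1 \<le> norm (mat 1 :: complex^2^2)" "norm (mat 1 :: complex^2^2) \<le> 2"
  using norm_entry_le[of "mat2 1 0 0 1" 1 1] norm_mat2_le[of 1 0 0 1] by (simp_all add: mat_1_eq)

text \<open>In the exponent, 16 is the factor 8 of a matrix product times the factor 2 of
  \<open>norm_zs_matrix_le\<close>; the 2 in front bounds the norm of the identity.\<close>

lemma transfer_norm_bound:
  assumes \<kappa>: "\<kappa> \<in> {1, -1}" and p: "continuous_on UNIV p" and L: "L \<ge> 0"
    and M: "\<And>x. x \<in> {0..L} \<Longrightarrow> norm (p x) \<le> M"
  shows "norm (transfer \<kappa> p L 0 z) \<le> 2 * exp (16 * (norm z + M) * L)"
proof -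
  have "norm (transfer \<kappa> p L 0 z) \<le> exp (16 * (norm z + M) * \<bar>L - 0\<bar>) * norm (transfer \<kappa> p 0 0 z)"
  proof (rule gronwall[OF transfer_ode(1)[OF p]])
    fix s assume "s \<in> {min 0 L..max 0 L}"
    then have "norm (p s) \<le> M" using M L by simp
    then have "norm (zs_matrix \<kappa> p z s) \<le> 2 * (norm z + M)"
      using order_trans[OF norm_zs_matrix_le[OF \<kappa>]] by simp
    from norm_matrix_mult_le_left[OF this]
    show "norm (zs_matrix \<kappa> p z s ** transfer \<kappa> p s 0 z) \<le> 16 * (norm z + M) * norm (transfer \<kappa> p s 0 z)"
      by (rule order_trans) simp
  qed
  also have "\<dots> \<le> exp (16 * (norm z + M) * \<bar>L - 0\<bar>) * 2"
    unfolding transfer_ode(2)[OF p] by (intro mult_left_mono norm_mat_1) simp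
  finally show ?thesis using L by (simp add: mult.commute)
qed

lemma inverse_norm_bound:
  assumes \<kappa>: "\<kappa> \<in> {1, -1}" and L: "L \<ge> 0"
    and M: "\<And>x. x \<in> {0..L} \<Longrightarrow> norm (p x) \<le> M"
    and Z: "Z 0 = mat 1" "\<And>s. (Z has_vector_derivative - (Z s ** zs_matrix \<kappa> p z s)) (at s)"
  shows "norm (Z L) \<le> 2 * exp (16 * (norm z + M) * L)"
proof -
  have "norm (Z L) \<le> exp (16 * (norm z + M) * \<bar>L - 0\<bar>) * norm (Z 0)"
  proof (rule gronwall[OF Z(2)])
    fix s assume "s \<in> {min 0 L..max 0 L}"
    then have "norm (p s) \<le> M" using M L by simp
    then have "norm (zs_matrix \<kappa> p z s) \<le> 2 * (norm z + M)"
      using order_trans[OF norm_zs_matrix_le[OF \<kappa>]] by simp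
    from norm_matrix_mult_le_right[OF this, of "Z s"]
    show "norm (- (Z s ** zs_matrix \<kappa> p z s)) \<le> 16 * (norm z + M) * norm (Z s)"
      unfolding norm_minus_cancel by (rule order_trans) simp
  qed
  also have "\<dots> \<le> exp (16 * (norm z + M) * \<bar>L - 0\<bar>) * 2"
    unfolding Z(1) by (intro mult_left_mono norm_mat_1) simp
  finally show ?thesis using L by (simp add: mult.commute)
qed

text \<open>The lower bound needs the inverse: with \<open>E\<close> for the exponential, 1 <= norm
  (Z Y) <= 8 (2 E) (4 op_norm Y), which is where 64 comes from. The upper bound is weakened to the
  same constant.\<close>

lemma op_norm_transfer_bounds:
  assumes \<kappa>: "\<kappa> \<in> {1, -1}" and p: "continuous_on UNIV p" and L: "L \<ge> 0"
    and M: "\<And>x. x \<in> {0..L} \<Longrightarrow> norm (p x) \<le> M"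
  shows "0 < op_norm (transfer \<kappa> p L 0 z)"
    and "\<bar>ln (op_norm (transfer \<kappa> p L 0 z))\<bar> \<le> ln 64 + 16 * (norm z + M) * L"
proof -
  let ?Y = "transfer \<kappa> p L 0 z" and ?E = "exp (16 * (norm z + M) * L)"
  obtain Z where Z: "Z 0 = mat 1" "\<And>s. (Z has_vector_derivative - (Z s ** zs_matrix \<kappa> p z s)) (at s)"
      "\<And>s. Z s ** transfer \<kappa> p s 0 z = mat 1" "\<And>s. transfer \<kappa> p s 0 z ** Z s = mat 1"
    by (rule transfer_inverse_exists[OF p, of \<kappa> z]) (rule that)
  have up: "op_norm ?Y \<le> 64 * ?E"
    using op_norm_le_norm[of ?Y] transfer_norm_bound[OF \<kappa> p L M, of z] exp_gt_zero[of "16 * (norm z + M) * L"]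
    by linarith
  have "1 \<le> norm (Z L ** ?Y)" using norm_mat_1 by (simp add: Z(3))
  also have "\<dots> \<le> norm (Z L) * norm ?Y * 8" by (rule norm_matrix_mult_le)
  also have "\<dots> \<le> (2 * ?E) * (4 * op_norm ?Y) * 8"
    using inverse_norm_bound[OF \<kappa> L M Z(1,2)] norm_le_op_norm by (intro mult_right_mono mult_mono) auto
  finally have low: "1 \<le> 64 * ?E * op_norm ?Y" by simp
  show pos: "0 < op_norm ?Y"
  proof (rule ccontr)
    assume "\<not> ?thesis"
    then have "op_norm ?Y = 0" using op_norm_nonneg[of ?Y] by simp
    with low show False by simp
  qed
  have "ln (op_norm ?Y) \<le> ln (64 * ?E)" using up pos by simp
  moreover have "ln 1 \<le> ln (64 * ?E * op_norm ?Y)"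
    using low pos by (intro ln_mono) auto
  ultimately show "\<bar>ln (op_norm ?Y)\<bar> \<le> ln 64 + 16 * (norm z + M) * L"
    using pos by (simp add: ln_mult abs_le_iff)
qed

lemma translate_continuous: "continuous_on UNIV p \<Longrightarrow> continuous_on UNIV (translate y p)"
  unfolding translate_def by (rule continuous_on_compose2[of UNIV p _ "\<lambda>x. x + y"]) (auto intro: continuous_intros)

text \<open>As functions of \<open>L'\<close> both sides solve the system of the translated
  potential, with the same value at 0.\<close>

lemma transfer_cocycle:
  assumes p: "continuous_on UNIV p"
  shows "transfer \<kappa> p (L' + L) 0 z = transfer \<kappa> (translate L p) L' 0 z ** transfer \<kappa> p L 0 z"
proof -
  have tp: "continuous_on UNIV (translate L p)" by (rule translate_continuous[OF p])
  have "(\<lambda>s. transfer \<kappa> p (s + L) 0 z) = (\<lambda>s. transfer \<kappa> (translate L p) s 0 z ** transfer \<kappa> p L 0 z)"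
  proof (rule matrix_ode_unique[OF zs_matrix_continuous[OF tp]])
    fix s
    have "zs_matrix \<kappa> (translate L p) z s = zs_matrix \<kappa> p z (s + L)"
      by (simp add: zs_matrix_def translate_def)
    then show "((\<lambda>s. transfer \<kappa> p (s + L) 0 z) has_vector_derivative
        zs_matrix \<kappa> (translate L p) z s ** transfer \<kappa> p (s + L) 0 z) (at s)"
      using has_vector_derivative_affine[of "\<lambda>x. transfer \<kappa> p x 0 z" _ 1 s L] transfer_ode(1)[OF p, of \<kappa> z "s + L"]
      by simp
    show "((\<lambda>s. transfer \<kappa> (translate L p) s 0 z ** transfer \<kappa> p L 0 z) has_vector_derivative
        zs_matrix \<kappa> (translate L p) z s ** (transfer \<kappa> (translate L p) s 0 z ** transfer \<kappa> p L 0 z)) (at s)"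
      unfolding matrix_mul_assoc
      by (rule bounded_linear.has_vector_derivative[OF matrix_mult.bounded_linear_left transfer_ode(1)[OF tp]])
  qed (simp add: transfer_ode(2)[OF tp])
  then show ?thesis by meson
qed

lemma norm_le_of_derivative_bound:
  fixes f :: "real \<Rightarrow> 'a::real_normed_vector"
  assumes "\<And>s. (f has_vector_derivative f' s) (at s)" "f 0 = 0" "L \<ge> 0"
    and "\<And>s. s \<in> {0..L} \<Longrightarrow> norm (f' s) \<le> C"
  shows "norm (f L) \<le> C * L"
proof -
  have "norm (f L - f 0) \<le> C * norm (L - 0)"
  proof (rule differentiable_bound[where S = "{0..L}" and f' = "\<lambda>s h. h *\<^sub>R f' s"])
    fix s assume s: "s \<in> {0..L}"
    show "(f has_derivative (\<lambda>h. h *\<^sub>R f' s)) (at s within {0..L})"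
      using assms(1)[of s] by (auto simp: has_vector_derivative_def intro: has_derivative_at_withinI)
    show "onorm (\<lambda>h. h *\<^sub>R f' s) \<le> C"
      using assms(4)[OF s] by (intro onorm_le) (simp add: mult.commute[of C] mult_left_mono)
  qed (use assms(3) in auto)
  with assms(2,3) show ?thesis by simp
qed

text \<open>Variation of constants: \<open>Z ** Y - mat 1\<close>, with \<open>Z\<close> the inverse
  for \<open>p\<close> and \<open>Y\<close> the matrix for \<open>q\<close>, has a derivative linear
  in the difference of the coefficients. The cube counts \<open>Z\<close>, \<open>Y\<close> and the
  final multiplication by the matrix for \<open>p\<close>; the constant is 16 times 512.\<close>

lemma transfer_diff_bound:
  assumes \<kappa>: "\<kappa> \<in> {1, -1}" and p: "continuous_on UNIV p" and q: "continuous_on UNIV q" and L: "L \<ge> 0"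
    and pM: "\<And>x. x \<in> {0..L} \<Longrightarrow> norm (p x) \<le> M" and qM: "\<And>x. x \<in> {0..L} \<Longrightarrow> norm (q x) \<le> M"
    and d: "\<And>x. x \<in> {0..L} \<Longrightarrow> norm (q x - p x) \<le> d" and xs: "x \<in> {0..L}"
  shows "norm (transfer \<kappa> q x 0 z - transfer \<kappa> p x 0 z) \<le> 8192 * exp (16 * (norm z + M) * L) ^ 3 * L * d"
proof -
  define E where "E = exp (16 * (norm z + M) * L)"
  have M: "M \<ge> 0" using order_trans[OF norm_ge_zero pM[of 0]] L by simp
  have d0: "d \<ge> 0" using order_trans[OF norm_ge_zero d[of 0]] L by simp
  have E: "2 * exp (16 * (norm z + M) * s) \<le> 2 * E" if "s \<in> {0..L}" for s
    using that M by (auto simp: E_def intro!: mult_left_mono)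
  obtain Z where Z: "Z 0 = mat 1" "\<And>s. (Z has_vector_derivative - (Z s ** zs_matrix \<kappa> p z s)) (at s)"
      "\<And>s. Z s ** transfer \<kappa> p s 0 z = mat 1" "\<And>s. transfer \<kappa> p s 0 z ** Z s = mat 1"
    by (rule transfer_inverse_exists[OF p, of \<kappa> z]) (rule that)
  let ?Y = "\<lambda>s. transfer \<kappa> q s 0 z"
  have ZE: "norm (Z s) \<le> 2 * E" if s: "s \<in> {0..L}" for s
  proof -
    have "norm (Z s) \<le> 2 * exp (16 * (norm z + M) * s)"
      by (rule inverse_norm_bound[OF \<kappa> _ _ Z(1,2)]) (use s pM in auto)
    with E[OF s] show ?thesis by simp
  qed
  have YE: "norm (transfer \<kappa> f s 0 z) \<le> 2 * E"
    if s: "s \<in> {0..L}" and f: "continuous_on UNIV f" "\<And>x. x \<in> {0..L} \<Longrightarrow> norm (f x) \<le> M" for s f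
  proof -
    have "norm (transfer \<kappa> f s 0 z) \<le> 2 * exp (16 * (norm z + M) * s)"
      by (rule transfer_norm_bound[OF \<kappa> f(1)]) (use s f in auto)
    with E[OF s] show ?thesis by simp
  qed
  have "norm (Z x ** ?Y x - mat 1) \<le> (64 * (2 * E) * (2 * d) * (2 * E)) * x"
  proof (rule norm_le_of_derivative_bound)
    let ?D = "\<lambda>s. zs_matrix \<kappa> q z s - zs_matrix \<kappa> p z s"
    show "((\<lambda>s. Z s ** ?Y s - mat 1) has_vector_derivative Z s ** ?D s ** ?Y s) (at s)" for s
    proof -
      have "((\<lambda>s. Z s ** ?Y s - mat 1) has_vector_derivative
          (Z s ** (zs_matrix \<kappa> q z s ** ?Y s) + - (Z s ** zs_matrix \<kappa> p z s) ** ?Y s) - 0) (at s)"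
        by (intro has_vector_derivative_diff matrix_mult.has_vector_derivative Z transfer_ode q
            has_vector_derivative_const)
      then show ?thesis
        by (simp add: matrix_mult.diff_left matrix_mult.diff_right matrix_mult.minus_left matrix_mul_assoc)
    qed
    show "Z 0 ** ?Y 0 - mat 1 = 0" by (simp add: Z(1) transfer_ode(2)[OF q])
    show "norm (Z s ** ?D s ** ?Y s) \<le> 64 * (2 * E) * (2 * d) * (2 * E)" if "s \<in> {0..x}" for s
    proof -
      have s: "s \<in> {0..L}" using that xs by simp
      have "norm (?D s) \<le> 2 * norm (q s - p s)"
        unfolding zs_matrix_diff using \<kappa>
          norm_mat2_le[of 0 "\<i> * (q s - p s)" "- \<i> * (of_real \<kappa> * cnj (q s - p s))" 0]
        by (auto simp: norm_mult simp flip: complex_cnj_diff)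
      then have D: "norm (?D s) \<le> 2 * d" using d[OF s] by linarith
      have "norm (Z s ** ?D s) \<le> 8 * (2 * E) * (2 * d)"
        using norm_matrix_mult_le_left[OF ZE[OF s], of "?D s"] D
        by (smt (verit) E_def exp_gt_zero mult_left_mono)
      from norm_matrix_mult_le_left[OF this, of "?Y s"]
      have "norm (Z s ** ?D s ** ?Y s) \<le> 8 * (8 * (2 * E) * (2 * d)) * norm (?Y s)" .
      also have "\<dots> \<le> 8 * (8 * (2 * E) * (2 * d)) * (2 * E)"
        using d0 by (intro mult_left_mono YE s q qM) (auto simp: E_def)
      finally show ?thesis by simp
    qed
  qed (use xs in auto)
  also have "\<dots> \<le> (64 * (2 * E) * (2 * d) * (2 * E)) * L"
    using xs d0 by (intro mult_left_mono) (auto simp: E_def)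
  finally have W: "norm (Z x ** ?Y x - mat 1) \<le> 512 * E\<^sup>2 * d * L" by (simp add: power2_eq_square mult_ac)
  have "transfer \<kappa> p x 0 z ** (Z x ** ?Y x - mat 1) = ?Y x - transfer \<kappa> p x 0 z"
    by (simp add: matrix_mult.diff_right matrix_mul_assoc Z(4))
  then have "norm (?Y x - transfer \<kappa> p x 0 z) \<le> 8 * (2 * E) * norm (Z x ** ?Y x - mat 1)"
    using norm_matrix_mult_le_left[OF YE[OF xs p pM], of "Z x ** ?Y x - mat 1"] by simp
  also have "\<dots> \<le> 8 * (2 * E) * (512 * E\<^sup>2 * d * L)"
    by (intro mult_left_mono W) (simp add: E_def)
  finally show ?thesis unfolding E_def[symmetric] by (simp add: power2_eq_square power3_eq_cube mult_ac)
qed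

text \<open>The part of \<open>zs_matrix\<close> that depends on the potential. It involves a
  conjugate, so it is linear over the reals only.\<close>

definition off_diag :: "real \<Rightarrow> complex \<Rightarrow> complex^2^2" where
  "off_diag \<kappa> w = mat2 0 (\<i> * w) (- \<i> * (of_real \<kappa> * cnj w)) 0"

lemma off_diag_diff: "off_diag \<kappa> (v - w) = off_diag \<kappa> v - off_diag \<kappa> w"
  and off_diag_scaleR: "off_diag \<kappa> (r *\<^sub>R w) = r *\<^sub>R off_diag \<kappa> w"
  unfolding off_diag_def mat2_diff mat2_scaleR by (simp_all add: scaleR_conv_of_real algebra_simps)

lemma norm_off_diag_le: "\<kappa> \<in> {1, -1} \<Longrightarrow> norm (off_diag \<kappa> w) \<le> 2 * norm w"
  using norm_mat2_le[of 0 "\<i> * w" "- \<i> * (of_real \<kappa> * cnj w)" 0]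
  by (auto simp: off_diag_def norm_mult)

text \<open>The time derivative of the potential is a commutator expression (zero curvature). At fixed \<open>L\<close>
  this turns the time derivative of the transfer matrix into boundary terms.\<close>

lemma transfer_time_derivative:
  assumes \<kappa>: "\<kappa> \<in> {1, -1}" and L: "L \<ge> 0"
    and q: "\<And>s. continuous_on UNIV (q s)" and qt: "continuous_on UNIV qt"
    and unif: "\<And>e. e > 0 \<Longrightarrow> \<exists>d>0. \<forall>s \<xi>. \<bar>s - s0\<bar> < d \<longrightarrow> \<xi> \<in> {0..L} \<longrightarrow>
      norm (q s \<xi> - q s0 \<xi> - (s - s0) *\<^sub>R qt \<xi>) \<le> e * \<bar>s - s0\<bar>"
    and V: "\<And>x. (V has_vector_derivative V' x) (at x)"
    and zero_curvature: "\<And>x. off_diag \<kappa> (qt x) = V' x - zs_matrix \<kappa> (q s0) z x ** V x + V x ** zs_matrix \<kappa> (q s0) z x"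
  shows "((\<lambda>s. transfer \<kappa> (q s) L 0 z) has_vector_derivative
      V L ** transfer \<kappa> (q s0) L 0 z - transfer \<kappa> (q s0) L 0 z ** V 0) (at s0)"
proof -
  obtain Q where Q: "Q \<ge> 0" "\<And>x. x \<in> {0..L} \<Longrightarrow> norm (qt x) \<le> Q" using continuous_norm_bounded[OF qt] by blast
  obtain M0 where M0: "M0 \<ge> 0" "\<And>x. x \<in> {0..L} \<Longrightarrow> norm (q s0 x) \<le> M0"
    using continuous_norm_bounded[OF q] by blast
  obtain d1 where d1: "d1 > 0" "\<And>s \<xi>. \<lbrakk>\<bar>s - s0\<bar> < d1; \<xi> \<in> {0..L}\<rbrakk> \<Longrightarrow>
      norm (q s \<xi> - q s0 \<xi> - (s - s0) *\<^sub>R qt \<xi>) \<le> 1 * \<bar>s - s0\<bar>" using unif[of 1] by auto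
  define d0 where "d0 = min d1 1"
  have d0: "d0 > 0" "d0 \<le> 1" "d0 \<le> d1" using d1(1) by (auto simp: d0_def)
  \<comment> \<open>For \<open>\<bar>s - s0\<bar> < d0\<close> with \<open>d0\<close> at most 1 the
    potential moves by at most \<open>Q + 1\<close> on \<open>{0..L}\<close>, so this single bound
    serves all nearby times.\<close>
  define M where "M = M0 + Q + 1"
  have lip: "norm (q s \<xi> - q s0 \<xi>) \<le> (Q + 1) * \<bar>s - s0\<bar>" if "\<bar>s - s0\<bar> < d0" "\<xi> \<in> {0..L}" for s \<xi>
  proof -
    have "norm (q s \<xi> - q s0 \<xi>) \<le> norm (q s \<xi> - q s0 \<xi> - (s - s0) *\<^sub>R qt \<xi>) + norm ((s - s0) *\<^sub>R qt \<xi>)"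
      using norm_triangle_ineq[of "q s \<xi> - q s0 \<xi> - (s - s0) *\<^sub>R qt \<xi>" "(s - s0) *\<^sub>R qt \<xi>"] by simp
    also have "\<dots> \<le> 1 * \<bar>s - s0\<bar> + \<bar>s - s0\<bar> * Q"
      using d1(2)[of s \<xi>] that d0 Q(2)[of \<xi>] by (intro add_mono) (auto intro: mult_left_mono)
    finally show ?thesis by (simp add: algebra_simps)
  qed
  have qM: "norm (q s \<xi>) \<le> M" if "\<bar>s - s0\<bar> < d0" "\<xi> \<in> {0..L}" for s \<xi>
  proof -
    have "norm (q s \<xi>) \<le> norm (q s0 \<xi>) + norm (q s \<xi> - q s0 \<xi>)"
      using norm_triangle_ineq[of "q s0 \<xi>" "q s \<xi> - q s0 \<xi>"] by simp
    also have "norm (q s \<xi> - q s0 \<xi>) \<le> (Q + 1) * 1"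
      using lip[OF that] that d0 Q(1) by (elim order_trans) (intro mult_left_mono, auto)
    finally show ?thesis using M0(2)[OF that(2)] by (simp add: M_def)
  qed
  define E where "E = exp (16 * (norm z + M) * L)"
  have M: "M \<ge> 0" using M0(1) Q(1) by (simp add: M_def)
  have E0: "E > 0" by (simp add: E_def)
  have E: "2 * exp (16 * (norm z + M) * s) \<le> 2 * E" if "s \<in> {0..L}" for s
    using that M by (auto simp: E_def intro!: mult_left_mono)
  obtain Z where Z: "Z 0 = mat 1" "\<And>s. (Z has_vector_derivative - (Z s ** zs_matrix \<kappa> (q s0) z s)) (at s)"
      "\<And>s. Z s ** transfer \<kappa> (q s0) s 0 z = mat 1" "\<And>s. transfer \<kappa> (q s0) s 0 z ** Z s = mat 1"
    by (rule transfer_inverse_exists[OF q, of \<kappa> s0 z]) (rule that)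
  let ?Y = "\<lambda>s \<xi>. transfer \<kappa> (q s) \<xi> 0 z" and ?U = "\<lambda>s. zs_matrix \<kappa> (q s) z"
  have ZE: "norm (Z \<xi>) \<le> 2 * E" if \<xi>: "\<xi> \<in> {0..L}" for \<xi>
  proof -
    have "norm (Z \<xi>) \<le> 2 * exp (16 * (norm z + M) * \<xi>)"
      by (rule inverse_norm_bound[OF \<kappa> _ _ Z(1,2)]) (use \<xi> qM[of s0] d0 in auto)
    with E[OF \<xi>] show ?thesis by simp
  qed
  have YE: "norm (?Y s \<xi>) \<le> 2 * E" if s: "\<bar>s - s0\<bar> < d0" and \<xi>: "\<xi> \<in> {0..L}" for s \<xi>
  proof -
    have "norm (?Y s \<xi>) \<le> 2 * exp (16 * (norm z + M) * \<xi>)"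
      by (rule transfer_norm_bound[OF \<kappa> q]) (use \<xi> qM[OF s] in auto)
    with E[OF \<xi>] show ?thesis by simp
  qed
  define C where "C = 8192 * E ^ 3 * L * (Q + 1)"
  have Ydiff: "norm (?Y s \<xi> - ?Y s0 \<xi>) \<le> C * \<bar>s - s0\<bar>" if s: "\<bar>s - s0\<bar> < d0" and \<xi>: "\<xi> \<in> {0..L}" for s \<xi>
    using transfer_diff_bound[OF \<kappa> q[of s0] q[of s] L qM[of s0] qM[OF s] lip[OF s] \<xi>, of z] d0
    by (simp add: C_def E_def mult_ac)
  have C: "C \<ge> 0" using E0 L Q(1) by (simp add: C_def)
  \<comment> \<open>The candidate for the derivative of \<open>Z L ** ?Y s L\<close> at
    \<open>s0\<close>. It vanishes at 0, and by zero curvature its derivative in space is exactly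
    the first variation, which therefore integrates to boundary terms.\<close>
  let ?X = "\<lambda>\<xi>. Z \<xi> ** V \<xi> ** ?Y s0 \<xi> - V 0"
  have X: "(?X has_vector_derivative Z \<xi> ** off_diag \<kappa> (qt \<xi>) ** ?Y s0 \<xi>) (at \<xi>)" for \<xi>
  proof -
    have "((\<lambda>\<xi>. Z \<xi> ** V \<xi> ** ?Y s0 \<xi> - V 0) has_vector_derivative
        (Z \<xi> ** V \<xi> ** (?U s0 \<xi> ** ?Y s0 \<xi>) + (Z \<xi> ** V' \<xi> + - (Z \<xi> ** ?U s0 \<xi>) ** V \<xi>) ** ?Y s0 \<xi>) - 0) (at \<xi>)"
      by (intro has_vector_derivative_diff matrix_mult.has_vector_derivative Z transfer_ode q V
          has_vector_derivative_const)
    then show ?thesis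
      unfolding zero_curvature
      by (simp add: matrix_mult.diff_left matrix_mult.diff_right matrix_mult.add_left matrix_mult.add_right
          matrix_mult.minus_left matrix_mul_assoc algebra_simps)
  qed
  \<comment> \<open>The space derivative of the first-order remainder has two parts: the
    time-expansion error of the potential, controlled by \<open>e\<close>, and the change of the
    transfer matrix, which brings a second factor \<open>\<bar>s - s0\<bar>\<close>.\<close>
  have R: "norm (Z L ** ?Y s L - mat 1 - (s - s0) *\<^sub>R ?X L)
      \<le> (256 * E * E * 2 * e + 128 * E * (2 * Q) * C * \<bar>s - s0\<bar>) * \<bar>s - s0\<bar> * L"
    if s: "\<bar>s - s0\<bar> < d0" and e: "\<And>\<xi>. \<xi> \<in> {0..L} \<Longrightarrow>
      norm (q s \<xi> - q s0 \<xi> - (s - s0) *\<^sub>R qt \<xi>) \<le> e * \<bar>s - s0\<bar>" for s e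
  proof (rule norm_le_of_derivative_bound)
    let ?B = "\<lambda>\<xi>. off_diag \<kappa> (q s \<xi> - q s0 \<xi> - (s - s0) *\<^sub>R qt \<xi>)"
    let ?G = "\<lambda>\<xi>. Z \<xi> ** ?B \<xi> ** ?Y s \<xi> + (s - s0) *\<^sub>R (Z \<xi> ** off_diag \<kappa> (qt \<xi>) ** (?Y s \<xi> - ?Y s0 \<xi>))"
    show "((\<lambda>\<xi>. Z \<xi> ** ?Y s \<xi> - mat 1 - (s - s0) *\<^sub>R ?X \<xi>) has_vector_derivative ?G \<xi>) (at \<xi>)" for \<xi>
    proof -
      have "((\<lambda>\<xi>. Z \<xi> ** ?Y s \<xi> - mat 1 - (s - s0) *\<^sub>R ?X \<xi>) has_vector_derivative
          (Z \<xi> ** (?U s \<xi> ** ?Y s \<xi>) + - (Z \<xi> ** ?U s0 \<xi>) ** ?Y s \<xi>) - 0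
          - (s - s0) *\<^sub>R (Z \<xi> ** off_diag \<kappa> (qt \<xi>) ** ?Y s0 \<xi>)) (at \<xi>)"
        by (intro has_vector_derivative_diff matrix_mult.has_vector_derivative Z transfer_ode q
            has_vector_derivative_const bounded_linear.has_vector_derivative[OF bounded_linear_scaleR_right X])
      moreover have "?U s \<xi> - ?U s0 \<xi> = off_diag \<kappa> (q s \<xi> - q s0 \<xi>)"
        by (simp only: zs_matrix_diff off_diag_def)
      then have "?U s \<xi> - ?U s0 \<xi> = ?B \<xi> + (s - s0) *\<^sub>R off_diag \<kappa> (qt \<xi>)"
        by (simp add: off_diag_diff off_diag_scaleR)
      then have "?U s \<xi> = ?U s0 \<xi> + ?B \<xi> + (s - s0) *\<^sub>R off_diag \<kappa> (qt \<xi>)" by (simp add: algebra_simps)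
      ultimately show ?thesis
        by (simp add: matrix_mult.diff_left matrix_mult.diff_right matrix_mult.add_left matrix_mult.add_right
          matrix_mult.minus_left matrix_mul_assoc scaleR_diff_right matrix_mult.scaleR_left matrix_mult.scaleR_right
          add_diff_eq)
    qed
    show "Z 0 ** ?Y s 0 - mat 1 - (s - s0) *\<^sub>R ?X 0 = 0"
      by (simp add: Z(1) transfer_ode(2)[OF q])
    show "norm (?G \<xi>) \<le> (256 * E * E * 2 * e + 128 * E * (2 * Q) * C * \<bar>s - s0\<bar>) * \<bar>s - s0\<bar>" if \<xi>: "\<xi> \<in> {0..L}" for \<xi>
    proof -
      have "norm (?B \<xi>) \<le> 2 * (e * \<bar>s - s0\<bar>)"
        using norm_off_diag_le[OF \<kappa>] e[OF \<xi>] by (meson mult_left_mono order_trans zero_le_numeral)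
      then have "norm (Z \<xi> ** ?B \<xi>) \<le> 8 * (2 * (e * \<bar>s - s0\<bar>)) * (2 * E)"
        using norm_matrix_mult_le_right[of "?B \<xi>" "2 * (e * \<bar>s - s0\<bar>)" "Z \<xi>"] ZE[OF \<xi>]
          order_trans[OF norm_ge_zero e[OF \<xi>]]
        by (meson mult_left_mono mult_nonneg_nonneg order_trans zero_le_numeral)
      from norm_matrix_mult_le_left[OF this, of "?Y s \<xi>"]
      have "norm (Z \<xi> ** ?B \<xi> ** ?Y s \<xi>) \<le> 8 * (8 * (2 * (e * \<bar>s - s0\<bar>)) * (2 * E)) * norm (?Y s \<xi>)" .
      also have "\<dots> \<le> 8 * (8 * (2 * (e * \<bar>s - s0\<bar>)) * (2 * E)) * (2 * E)"
        using order_trans[OF norm_ge_zero e[OF \<xi>]] E0 by (intro mult_left_mono YE[OF s \<xi>]) auto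
      finally have 1: "norm (Z \<xi> ** ?B \<xi> ** ?Y s \<xi>) \<le> 256 * E * E * 2 * e * \<bar>s - s0\<bar>" by (simp add: mult_ac)
      have "norm (off_diag \<kappa> (qt \<xi>)) \<le> 2 * Q"
        using norm_off_diag_le[OF \<kappa>, of "qt \<xi>"] Q(2)[OF \<xi>] by linarith
      then have "norm (Z \<xi> ** off_diag \<kappa> (qt \<xi>)) \<le> 8 * (2 * Q) * (2 * E)"
        using norm_matrix_mult_le_right[of "off_diag \<kappa> (qt \<xi>)" "2 * Q" "Z \<xi>"] ZE[OF \<xi>] Q(1)
        by (meson mult_left_mono mult_nonneg_nonneg order_trans zero_le_numeral)
      from norm_matrix_mult_le_left[OF this, of "?Y s \<xi> - ?Y s0 \<xi>"]
      have "norm (Z \<xi> ** off_diag \<kappa> (qt \<xi>) ** (?Y s \<xi> - ?Y s0 \<xi>))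
          \<le> 8 * (8 * (2 * Q) * (2 * E)) * norm (?Y s \<xi> - ?Y s0 \<xi>)" .
      also have "\<dots> \<le> 8 * (8 * (2 * Q) * (2 * E)) * (C * \<bar>s - s0\<bar>)"
        using Q(1) E0 by (intro mult_left_mono Ydiff[OF s \<xi>]) auto
      finally have "\<bar>s - s0\<bar> * norm (Z \<xi> ** off_diag \<kappa> (qt \<xi>) ** (?Y s \<xi> - ?Y s0 \<xi>))
          \<le> \<bar>s - s0\<bar> * (8 * (8 * (2 * Q) * (2 * E)) * (C * \<bar>s - s0\<bar>))"
        by (rule mult_left_mono) simp
      then have 2: "norm ((s - s0) *\<^sub>R (Z \<xi> ** off_diag \<kappa> (qt \<xi>) ** (?Y s \<xi> - ?Y s0 \<xi>)))
          \<le> 128 * E * (2 * Q) * C * \<bar>s - s0\<bar> * \<bar>s - s0\<bar>" by (simp add: mult_ac)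
      show ?thesis
        using norm_triangle_mono[OF 1 2] by (simp add: distrib_right mult.assoc)
    qed
  qed (rule L)
  have "((\<lambda>s. Z L ** ?Y s L) has_vector_derivative ?X L) (at s0)"
    unfolding has_vector_derivative_def has_derivative_at_alt
  proof (intro conjI allI impI)
    show "bounded_linear (\<lambda>h. h *\<^sub>R ?X L)" by (rule bounded_linear_scaleR_left)
    fix e :: real assume e: "e > 0"
    \<comment> \<open>Each part of the remainder is allotted \<open>e / 2\<close>; the added 1 keeps
      \<open>K\<close> and \<open>K2\<close> positive when the coefficients vanish.\<close>
    define K where "K = 512 * E * E * L + 1"
    define K2 where "K2 = 256 * E * Q * C * L + 1"
    have K: "K > 0" "K2 > 0" using E0 L Q(1) C by (auto simp: K_def K2_def intro!: add_nonneg_pos mult_nonneg_nonneg)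
    obtain d2 where d2: "d2 > 0" "\<And>s \<xi>. \<lbrakk>\<bar>s - s0\<bar> < d2; \<xi> \<in> {0..L}\<rbrakk> \<Longrightarrow>
        norm (q s \<xi> - q s0 \<xi> - (s - s0) *\<^sub>R qt \<xi>) \<le> (e / 2 / K) * \<bar>s - s0\<bar>"
      using unif[of "e / 2 / K"] e K by auto
    define d where "d = Min {d0, d2, e / 2 / K2}"
    have d: "d > 0" "d \<le> d0" "d \<le> d2" "d \<le> e / 2 / K2" using d0 d2 e K by (auto simp: d_def)
    show "\<exists>d>0. \<forall>s. norm (s - s0) < d \<longrightarrow>
        norm (Z L ** ?Y s L - Z L ** ?Y s0 L - (s - s0) *\<^sub>R ?X L) \<le> e * norm (s - s0)"
    proof (intro exI[of _ d] conjI allI impI d)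
      fix s assume s: "norm (s - s0) < d"
      have "norm (Z L ** ?Y s L - mat 1 - (s - s0) *\<^sub>R ?X L)
          \<le> (256 * E * E * 2 * (e / 2 / K) + 128 * E * (2 * Q) * C * \<bar>s - s0\<bar>) * \<bar>s - s0\<bar> * L"
        by (rule R) (use s d d2 in auto)
      also have "\<dots> = (512 * E * E * L * (e / 2 / K) + 256 * E * Q * C * L * \<bar>s - s0\<bar>) * \<bar>s - s0\<bar>"
        by (simp add: algebra_simps)
      also have "\<dots> \<le> (K * (e / 2 / K) + K2 * (e / 2 / K2)) * \<bar>s - s0\<bar>"
        using s d e K E0 L Q(1) C
        by (intro mult_right_mono add_mono mult_mono) (auto simp: K_def K2_def)
      also have "\<dots> = e * \<bar>s - s0\<bar>" using K by simp
      finally show "norm (Z L ** ?Y s L - Z L ** ?Y s0 L - (s - s0) *\<^sub>R ?X L) \<le> e * norm (s - s0)"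
        by (simp add: Z(3))
    qed
  qed
  from bounded_linear.has_vector_derivative[OF matrix_mult.bounded_linear_right this, of "?Y s0 L"]
  show ?thesis
    by (simp add: matrix_mult.diff_right matrix_mul_assoc Z(4))
qed

text \<open>Uniform continuity of \<open>vt\<close> on a compact rectangle, combined with the mean
  value inequality in time, makes the expansion uniform in space.\<close>

lemma uniform_time_derivative:
  fixes v vt :: "real \<Rightarrow> real \<Rightarrow> complex"
  assumes cont: "continuous_on UNIV (\<lambda>(t, x). vt t x)"
    and D: "\<And>t x. ((\<lambda>s. v s x) has_vector_derivative vt t x) (at t)" and "e > 0"
  shows "\<exists>d>0. \<forall>s \<xi>. \<bar>s - s0\<bar> < d \<longrightarrow> \<xi> \<in> {0..L} \<longrightarrow>
      norm (v s \<xi> - v s0 \<xi> - (s - s0) *\<^sub>R vt s0 \<xi>) \<le> e * \<bar>s - s0\<bar>"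
proof -
  let ?S = "{s0 - 1..s0 + 1} \<times> {0..L}"
  have "uniformly_continuous_on ?S (\<lambda>(t, x). vt t x)"
    by (intro compact_uniformly_continuous continuous_on_subset[OF cont] compact_Times) auto
  then obtain d where d: "d > 0" "\<And>a b. \<lbrakk>a \<in> ?S; b \<in> ?S; dist a b < d\<rbrakk> \<Longrightarrow>
      dist (case a of (t, x) \<Rightarrow> vt t x) (case b of (t, x) \<Rightarrow> vt t x) < e"
    using \<open>e > 0\<close> unfolding uniformly_continuous_on_def by metis
  have "norm (v s \<xi> - v s0 \<xi> - (s - s0) *\<^sub>R vt s0 \<xi>) \<le> e * \<bar>s - s0\<bar>"
    if s: "\<bar>s - s0\<bar> < min d 1" and \<xi>: "\<xi> \<in> {0..L}" for s \<xi>
  proof -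
    let ?f = "\<lambda>r. v r \<xi> - (r - s0) *\<^sub>R vt s0 \<xi>" and ?S = "ball s0 (min d 1)"
    have "norm (?f s - ?f s0) \<le> e * norm (s - s0)"
    proof (rule differentiable_bound[where S = ?S and f' = "\<lambda>r h. h *\<^sub>R (vt r \<xi> - vt s0 \<xi>)"])
      fix r assume r: "r \<in> ?S"
      have "(?f has_vector_derivative vt r \<xi> - 1 *\<^sub>R vt s0 \<xi>) (at r)"
        by (intro has_vector_derivative_diff D
            bounded_linear.has_vector_derivative[OF bounded_linear_scaleR_left])
          (auto intro!: derivative_eq_intros)
      then show "(?f has_derivative (\<lambda>h. h *\<^sub>R (vt r \<xi> - vt s0 \<xi>))) (at r within ?S)"
        by (auto simp: has_vector_derivative_def intro: has_derivative_at_withinI)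
      have "\<bar>r - s0\<bar> < d" "\<bar>r - s0\<bar> < 1" using r by (auto simp: dist_real_def abs_minus_commute)
      moreover from this(2) have "s0 - 1 \<le> r \<and> r \<le> s0 + 1" by linarith
      ultimately have "dist (vt r \<xi>) (vt s0 \<xi>) < e"
        using d(2)[of "(r, \<xi>)" "(s0, \<xi>)"] \<xi> by (auto simp: dist_Pair_Pair dist_real_def)
      then show "onorm (\<lambda>h. h *\<^sub>R (vt r \<xi> - vt s0 \<xi>)) \<le> e"
        by (intro onorm_le) (simp add: dist_norm mult.commute[of e] mult_left_mono less_imp_le)
    qed (use s d(1) in \<open>auto simp: dist_real_def abs_minus_commute\<close>)
    then show ?thesis by (simp add: algebra_simps)
  qed
  then show ?thesis using d(1) by (intro exI[of _ "min d 1"]) auto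
qed

section \<open>The zero-curvature identity and the change of the logarithm under the flow\<close>

lemma arg_cong4: "a = a' \<Longrightarrow> b = b' \<Longrightarrow> c = c' \<Longrightarrow> d = d' \<Longrightarrow> f a b c d = f a' b' c' d'"
  by simp

text \<open>Pointwise algebra of the Lax pair: \<open>q1\<close> and \<open>q2\<close> stand for the
  first two space derivatives of \<open>q\<close>, the first matrix is the space derivative of the
  time part, and the other two terms form the commutator. The lower left entry is the conjugate
  equation, with \<kappa>^2 = 1.\<close>

lemma nls_zero_curvature:
  fixes q q1 q2 qt z :: complex and \<kappa> :: real
  assumes "\<kappa> \<in> {1, -1}" and nls: "\<i> * qt = - (1 / 2) * q2 + complex_of_real (\<kappa> * (norm q)\<^sup>2) * q"
  shows "off_diag \<kappa> qt =
      mat2 (- (\<i> / 2) * of_real \<kappa> * (q1 * cnj q + q * cnj q1)) (\<i> * z * q1 - q2 / 2)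
        (- \<i> * of_real \<kappa> * z * cnj q1 - of_real \<kappa> / 2 * cnj q2) ((\<i> / 2) * of_real \<kappa> * (q1 * cnj q + q * cnj q1))
      - mat2 (- \<i> * z) (\<i> * q) (- \<i> * (of_real \<kappa> * cnj q)) (\<i> * z) **
        mat2 (- \<i> * z\<^sup>2 - (\<i> / 2) * of_real \<kappa> * (q * cnj q)) (\<i> * z * q - q1 / 2)
          (- \<i> * of_real \<kappa> * z * cnj q - of_real \<kappa> / 2 * cnj q1) (\<i> * z\<^sup>2 + (\<i> / 2) * of_real \<kappa> * (q * cnj q))
      + mat2 (- \<i> * z\<^sup>2 - (\<i> / 2) * of_real \<kappa> * (q * cnj q)) (\<i> * z * q - q1 / 2)
          (- \<i> * of_real \<kappa> * z * cnj q - of_real \<kappa> / 2 * cnj q1) (\<i> * z\<^sup>2 + (\<i> / 2) * of_real \<kappa> * (q * cnj q)) **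
        mat2 (- \<i> * z) (\<i> * q) (- \<i> * (of_real \<kappa> * cnj q)) (\<i> * z)"
proof -
  let ?k = "complex_of_real \<kappa>"
  have k: "?k * ?k = 1" using assms(1) by auto
  have I: "\<i> * (\<i> * w) = - w" for w by (simp flip: mult.assoc)
  have K: "?k * (?k * w) = w" for w using k by (simp flip: mult.assoc)
  have n: "complex_of_real (\<kappa> * (norm q)\<^sup>2) = ?k * (q * cnj q)"
    by (simp only: of_real_mult complex_norm_square)
  have e1: "\<i> * qt = - q2 / 2 + ?k * (q * cnj q) * q" using nls n by simp
  have "cnj (\<i> * qt) = cnj (- q2 / 2 + ?k * (q * cnj q) * q)" using e1 by simp
  then have e2: "- \<i> * cnj qt = - cnj q2 / 2 + ?k * (q * cnj q) * cnj q" by (simp add: mult_ac)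
  have e3: "- \<i> * (?k * cnj qt) = ?k * (- cnj q2 / 2 + ?k * (q * cnj q) * cnj q)"
    using e2 by (metis mult.left_commute)
  show ?thesis
    unfolding off_diag_def e1 e3 mat2_mult mat2_diff mat2_add
    by (intro arg_cong4[where f = mat2]) (simp_all add: algebra_simps power2_eq_square I K)
qed

text \<open>Gronwall runs in both time directions, since \<open>ln\<close> needs the ratio bounded
  from above and from below. \<open>ln 16\<close> pays for passing between \<open>norm\<close> and
  \<open>op_norm\<close>, a factor 4 each way; the other 16 is the factor 8 of a matrix product,
  once for each end of the interval.\<close>

lemma ln_op_norm_transfer_nls:
  assumes \<kappa>: "\<kappa> \<in> {1, -1}" and sol: "classical_nls_solution \<kappa> v" and L: "L \<ge> 0"
    and m: "\<And>s x. \<bar>s\<bar> \<le> \<bar>t\<bar> \<Longrightarrow> norm (v s x) \<le> m"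
    and m1: "\<And>s x. \<bar>s\<bar> \<le> \<bar>t\<bar> \<Longrightarrow> norm (vderiv (Suc 0) (v s) x) \<le> m"
  shows "\<bar>ln (op_norm (transfer \<kappa> (v t) L 0 z)) - ln (op_norm (transfer \<kappa> (v 0) L 0 z))\<bar>
    \<le> ln 16 + 16 * (2 * (norm z)\<^sup>2 + m\<^sup>2 + 2 * norm z * m + m) * \<bar>t\<bar>"
proof -
  obtain vt vx vxx where cont: "continuous_on UNIV (\<lambda>(t, x). vt t x)"
    and Dt: "\<And>t x. ((\<lambda>s. v s x) has_vector_derivative vt t x) (at t)"
    and Dx: "\<And>t x. (v t has_vector_derivative vx t x) (at x)"
    and Dxx: "\<And>t x. (vx t has_vector_derivative vxx t x) (at x)"
    and nls: "\<And>t x. \<i> * vt t x = - (1 / 2) * vxx t x + complex_of_real (\<kappa> * (norm (v t x))\<^sup>2) * v t x"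
    using sol unfolding classical_nls_solution_def by blast
  have vx: "vderiv (Suc 0) (v s) = vx s" for s by (rule vderiv_1_eqI[OF Dx])
  have vcont: "continuous_on UNIV (v s)" for s
    using Dx by (meson continuous_at_imp_continuous_on has_vector_derivative_continuous)
  have vtcont: "continuous_on UNIV (vt s)" for s
    using continuous_on_compose2[OF cont, of UNIV "\<lambda>x. (s, x)"]
      continuous_on_Pair[OF continuous_on_const continuous_on_id, of UNIV s] by simp
  let ?k = "complex_of_real \<kappa>"
  define V where "V s x = mat2 (- \<i> * z\<^sup>2 - (\<i> / 2) * ?k * (v s x * cnj (v s x))) (\<i> * z * v s x - vx s x / 2)
      (- \<i> * ?k * z * cnj (v s x) - ?k / 2 * cnj (vx s x)) (\<i> * z\<^sup>2 + (\<i> / 2) * ?k * (v s x * cnj (v s x)))" for s x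
  define V' where "V' s x = mat2 (- (\<i> / 2) * ?k * (vx s x * cnj (v s x) + v s x * cnj (vx s x))) (\<i> * z * vx s x - vxx s x / 2)
      (- \<i> * ?k * z * cnj (vx s x) - ?k / 2 * cnj (vxx s x)) ((\<i> / 2) * ?k * (vx s x * cnj (v s x) + v s x * cnj (vx s x)))" for s x
  have cnjD: "((\<lambda>x. cnj (f x)) has_vector_derivative cnj f') (at x)"
    if "(f has_vector_derivative f') (at x)" for f f' x
    by (rule bounded_linear.has_vector_derivative[OF bounded_linear_cnj that])
  have VD: "(V s has_vector_derivative V' s x) (at x)" for s x
    unfolding V_def V'_def
    by (intro has_vector_derivative_mat2)
      (auto intro!: derivative_eq_intros Dx Dxx cnjD has_vector_derivative_mult simp: algebra_simps)
  let ?f = "\<lambda>s. transfer \<kappa> (v s) L 0 z"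
  have f: "(?f has_vector_derivative V s L ** ?f s - ?f s ** V s 0) (at s)" for s
  proof (rule transfer_time_derivative[OF \<kappa> L vcont vtcont _ VD])
    show "\<exists>d>0. \<forall>r \<xi>. \<bar>r - s\<bar> < d \<longrightarrow> \<xi> \<in> {0..L} \<longrightarrow>
        norm (v r \<xi> - v s \<xi> - (r - s) *\<^sub>R vt s \<xi>) \<le> e * \<bar>r - s\<bar>" if "e > 0" for e
      by (rule uniform_time_derivative[OF cont Dt that])
    show "off_diag \<kappa> (vt s x) = V' s x - zs_matrix \<kappa> (v s) z x ** V s x + V s x ** zs_matrix \<kappa> (v s) z x" for x
      unfolding V_def V'_def zs_matrix_eq by (rule nls_zero_curvature[OF \<kappa> nls])
  qed
  \<comment> \<open>The sum of the four entry bounds of \<open>V\<close>: twice (norm z)^2 + m^2 / 2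
    on the diagonal and twice norm z * m + m / 2 off it.\<close>
  define b where "b = 2 * (norm z)\<^sup>2 + m\<^sup>2 + 2 * norm z * m + m"
  have m0: "0 \<le> m" using order_trans[OF norm_ge_zero m[of 0]] by simp
  have Vb: "norm (V s x) \<le> b" if s: "\<bar>s\<bar> \<le> \<bar>t\<bar>" for s x
  proof -
    have k: "\<bar>\<kappa>\<bar> = 1" using \<kappa> by auto
    have v: "norm (v s x) \<le> m" and vx: "norm (vx s x) \<le> m" using m[OF s] m1[OF s] by (auto simp: vx)
    have "norm (v s x * cnj (v s x)) \<le> m * m" unfolding norm_mult complex_mod_cnj by (intro mult_mono v m0) auto
    then have sq: "norm ((\<i> / 2) * ?k * (v s x * cnj (v s x))) \<le> m\<^sup>2 / 2"
      using k by (simp add: norm_mult norm_divide power2_eq_square)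
    have A: "norm (- \<i> * z\<^sup>2 - (\<i> / 2) * ?k * (v s x * cnj (v s x))) \<le> (norm z)\<^sup>2 + m\<^sup>2 / 2"
      by (rule order_trans[OF norm_triangle_ineq4]) (intro add_mono sq, simp add: norm_mult norm_power)
    have D: "norm (\<i> * z\<^sup>2 + (\<i> / 2) * ?k * (v s x * cnj (v s x))) \<le> (norm z)\<^sup>2 + m\<^sup>2 / 2"
      by (rule order_trans[OF norm_triangle_ineq]) (intro add_mono sq, simp add: norm_mult norm_power)
    have B: "norm (\<i> * z * v s x - vx s x / 2) \<le> norm z * m + m / 2"
      by (rule order_trans[OF norm_triangle_ineq4])
        (intro add_mono, use v vx in \<open>auto simp: norm_mult norm_divide intro: mult_left_mono\<close>)
    have C: "norm (- \<i> * ?k * z * cnj (v s x) - ?k / 2 * cnj (vx s x)) \<le> norm z * m + m / 2"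
      by (rule order_trans[OF norm_triangle_ineq4])
        (intro add_mono, use v vx k in \<open>auto simp: norm_mult norm_divide intro: mult_left_mono\<close>)
    show ?thesis
      unfolding V_def b_def by (rule order_trans[OF norm_mat2_le]) (use A B C D in simp)
  qed
  have f'b: "norm (V s L ** ?f s - ?f s ** V s 0) \<le> 16 * b * norm (?f s)" if s: "\<bar>s\<bar> \<le> \<bar>t\<bar>" for s
    using norm_triangle_ineq4[of "V s L ** ?f s" "?f s ** V s 0"]
      norm_matrix_mult_le_left[OF Vb[OF s], of L "?f s"] norm_matrix_mult_le_right[OF Vb[OF s], of "?f s" 0]
    by linarith
  have "norm (?f t) \<le> exp (16 * b * \<bar>t - 0\<bar>) * norm (?f 0)"
    by (rule gronwall[OF f f'b]) (auto simp: min_def max_def abs_le_iff split: if_splits)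
  then have fwd: "norm (?f t) \<le> exp (16 * b * \<bar>t\<bar>) * norm (?f 0)" by simp
  have "norm (?f 0) \<le> exp (16 * b * \<bar>0 - t\<bar>) * norm (?f t)"
    by (rule gronwall[OF f f'b]) (auto simp: min_def max_def abs_le_iff split: if_splits)
  then have bwd: "norm (?f 0) \<le> exp (16 * b * \<bar>t\<bar>) * norm (?f t)" by simp
  have step: "ln (op_norm Y1) \<le> ln 16 + 16 * b * \<bar>t\<bar> + ln (op_norm Y2)"
    if "norm Y1 \<le> exp (16 * b * \<bar>t\<bar>) * norm Y2" "0 < op_norm Y1" "0 < op_norm Y2" for Y1 Y2
  proof -
    have "op_norm Y1 \<le> 4 * (exp (16 * b * \<bar>t\<bar>) * (4 * op_norm Y2))"
    proof -
      have "exp (16 * b * \<bar>t\<bar>) * norm Y2 \<le> exp (16 * b * \<bar>t\<bar>) * (4 * op_norm Y2)"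
        by (intro mult_left_mono norm_le_op_norm) simp
      with op_norm_le_norm[of Y1] that(1) show ?thesis by linarith
    qed
    then have "ln (op_norm Y1) \<le> ln (16 * exp (16 * b * \<bar>t\<bar>) * op_norm Y2)"
      using that by (intro ln_mono) auto
    then show ?thesis using that by (simp add: ln_mult)
  qed
  have pos: "0 < op_norm (?f s)" if "\<bar>s\<bar> \<le> \<bar>t\<bar>" for s
    by (rule op_norm_transfer_bounds(1)[OF \<kappa> vcont L m[OF that]])
  show ?thesis
    using step[OF fwd pos pos] step[OF bwd pos pos] unfolding b_def by (simp add: abs_le_iff)
qed

section \<open>The topology of local convergence\<close>

text \<open>The open set consists of the functions that satisfy the bounds with a uniform margin
  \<open>d < e\<close>; the margin leaves room for a further perturbation.\<close>

lemma Ck_loc_nhd_contains_open: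
  assumes f: "Ck_fun k f" and "e > 0"
  obtains U where "openin (Ck_loc k) U" "f \<in> U" "U \<subseteq> Ck_loc_nhd k f R e"
proof -
  define U where "U = {g. Ck_fun k g \<and> (\<exists>d<e. \<forall>j\<le>k. \<forall>x\<in>{-R..R}. norm (vderiv j g x - vderiv j f x) \<le> d)}"
  have "Ck_loc_open k U"
    unfolding Ck_loc_open_def
  proof (intro conjI ballI)
    show "U \<subseteq> Collect (Ck_fun k)" by (auto simp: U_def)
    fix g assume "g \<in> U"
    then obtain d where d: "d < e" "\<And>j x. j \<le> k \<Longrightarrow> x \<in> {-R..R} \<Longrightarrow> norm (vderiv j g x - vderiv j f x) \<le> d"
      by (auto simp: U_def)
    \<comment> \<open>Half of the margin is spent; \<open>max R 1\<close> supplies the positive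
      radius that \<open>Ck_loc_open\<close> asks for.\<close>
    have "Ck_loc_nhd k g (max R 1) ((e - d) / 2) \<subseteq> U"
    proof
      fix h assume h: "h \<in> Ck_loc_nhd k g (max R 1) ((e - d) / 2)"
      have "norm (vderiv j h x - vderiv j f x) \<le> (e + d) / 2" if "j \<le> k" "x \<in> {-R..R}" for j x
      proof -
        have "norm (vderiv j h x - vderiv j g x) < (e - d) / 2"
        proof -
          have "x \<in> {- max R 1..max R 1}" using that(2) by auto
          with h that(1) show ?thesis unfolding Ck_loc_nhd_def by blast
        qed
        with d(2)[OF that] norm_triangle_ineq[of "vderiv j h x - vderiv j g x" "vderiv j g x - vderiv j f x"]
        show ?thesis by (simp add: field_simps)
      qed
      moreover have "(e + d) / 2 < e" using d(1) by simp
      moreover have "Ck_fun k h" using h by (simp add: Ck_loc_nhd_def)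
      ultimately show "h \<in> U" unfolding U_def by blast
    qed
    then show "\<exists>R>0. \<exists>\<epsilon>>0. Ck_loc_nhd k g R \<epsilon> \<subseteq> U"
      using d(1) by (intro exI[of _ "max R 1"] conjI exI[of _ "(e - d) / 2"]) auto
  qed
  moreover have "f \<in> U" using assms by (auto simp: U_def intro!: exI[of _ 0])
  moreover have "U \<subseteq> Ck_loc_nhd k f R e"
    unfolding U_def Ck_loc_nhd_def by (auto intro: le_less_trans)
  ultimately show ?thesis using that by (simp add: openin_Ck_loc)
qed

lemma hull_loc_iff:
  "p \<in> hull_loc f \<longleftrightarrow> Ck_fun 4 p \<and> (\<forall>R e. e > 0 \<longrightarrow> (\<exists>y. translate y f \<in> Ck_loc_nhd 4 p R e))"
proof
  assume p: "p \<in> hull_loc f"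
  then have Ck: "Ck_fun 4 p"
    using closure_of_subset_topspace[of "Ck_loc 4"] by (auto simp: hull_loc_def topspace_Ck_loc)
  moreover have "\<exists>y. translate y f \<in> Ck_loc_nhd 4 p R e" if "e > 0" for R e
  proof -
    obtain U where U: "openin (Ck_loc 4) U" "p \<in> U" "U \<subseteq> Ck_loc_nhd 4 p R e"
      using Ck_loc_nhd_contains_open[OF Ck \<open>e > 0\<close>] by blast
    with p show ?thesis unfolding hull_loc_def in_closure_of by blast
  qed
  ultimately show "Ck_fun 4 p \<and> (\<forall>R e. e > 0 \<longrightarrow> (\<exists>y. translate y f \<in> Ck_loc_nhd 4 p R e))" by blast
next
  assume r: "Ck_fun 4 p \<and> (\<forall>R e. e > 0 \<longrightarrow> (\<exists>y. translate y f \<in> Ck_loc_nhd 4 p R e))"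
  show "p \<in> hull_loc f"
    unfolding hull_loc_def in_closure_of topspace_Ck_loc
  proof (intro conjI allI impI)
    fix T assume "p \<in> T \<and> openin (Ck_loc 4) T"
    then obtain R e where "e > 0" "Ck_loc_nhd 4 p R e \<subseteq> T"
      unfolding openin_Ck_loc Ck_loc_open_def by meson
    with r show "\<exists>y. y \<in> range (\<lambda>y. translate y f) \<and> y \<in> T" by blast
  qed (use r in simp)
qed

lemma hull_loc_Ck: "p \<in> hull_loc f \<Longrightarrow> Ck_fun 4 p"
  by (simp add: hull_loc_iff)

lemma hull_loc_continuous: "p \<in> hull_loc f \<Longrightarrow> continuous_on UNIV p"
  using Ck_fun_continuous[OF hull_loc_Ck, of p f 0] by simp

lemma topspace_hull_top: "topspace (hull_top f) = hull_loc f"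
  using hull_loc_Ck by (auto simp: hull_top_def topspace_Ck_loc)

lemma openin_hull_topI:
  assumes "S \<subseteq> hull_loc f"
    and "\<And>p. p \<in> S \<Longrightarrow> \<exists>R e. e > 0 \<and> hull_loc f \<inter> Ck_loc_nhd 4 p R e \<subseteq> S"
  shows "openin (hull_top f) S"
  unfolding openin_subopen[of _ S]
proof
  fix p assume p: "p \<in> S"
  then obtain R e where e: "e > 0" "hull_loc f \<inter> Ck_loc_nhd 4 p R e \<subseteq> S" using assms(2) by blast
  have "Ck_fun 4 p" using p assms(1) hull_loc_Ck by blast
  from Ck_loc_nhd_contains_open[OF this e(1)] obtain U where
    U: "openin (Ck_loc 4) U" "p \<in> U" "U \<subseteq> Ck_loc_nhd 4 p R e" by blast
  then have "openin (hull_top f) (U \<inter> hull_loc f)" unfolding hull_top_def openin_subtopology by blast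
  then show "\<exists>T. openin (hull_top f) T \<and> p \<in> T \<and> T \<subseteq> S"
    using U e(2) p assms(1) by (intro exI[of _ "U \<inter> hull_loc f"]) auto
qed

lemma continuous_map_hullI:
  assumes maps: "\<And>p. p \<in> hull_loc f \<Longrightarrow> F p \<in> hull_loc g"
    and cont: "\<And>p R e. p \<in> hull_loc f \<Longrightarrow> e > 0 \<Longrightarrow>
      \<exists>R' e'. e' > 0 \<and> (\<forall>p'\<in>hull_loc f. p' \<in> Ck_loc_nhd 4 p R' e' \<longrightarrow> F p' \<in> Ck_loc_nhd 4 (F p) R e)"
  shows "continuous_map (hull_top f) (hull_top g) F"
  unfolding continuous_map_def topspace_hull_top
proof (intro conjI allI impI)
  show "F \<in> hull_loc f \<rightarrow> hull_loc g" using maps by auto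
  fix U assume "openin (hull_top g) U"
  then obtain V where V: "openin (Ck_loc 4) V" "U = V \<inter> hull_loc g"
    unfolding hull_top_def openin_subtopology by blast
  show "openin (hull_top f) {x \<in> hull_loc f. F x \<in> U}"
  proof (rule openin_hull_topI)
    fix p assume "p \<in> {x \<in> hull_loc f. F x \<in> U}"
    then have p: "p \<in> hull_loc f" "F p \<in> V" by (auto simp: V)
    with V(1) obtain R e where e: "e > 0" "Ck_loc_nhd 4 (F p) R e \<subseteq> V"
      unfolding openin_Ck_loc Ck_loc_open_def by meson
    from cont[OF p(1) e(1), of R] obtain R' e' where "e' > 0"
        "\<forall>p'\<in>hull_loc f. p' \<in> Ck_loc_nhd 4 p R' e' \<longrightarrow> F p' \<in> Ck_loc_nhd 4 (F p) R e" by blast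
    with e(2) maps show "\<exists>R e. e > 0 \<and> hull_loc f \<inter> Ck_loc_nhd 4 p R e \<subseteq> {x \<in> hull_loc f. F x \<in> U}"
      unfolding V(2) by blast
  qed auto
qed

lemma translate_translate: "translate a (translate b f) = translate (a + b) f"
  by (simp add: translate_def add.assoc)

lemma Ck_fun_translate:
  assumes "Ck_fun k f"
  shows "Ck_fun k (translate y f)" and "j \<le> k \<Longrightarrow> vderiv j (translate y f) = translate y (vderiv j f)"
  using Ck_fun_affine[OF assms, where a = 1 and c = y] by (simp_all add: translate_def)

lemma Ck_loc_nhd_translate:
  assumes g: "g \<in> Ck_loc_nhd k f (R + \<bar>y\<bar>) e" and f: "Ck_fun k f"
  shows "translate y g \<in> Ck_loc_nhd k (translate y f) R e"
proof -
  have Ck: "Ck_fun k g" using g by (simp add: Ck_loc_nhd_def)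
  have "norm (vderiv j g (x + y) - vderiv j f (x + y)) < e" if "j \<le> k" "x \<in> {-R..R}" for j x
  proof -
    have "x + y \<in> {-(R + \<bar>y\<bar>)..R + \<bar>y\<bar>}" using that by auto
    then show ?thesis using g that by (auto simp: Ck_loc_nhd_def)
  qed
  then show ?thesis
    using Ck_fun_translate[OF Ck] Ck_fun_translate[OF f] by (simp add: Ck_loc_nhd_def translate_def[of y "vderiv _ _"])
qed

lemma hull_loc_translate:
  assumes "p \<in> hull_loc f"
  shows "translate y p \<in> hull_loc f"
  unfolding hull_loc_iff
proof (intro conjI allI impI)
  show "Ck_fun 4 (translate y p)" by (rule Ck_fun_translate(1)[OF hull_loc_Ck[OF assms]])
  fix R e :: real assume "e > 0"
  then obtain z where "translate z f \<in> Ck_loc_nhd 4 p (R + \<bar>y\<bar>) e" using assms unfolding hull_loc_iff by blast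
  from Ck_loc_nhd_translate[OF this hull_loc_Ck[OF assms]]
  show "\<exists>z. translate z f \<in> Ck_loc_nhd 4 (translate y p) R e" unfolding translate_translate by blast
qed

lemma continuous_map_translate: "continuous_map (hull_top f) (hull_top f) (translate y)"
proof (rule continuous_map_hullI)
  fix p R and e :: real assume p: "p \<in> hull_loc f" "e > 0"
  show "\<exists>R' e'. e' > 0 \<and> (\<forall>p'\<in>hull_loc f. p' \<in> Ck_loc_nhd 4 p R' e' \<longrightarrow>
      translate y p' \<in> Ck_loc_nhd 4 (translate y p) R e)"
    using Ck_loc_nhd_translate[OF _ hull_loc_Ck[OF p(1)]] p(2) by blast
qed (rule hull_loc_translate)

text \<open>Stands in for first countability of the hull: radius and precision improve together
  along one sequence of translates.\<close>

lemma hull_loc_sequence: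
  assumes "p \<in> hull_loc f"
  obtains y :: "nat \<Rightarrow> real" where "\<And>n. translate (y n) f \<in> Ck_loc_nhd 4 p (real (Suc n)) (inverse (real (Suc n)))"
proof -
  have "\<forall>n. \<exists>y. translate y f \<in> Ck_loc_nhd 4 p (real (Suc n)) (inverse (real (Suc n)))"
    using assms unfolding hull_loc_iff by simp
  then show ?thesis using that by metis
qed

lemma Ck_loc_nhd_sequence_tendsto:
  assumes "\<And>n. g n \<in> Ck_loc_nhd k p (real (Suc n)) (inverse (real (Suc n)))"
  shows "(\<lambda>n. g n x) \<longlonglongrightarrow> p x"
proof -
  have "(\<lambda>n. g n x - p x) \<longlonglongrightarrow> 0"
  proof (rule Lim_null_comparison[OF _ LIMSEQ_inverse_real_of_nat])
    show "\<forall>\<^sub>F n in sequentially. norm (g n x - p x) \<le> inverse (real (Suc n))"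
      using eventually_ge_at_top[of "nat \<lceil>\<bar>x\<bar>\<rceil>"]
    proof eventually_elim
      case (elim n)
      then have "x \<in> {- real (Suc n)..real (Suc n)}" by auto
      with assms[of n] have "norm (vderiv 0 (g n) x - vderiv 0 p x) < inverse (real (Suc n))"
        unfolding Ck_loc_nhd_def by blast
      then show ?case by simp
    qed
  qed
  then show ?thesis by (simp add: LIM_zero_iff)
qed

section \<open>The flow on a hull\<close>

lemma continuous_on_shift2:
  fixes w :: "real \<Rightarrow> real \<Rightarrow> 'a::topological_space"
  assumes "continuous_on UNIV (\<lambda>(t, x). w t x)"
  shows "continuous_on UNIV (\<lambda>(t, x). w (t + a) (x + b))"
proof -
  have "continuous_on UNIV (\<lambda>z :: real \<times> real. (fst z + a, snd z + b))"
    by (intro continuous_intros)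
  from continuous_on_compose2[OF assms this] show ?thesis by (simp add: case_prod_unfold)
qed

lemma classical_nls_solution_shift:
  assumes "classical_nls_solution \<kappa> v"
  shows "classical_nls_solution \<kappa> (\<lambda>t x. v (t + a) (x + b))"
proof -
  obtain vt vx vxx where v: "continuous_on UNIV (\<lambda>(t, x). vt t x)" "continuous_on UNIV (\<lambda>(t, x). vx t x)"
      "continuous_on UNIV (\<lambda>(t, x). vxx t x)"
    and D: "\<And>t x. ((\<lambda>s. v s x) has_vector_derivative vt t x) (at t)"
      "\<And>t x. (v t has_vector_derivative vx t x) (at x)" "\<And>t x. (vx t has_vector_derivative vxx t x) (at x)"
      "\<And>t x. \<i> * vt t x = - (1 / 2) * vxx t x + complex_of_real (\<kappa> * (norm (v t x))\<^sup>2) * v t x"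
    using assms unfolding classical_nls_solution_def by blast
  show ?thesis
    unfolding classical_nls_solution_def
  proof (intro exI conjI allI)
    show "continuous_on UNIV (\<lambda>(t, x). vt (t + a) (x + b))" "continuous_on UNIV (\<lambda>(t, x). vx (t + a) (x + b))"
        "continuous_on UNIV (\<lambda>(t, x). vxx (t + a) (x + b))"
      by (intro continuous_on_shift2 v)+
    fix t x
    show "((\<lambda>s. v (s + a) (x + b)) has_vector_derivative vt (t + a) (x + b)) (at t)"
      using has_vector_derivative_affine[of "\<lambda>s. v s (x + b)" _ 1 t a] D(1) by simp
    show "((\<lambda>x. v (t + a) (x + b)) has_vector_derivative vx (t + a) (x + b)) (at x)"
      using has_vector_derivative_affine[of "v (t + a)" _ 1 x b] D(2) by simp
    show "((\<lambda>x. vx (t + a) (x + b)) has_vector_derivative vxx (t + a) (x + b)) (at x)"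
      using has_vector_derivative_affine[of "vx (t + a)" _ 1 x b] D(3) by simp
    show "\<i> * vt (t + a) (x + b) = - (1 / 2) * vxx (t + a) (x + b) +
        complex_of_real (\<kappa> * (norm (v (t + a) (x + b)))\<^sup>2) * v (t + a) (x + b)" by (rule D(4))
  qed
qed

lemma bounded_on_stripsI:
  assumes "\<And>T. \<exists>M. \<forall>t x. \<bar>t\<bar> \<le> T \<longrightarrow> norm (w t x) \<le> M"
  shows "bounded_on_strips w"
  unfolding bounded_on_strips_def
proof
  fix T
  obtain M where "\<And>t x. \<bar>t\<bar> \<le> T \<Longrightarrow> norm (w t x) \<le> M" using assms by blast
  then show "bounded ((\<lambda>(t, x). w t x) ` ({- T..T} \<times> UNIV))"
    unfolding bounded_iff by (intro exI[of _ M]) auto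
qed

context
  fixes \<eta> :: "real \<Rightarrow> real" and \<kappa> :: real and \<Phi> :: "real \<Rightarrow> (real \<Rightarrow> complex) \<Rightarrow> real \<Rightarrow> complex"
  assumes partition: "unit_partition \<eta>" and flow: "nls_flow \<eta> \<kappa> \<Phi>"
begin

lemma flow_mod_space: "p \<in> mod_space \<eta> 5 \<Longrightarrow> \<Phi> t p \<in> mod_space \<eta> 5"
  using flow unfolding nls_flow_def continuous_into_mod_def by blast

lemma flow_0: "p \<in> mod_space \<eta> 5 \<Longrightarrow> \<Phi> 0 p = p"
  using flow unfolding nls_flow_def by blast

lemma flow_classical: "p \<in> mod_space \<eta> 5 \<Longrightarrow> classical_nls_solution \<kappa> (\<lambda>t. \<Phi> t p)"
  using flow unfolding nls_flow_def by blast

lemma flow_unique: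
  assumes "p \<in> mod_space \<eta> 5" "classical_nls_solution \<kappa> v" "bounded_on_strips v"
    "bounded_on_strips (\<lambda>t. vderiv (Suc 0) (v t))" "v 0 = p"
  shows "v t = \<Phi> t p"
  using flow assms unfolding nls_flow_def One_nat_def by blast

lemma flow_Ck: "p \<in> mod_space \<eta> 5 \<Longrightarrow> Ck_fun 5 (\<Phi> t p)"
  using mod_space_regular[OF partition flow_mod_space] by blast

text \<open>\<open>mod_fnorm_bound\<close>, applied to the difference of two times, turns continuity
  with values in the space into closeness of all derivatives, uniformly in \<open>x\<close>.\<close>

lemma flow_time_continuous:
  assumes p: "p \<in> mod_space \<eta> 5" and e: "e > 0"
  shows "\<exists>d>0. \<forall>s. \<bar>s - t\<bar> < d \<longrightarrow> (\<forall>j\<le>5. \<forall>x. norm (vderiv j (\<Phi> s p) x - vderiv j (\<Phi> t p) x) \<le> e)"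
proof -
  obtain C where C: "C \<ge> 0" "\<And>f M j x. \<lbrakk>continuous_on UNIV f; \<forall>x. norm (f x) \<le> M; mod_fnorm \<eta> 5 f < \<infinity>; j \<le> 5\<rbrakk>
      \<Longrightarrow> norm (vderiv j f x) \<le> C * enn2real (mod_fnorm \<eta> 5 f)"
    using mod_fnorm_bound[OF partition] by metis
  have "((\<lambda>s. mod_fnorm \<eta> 5 (\<lambda>x. \<Phi> s p x - \<Phi> t p x)) \<longlongrightarrow> 0) (at t)"
    using flow p unfolding nls_flow_def continuous_into_mod_def by blast
  moreover have "0 < ennreal (e / (C + 1))" using e C(1) by simp
  ultimately have "\<forall>\<^sub>F s in at t. mod_fnorm \<eta> 5 (\<lambda>x. \<Phi> s p x - \<Phi> t p x) < ennreal (e / (C + 1))"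
    by (rule order_tendstoD(2))
  then obtain d where d: "d > 0" "\<And>s. s \<noteq> t \<Longrightarrow> \<bar>s - t\<bar> < d \<Longrightarrow>
      mod_fnorm \<eta> 5 (\<lambda>x. \<Phi> s p x - \<Phi> t p x) < ennreal (e / (C + 1))"
    unfolding eventually_at dist_real_def by auto
  have "norm (vderiv j (\<Phi> s p) x - vderiv j (\<Phi> t p) x) \<le> e" if s: "\<bar>s - t\<bar> < d" and j: "j \<le> 5" for s j x
  \<comment> \<open>A limit at \<open>t\<close> disregards the value at \<open>t\<close>
    itself.\<close>
  proof (cases "s = t")
    case False
    let ?h = "\<lambda>x. \<Phi> s p x - \<Phi> t p x"
    have Ck: "Ck_fun 5 (\<Phi> r p)" for r by (rule flow_Ck[OF p])
    have cont: "continuous_on UNIV ?h"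
      using Ck_fun_continuous[OF Ck, of 0] by (intro continuous_intros) auto
    obtain M1 where "\<And>j x. j \<le> 5 \<Longrightarrow> norm (vderiv j (\<Phi> s p) x) \<le> M1"
      using mod_space_regular[OF partition flow_mod_space[OF p]] by blast
    from this[of 0] have M1: "norm (\<Phi> s p x) \<le> M1" for x by simp
    obtain M2 where "\<And>j x. j \<le> 5 \<Longrightarrow> norm (vderiv j (\<Phi> t p) x) \<le> M2"
      using mod_space_regular[OF partition flow_mod_space[OF p]] by blast
    from this[of 0] have M2: "norm (\<Phi> t p x) \<le> M2" for x by simp
    have bd: "\<forall>x. norm (?h x) \<le> M1 + M2"
      by (intro allI order_trans[OF norm_triangle_ineq4] add_mono M1 M2)
    have small: "mod_fnorm \<eta> 5 ?h < ennreal (e / (C + 1))" by (rule d(2)[OF False s])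
    then have fin: "mod_fnorm \<eta> 5 ?h < \<infinity>" by (auto intro: less_trans)
    have "enn2real (mod_fnorm \<eta> 5 ?h) \<le> e / (C + 1)"
      using small e C(1) by (intro enn2real_leI) auto
    then have "C * enn2real (mod_fnorm \<eta> 5 ?h) \<le> (C + 1) * (e / (C + 1))"
      using C(1) by (intro mult_mono) auto
    also have "\<dots> = e" using C(1) by simp
    finally have "norm (vderiv j ?h x) \<le> e" using C(2)[OF cont bd fin j, of x] by linarith
    then show ?thesis using Ck_fun_diff(2)[OF Ck Ck j] by simp
  qed (use e in simp)
  then show ?thesis using d(1) by blast
qed

text \<open>Continuity gives a bound near each time; finitely many of these neighbourhoods cover the
  interval, and the sum of the bounds dominates each of them.\<close>

lemma flow_bounded:
  assumes p: "p \<in> mod_space \<eta> 5"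
  obtains M where "M \<ge> 0" "\<And>s j x. \<bar>s\<bar> \<le> T \<Longrightarrow> j \<le> 5 \<Longrightarrow> norm (vderiv j (\<Phi> s p) x) \<le> M"
proof -
  have "\<exists>d M. d > 0 \<and> (\<forall>s j x. \<bar>s - t\<bar> < d \<longrightarrow> j \<le> 5 \<longrightarrow> norm (vderiv j (\<Phi> s p) x) \<le> M)" for t
  proof -
    obtain d where d: "d > 0" "\<And>s j x. \<bar>s - t\<bar> < d \<Longrightarrow> j \<le> 5 \<Longrightarrow>
        norm (vderiv j (\<Phi> s p) x - vderiv j (\<Phi> t p) x) \<le> 1"
      using flow_time_continuous[OF p, of 1 t] by auto
    obtain M where M: "\<And>j x. j \<le> 5 \<Longrightarrow> norm (vderiv j (\<Phi> t p) x) \<le> M"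
      using mod_space_regular[OF partition flow_mod_space[OF p]] by blast
    have "norm (vderiv j (\<Phi> s p) x) \<le> M + 1" if "\<bar>s - t\<bar> < d" "j \<le> 5" for s j x
      using d(2)[OF that, of x] M[OF that(2), of x] norm_triangle_sub[of "vderiv j (\<Phi> s p) x" "vderiv j (\<Phi> t p) x"]
      by linarith
    with d(1) show ?thesis by blast
  qed
  then obtain d M where dM: "\<And>t. d t > 0" "\<And>t s j x. \<bar>s - t\<bar> < d t \<Longrightarrow> j \<le> 5 \<Longrightarrow> norm (vderiv j (\<Phi> s p) x) \<le> M t"
    by metis
  have op: "open (ball t (d t))" if "t \<in> {-T..T}" for t by simp
  have cover: "{-T..T} \<subseteq> (\<Union>t\<in>{-T..T}. ball t (d t))"
  proof
    fix t assume "t \<in> {-T..T}"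
    then show "t \<in> (\<Union>t\<in>{-T..T}. ball t (d t))" using dM(1)[of t] by (intro UN_I[of t]) auto
  qed
  obtain C where C: "C \<subseteq> {-T..T}" "finite C" "{-T..T} \<subseteq> (\<Union>t\<in>C. ball t (d t))"
    using compactE_image[OF compact_Icc op cover] by blast
  have "norm (vderiv j (\<Phi> s p) x) \<le> (\<Sum>t\<in>C. \<bar>M t\<bar>)" if s: "\<bar>s\<bar> \<le> T" and j: "j \<le> 5" for s j x
  proof -
    have "s \<in> {-T..T}" using s by auto
    then obtain t where t: "t \<in> C" "dist t s < d t" using C(3) by auto
    then have "norm (vderiv j (\<Phi> s p) x) \<le> \<bar>M t\<bar>"
      using dM(2)[of s t j x] j by (auto simp: dist_real_def abs_minus_commute)
    also have "\<dots> \<le> (\<Sum>t\<in>C. \<bar>M t\<bar>)" using t C(2) by (intro member_le_sum) auto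
    finally show ?thesis .
  qed
  then show ?thesis by (intro that[of "\<Sum>t\<in>C. \<bar>M t\<bar>"]) (auto intro: sum_nonneg)
qed

text \<open>The constant sequence of translations in
  \<open>mod_space_translation_limit\<close>.\<close>

lemma mod_space_translate: "p \<in> mod_space \<eta> 5 \<Longrightarrow> translate b p \<in> mod_space \<eta> 5"
  by (rule mod_space_translation_limit[OF partition, where f = p and y = "\<lambda>_. b"])
    (auto simp: translate_def mod_space_def intro!: translate_continuous[unfolded translate_def])

text \<open>A solution shifted in time and space is again a solution with bounded gradient on
  strips, so uniqueness identifies it. Equivariance under translations and the group law are the
  special cases \<open>a = 0\<close> and \<open>b = 0\<close>.\<close>

lemma flow_shift:
  assumes p: "p \<in> mod_space \<eta> 5"
  shows "\<Phi> s (translate b (\<Phi> a p)) = translate b (\<Phi> (s + a) p)"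
proof -
  let ?v = "\<lambda>s x. \<Phi> (s + a) p (x + b)"
  have vd: "vderiv j (?v s) = (\<lambda>x. vderiv j (\<Phi> (s + a) p) (x + b))" if "j \<le> 5" for j s
    using Ck_fun_translate(2)[OF flow_Ck[OF p, of "s + a"] that, of b] by (simp add: translate_def)
  have bd: "bounded_on_strips (\<lambda>s. vderiv j (?v s))" if j: "j \<le> 5" for j
  proof (rule bounded_on_stripsI)
    fix T
    obtain M where M: "M \<ge> 0" "\<And>s j x. \<bar>s\<bar> \<le> T + \<bar>a\<bar> \<Longrightarrow> j \<le> 5 \<Longrightarrow> norm (vderiv j (\<Phi> s p) x) \<le> M"
      by (rule flow_bounded[OF p, of "T + \<bar>a\<bar>"]) (rule that)
    have "norm (vderiv j (?v t) x) \<le> M" if "\<bar>t\<bar> \<le> T" for t x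
      unfolding vd[OF j] by (rule M(2)[OF _ j]) (use that in linarith)
    then show "\<exists>M. \<forall>t x. \<bar>t\<bar> \<le> T \<longrightarrow> norm (vderiv j (?v t) x) \<le> M" by blast
  qed
  have "?v s = \<Phi> s (translate b (\<Phi> a p))"
  proof (rule flow_unique)
    show "translate b (\<Phi> a p) \<in> mod_space \<eta> 5" by (intro mod_space_translate flow_mod_space p)
    show "classical_nls_solution \<kappa> ?v" by (rule classical_nls_solution_shift[OF flow_classical[OF p]])
    show "bounded_on_strips ?v" "bounded_on_strips (\<lambda>s. vderiv (Suc 0) (?v s))"
      using bd[of 0] bd[of "Suc 0"] by simp_all
  qed (simp add: translate_def)
  then show ?thesis by (simp add: translate_def)
qed

lemma flow_translate: "p \<in> mod_space \<eta> 5 \<Longrightarrow> \<Phi> t (translate b p) = translate b (\<Phi> t p)"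
  using flow_shift[of p t b 0] by (simp add: flow_0)

lemma flow_add: "p \<in> mod_space \<eta> 5 \<Longrightarrow> \<Phi> s (\<Phi> a p) = \<Phi> (s + a) p"
  using flow_shift[of p s 0 a] by (simp add: translate_def)

end

section \<open>Space-time compactness of translated solutions\<close>

lemma uniform_limit_slice:
  assumes "uniform_limit (A \<times> B) (\<lambda>n (s, x). f n s x) (\<lambda>(s, x). g s x) F"
  shows "s \<in> A \<Longrightarrow> uniform_limit B (\<lambda>n. f n s) (g s) F"
    and "x \<in> B \<Longrightarrow> uniform_limit A (\<lambda>n s. f n s x) (\<lambda>s. g s x) F"
  using assms unfolding uniform_limit_iff
  by (auto elim!: eventually_mono)

lemma uniform_limit_subseq:
  assumes "uniform_limit S f g sequentially" "strict_mono (r :: nat \<Rightarrow> nat)"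
  shows "uniform_limit S (\<lambda>n. f (r n)) g sequentially"
  unfolding uniform_limit_iff
proof (intro allI impI)
  fix e :: real assume "e > 0"
  with assms(1) have "\<forall>\<^sub>F n in sequentially. \<forall>x\<in>S. dist (f n x) (g x) < e"
    unfolding uniform_limit_iff by blast
  then show "\<forall>\<^sub>F n in sequentially. \<forall>x\<in>S. dist (f (r n) x) (g x) < e"
    by (rule eventually_compose_filterlim) (rule filterlim_subseq[OF assms(2)])
qed

context
  fixes \<eta> :: "real \<Rightarrow> real" and \<kappa> :: real and \<Phi> :: "real \<Rightarrow> (real \<Rightarrow> complex) \<Rightarrow> real \<Rightarrow> complex"
  assumes partition: "unit_partition \<eta>" and flow: "nls_flow \<eta> \<kappa> \<Phi>"
begin

text \<open>The derivative of order \<open>Suc j\<close>, at most 5, is bounded and gives a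
  Lipschitz constant in space; \<open>d\<close> is chosen independently of the translation
  \<open>y\<close>.\<close>

lemma flow_equicontinuous:
  assumes q0: "q0 \<in> mod_space \<eta> 5" and e: "e > 0" and j: "j \<le> 4"
  shows "\<exists>d>0. \<forall>s' x' y. \<bar>s' - s\<bar> < d \<longrightarrow> \<bar>x' - x\<bar> < d \<longrightarrow>
      norm (vderiv j (\<Phi> s' q0) (x' + y) - vderiv j (\<Phi> s q0) (x + y)) < e"
proof -
  obtain d where d: "d > 0" "\<And>s' j x. \<bar>s' - s\<bar> < d \<Longrightarrow> j \<le> 5 \<Longrightarrow>
      norm (vderiv j (\<Phi> s' q0) x - vderiv j (\<Phi> s q0) x) \<le> e / 2"
    using flow_time_continuous[OF partition flow q0, of "e / 2" s] e by auto
  obtain M where M: "M \<ge> 0" "\<And>r j x. \<bar>r\<bar> \<le> \<bar>s\<bar> \<Longrightarrow> j \<le> 5 \<Longrightarrow> norm (vderiv j (\<Phi> r q0) x) \<le> M"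
    by (rule flow_bounded[OF partition flow q0, of "\<bar>s\<bar>"]) (rule that)
  have lip: "norm (vderiv j (\<Phi> s q0) a - vderiv j (\<Phi> s q0) b) \<le> M * norm (a - b)" for a b
  proof (rule differentiable_bound[where S = UNIV and f' = "\<lambda>r h. h *\<^sub>R vderiv (Suc j) (\<Phi> s q0) r"])
    fix r
    have "(vderiv j (\<Phi> s q0) has_vector_derivative vderiv (Suc j) (\<Phi> s q0) r) (at r)"
      by (rule Ck_fun_has_vderiv[OF flow_Ck[OF partition flow q0]]) (use j in simp)
    then show "(vderiv j (\<Phi> s q0) has_derivative (\<lambda>h. h *\<^sub>R vderiv (Suc j) (\<Phi> s q0) r)) (at r within UNIV)"
      by (simp add: has_vector_derivative_def)
    show "onorm (\<lambda>h. h *\<^sub>R vderiv (Suc j) (\<Phi> s q0) r) \<le> M"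
      using M(2)[of s "Suc j" r] j by (intro onorm_le) (simp add: mult.commute[of M] mult_left_mono)
  qed auto
  define d' where "d' = min d (e / 2 / (M + 1))"
  have d': "d' > 0" "d' \<le> d" "d' \<le> e / 2 / (M + 1)" using d(1) e M(1) by (auto simp: d'_def)
  have "norm (vderiv j (\<Phi> s' q0) (x' + y) - vderiv j (\<Phi> s q0) (x + y)) < e"
    if s: "\<bar>s' - s\<bar> < d'" and x: "\<bar>x' - x\<bar> < d'" for s' x' y
  proof -
    have 1: "norm (vderiv j (\<Phi> s' q0) (x' + y) - vderiv j (\<Phi> s q0) (x' + y)) \<le> e / 2"
      using s d'(2) j by (intro d(2)) auto
    have "norm (vderiv j (\<Phi> s q0) (x' + y) - vderiv j (\<Phi> s q0) (x + y)) \<le> M * \<bar>x' - x\<bar>"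
      using lip[of "x' + y" "x + y"] by simp
    also have "\<dots> \<le> (M + 1) * \<bar>x' - x\<bar>" by (simp add: algebra_simps)
    also have "\<dots> < (M + 1) * (e / 2 / (M + 1))"
      using x d'(3) M(1) by (intro mult_strict_left_mono) auto
    also have "\<dots> = e / 2"
    proof -
      have "M + 1 \<noteq> 0" using M(1) by linarith
      then show ?thesis by (simp add: field_simps)
    qed
    finally show ?thesis
      using 1 norm_triangle_ineq[of "vderiv j (\<Phi> s' q0) (x' + y) - vderiv j (\<Phi> s q0) (x' + y)"
          "vderiv j (\<Phi> s q0) (x' + y) - vderiv j (\<Phi> s q0) (x + y)"] by simp
  qed
  then show ?thesis using d'(1) by blast
qed

text \<open>Compactness in space-time: the limit of a subsequence solves the equation with initial datum
  \<open>p\<close>, and the uniqueness clause of the flow identifies it.\<close>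

lemma flow_compactness:
  fixes y :: "nat \<Rightarrow> real"
  assumes q0: "q0 \<in> mod_space \<eta> 5" and p: "continuous_on UNIV p"
    and lim: "\<And>x. (\<lambda>n. q0 (x + y n)) \<longlonglongrightarrow> p x"
  obtains r where "strict_mono (r :: nat \<Rightarrow> nat)" "p \<in> mod_space \<eta> 5"
    "\<And>j R s. j \<le> 4 \<Longrightarrow>
      uniform_limit {-R..R} (\<lambda>n x. vderiv j (\<Phi> s q0) (x + y (r n))) (vderiv j (\<Phi> s p)) sequentially"
proof -
  have pS: "p \<in> mod_space \<eta> 5" by (rule mod_space_translation_limit[OF partition q0 p lim])
  define G where "G n j = (\<lambda>(s, x). vderiv j (\<Phi> s q0) (x + y n))" for n j
  define I where "I R = {-R..R} \<times> {-R..R}" for R :: real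
  \<comment> \<open>One index encodes both tasks of the diagonal argument: the derivative of order
    \<open>i mod 5\<close> on the square of half-width \<open>i\<close>.\<close>
  define P where "P i \<sigma> = (\<exists>g. uniform_limit (I (real i)) (\<lambda>n. G (\<sigma> n) (i mod 5)) g sequentially)"
    for i :: nat and \<sigma> :: "nat \<Rightarrow> nat"
  interpret subseqs P
  proof
    fix i :: nat and \<sigma> :: "nat \<Rightarrow> nat" assume "strict_mono \<sigma>"
    let ?j = "i mod 5"
    have j: "?j \<le> 4" using mod_less_divisor[of 5 i] by linarith
    obtain M where M: "M \<ge> 0" "\<And>s j x. \<bar>s\<bar> \<le> real i \<Longrightarrow> j \<le> 5 \<Longrightarrow> norm (vderiv j (\<Phi> s q0) x) \<le> M"
      by (rule flow_bounded[OF partition flow q0, of "real i"]) (rule that)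
    have "compact (I (real i))" unfolding I_def by (intro compact_Times compact_Icc)
    then obtain g k where gk: "strict_mono (k :: nat \<Rightarrow> nat)"
      "\<And>e. 0 < e \<Longrightarrow> \<exists>N. \<forall>n x. n \<ge> N \<and> x \<in> I (real i) \<longrightarrow> norm (G (\<sigma> (k n)) ?j x - g x) < e"
    proof (rule Arzela_Ascoli[where \<F> = "\<lambda>n. G (\<sigma> n) ?j" and M = M])
      show "norm (G (\<sigma> n) ?j z) \<le> M" if "z \<in> I (real i)" for n z
        using that j by (auto simp: G_def I_def intro!: M(2))
      fix z :: "real \<times> real" and e :: real assume "0 < e"
      obtain s x where z: "z = (s, x)" by (cases z)
      obtain d where d: "d > 0" "\<And>s' x' y. \<bar>s' - s\<bar> < d \<Longrightarrow> \<bar>x' - x\<bar> < d \<Longrightarrow>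
          norm (vderiv ?j (\<Phi> s' q0) (x' + y) - vderiv ?j (\<Phi> s q0) (x + y)) < e"
        using flow_equicontinuous[OF q0 \<open>0 < e\<close> j, of s x] by blast
      have "norm (G (\<sigma> n) ?j z - G (\<sigma> n) ?j w) < e" if w: "norm (z - w) < d" for n w
      proof -
        obtain s' x' where w': "w = (s', x')" by (cases w)
        have "\<bar>s - s'\<bar> < d" "\<bar>x - x'\<bar> < d"
          using w norm_fst_le[of "s - s'" "x - x'"] norm_snd_le[of "x - x'" "s - s'"] by (auto simp: z w')
        then show ?thesis
          using d(2)[of s' x' "y (\<sigma> n)"] by (simp add: z w' G_def norm_minus_commute abs_minus_commute)
      qed
      with d(1) show "\<exists>d>0. \<forall>n w. w \<in> I (real i) \<and> norm (z - w) < d \<longrightarrow> norm (G (\<sigma> n) ?j z - G (\<sigma> n) ?j w) < e"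
        by blast
    qed blast
    have "uniform_limit (I (real i)) (\<lambda>n. G (\<sigma> (k n)) ?j) g sequentially"
      unfolding uniform_limit_sequentially_iff dist_norm using gk(2) by blast
    with gk(1) show "\<exists>r'. strict_mono r' \<and> P i (\<sigma> \<circ> r')"
      unfolding P_def by (intro exI[of _ k]) (auto simp: o_def)
  qed
  define r where "r = diagseq"
  have r: "strict_mono r" unfolding r_def by (rule subseq_diagseq)
  have "\<exists>g. uniform_limit (I (real i)) (\<lambda>n. G (r n) (i mod 5)) g sequentially" for i
  proof -
    \<comment> \<open>The diagonal sequence is a subsequence of the \<open>i\<close>-th extraction
      only from \<open>Suc i\<close> on; the finitely many earlier terms do not affect the
      limit.\<close>
    have "P i (diagseq \<circ> (+) (Suc i))"
    proof (rule diagseq_holds)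
      show "P n (s \<circ> r)" if "strict_mono r" "P n s" for r s n
        using that(2) uniform_limit_subseq[OF _ that(1)] unfolding P_def o_def by blast
    qed
    then obtain g where "uniform_limit (I (real i)) (\<lambda>n. G (diagseq (Suc i + n)) (i mod 5)) g sequentially"
      unfolding P_def o_def by blast
    then have "uniform_limit (I (real i)) (\<lambda>n. G (diagseq n) (i mod 5)) g sequentially"
      unfolding uniform_limit_iff
      using eventually_sequentially_seg[of "\<lambda>n. \<forall>x\<in>I (real i). dist (G (diagseq n) (i mod 5) x) (g x) < _" "Suc i"]
      by (simp add: add.commute)
    then show ?thesis unfolding r_def by blast
  qed
  then obtain g where g: "\<And>i. uniform_limit (I (real i)) (\<lambda>n. G (r n) (i mod 5)) (g i) sequentially" by metis
  \<comment> \<open>Defined without reference to a square, so that the limits \<open>g i\<close>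
    obtained on different squares are all restrictions of the same functions.\<close>
  define W where "W j s x = lim (\<lambda>n. G (r n) j (s, x))" for j s x
  have unif: "uniform_limit ({-R..R} \<times> {-R..R}) (\<lambda>n (s, x). vderiv j (\<Phi> s q0) (x + y (r n)))
      (\<lambda>(s, x). W j s x) sequentially" if j: "j \<le> 4" for j R
  proof -
    \<comment> \<open>An index with \<open>i mod 5 = j\<close> whose square contains
      \<open>{-R..R} \<times> {-R..R}\<close>.\<close>
    define i where "i = 5 * nat \<lceil>R\<rceil> + j"
    have i: "i mod 5 = j" using j by (simp add: i_def)
    have "R \<le> real (nat \<lceil>R\<rceil>)" by linarith
    also have "\<dots> \<le> real i" by (simp add: i_def)
    finally have R: "{-R..R} \<times> {-R..R} \<subseteq> I (real i)" by (auto simp: I_def)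
    have u: "uniform_limit (I (real i)) (\<lambda>n. G (r n) j) (g i) sequentially" using g[of i] by (simp add: i)
    have "g i z = (\<lambda>(s, x). W j s x) z" if "z \<in> I (real i)" for z
    proof -
      have "(\<lambda>n. G (r n) j z) \<longlonglongrightarrow> g i z" by (rule tendsto_uniform_limitI[OF u that])
      then show ?thesis unfolding W_def by (simp add: limI case_prod_unfold)
    qed
    then have "uniform_limit (I (real i)) (\<lambda>n. G (r n) j) (\<lambda>(s, x). W j s x) sequentially"
      using u uniform_limit_cong'[of "I (real i)" "\<lambda>n. G (r n) j" "\<lambda>n. G (r n) j" "g i" "\<lambda>(s, x). W j s x"] by blast
    from uniform_limit_on_subset[OF this R] show ?thesis by (simp add: G_def)
  qed
  have Wx: "uniform_limit {-R..R} (\<lambda>n x. vderiv j (\<Phi> s q0) (x + y (r n))) (W j s) sequentially"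
    if "j \<le> 4" for j s R
  proof -
    have "uniform_limit {-max R \<bar>s\<bar>..max R \<bar>s\<bar>} (\<lambda>n x. vderiv j (\<Phi> s q0) (x + y (r n))) (W j s) sequentially"
      by (rule uniform_limit_slice(1)[OF unif[OF that]]) auto
    then show ?thesis by (rule uniform_limit_on_subset) auto
  qed
  have Ws: "uniform_limit {-R..R} (\<lambda>n s. vderiv j (\<Phi> s q0) (x + y (r n))) (\<lambda>s. W j s x) sequentially"
    if "j \<le> 4" for j x R
  proof -
    have "uniform_limit {-max R \<bar>x\<bar>..max R \<bar>x\<bar>} (\<lambda>n s. vderiv j (\<Phi> s q0) (x + y (r n))) (\<lambda>s. W j s x) sequentially"
      by (rule uniform_limit_slice(2)[OF unif[OF that]]) auto
    then show ?thesis by (rule uniform_limit_on_subset) auto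
  qed
  have pt: "(\<lambda>n. vderiv j (\<Phi> s q0) (x + y (r n))) \<longlonglongrightarrow> W j s x" if "j \<le> 4" for j s x
    by (rule tendsto_uniform_limitI[OF Wx[OF that, where R = "\<bar>x\<bar>"]]) auto
  have Ck: "Ck_fun 5 (\<Phi> s q0)" for s by (rule flow_Ck[OF partition flow q0])
  have Ck4: "Ck_fun 4 (\<Phi> s q0)" for s by (rule Ck_fun_mono[OF Ck]) simp
  have shift: "Ck_fun 4 (\<lambda>x. \<Phi> s q0 (x + c))"
      "j \<le> 4 \<Longrightarrow> vderiv j (\<lambda>x. \<Phi> s q0 (x + c)) = (\<lambda>x. vderiv j (\<Phi> s q0) (x + c))" for s c j
    using Ck_fun_translate[OF Ck4, where y = c] by (simp_all add: translate_def)
  have lim': "uniform_limit {-R..R} (\<lambda>n. vderiv j (\<lambda>x. \<Phi> s q0 (x + y (r n)))) (W j s) sequentially"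
    if "j \<le> 4" for j s R
    using Wx[OF that] by (simp add: shift(2)[OF that])
  have WCk: "Ck_fun 4 (W 0 s)" and Wv: "j \<le> 4 \<Longrightarrow> vderiv j (W 0 s) = W j s" for s j
    using Ck_fun_uniform_limit[where f = "\<lambda>n x. \<Phi> s q0 (x + y (r n))" and D = "\<lambda>j. W j s" and k = 4,
        OF shift(1) lim'] by blast+
  have cont: "continuous_on UNIV (\<lambda>(s, x). W j s x)" if j: "j \<le> 4" for j
  proof -
    have cG: "continuous_on UNIV (\<lambda>(s, x). vderiv j (\<Phi> s q0) (x + c))" for c
      unfolding continuous_on_iff
    proof (intro ballI allI impI)
      fix z :: "real \<times> real" and e :: real assume e: "0 < e"
      obtain s x where z: "z = (s, x)" by (cases z)
      obtain d where d: "d > 0" "\<And>s' x' y. \<bar>s' - s\<bar> < d \<Longrightarrow> \<bar>x' - x\<bar> < d \<Longrightarrow>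
          norm (vderiv j (\<Phi> s' q0) (x' + y) - vderiv j (\<Phi> s q0) (x + y)) < e"
        using flow_equicontinuous[OF q0 e j, of s x] by blast
      have "dist (case w of (s, x) \<Rightarrow> vderiv j (\<Phi> s q0) (x + c)) (case z of (s, x) \<Rightarrow> vderiv j (\<Phi> s q0) (x + c)) < e"
        if "dist w z < d" for w
      proof -
        obtain s' x' where w: "w = (s', x')" by (cases w)
        have "\<bar>s' - s\<bar> < d" "\<bar>x' - x\<bar> < d"
          using that dist_fst_le[of w z] dist_snd_le[of w z] by (auto simp: z w dist_real_def)
        then show ?thesis using d(2)[of s' x' c] by (simp add: z w dist_norm)
      qed
      with d(1) show "\<exists>d>0. \<forall>w\<in>UNIV. dist w z < d \<longrightarrow>
          dist (case w of (s, x) \<Rightarrow> vderiv j (\<Phi> s q0) (x + c)) (case z of (s, x) \<Rightarrow> vderiv j (\<Phi> s q0) (x + c)) < e"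
        by blast
    qed
    have "isCont (\<lambda>(s, x). W j s x) (s, x)" for s x
    proof -
      define R where "R = \<bar>s\<bar> + \<bar>x\<bar> + 1"
      have "continuous_on ({-R..R} \<times> {-R..R}) (\<lambda>(s, x). W j s x)"
        by (rule uniform_limit_theorem[OF _ unif[OF j]])
          (auto intro!: always_eventually continuous_on_subset[OF cG])
      moreover have "(s, x) \<in> interior ({-R..R} \<times> {-R..R})"
        by (simp add: interior_Times R_def) linarith
      ultimately show ?thesis by (rule continuous_on_interior)
    qed
    then show ?thesis by (auto simp: continuous_on_eq_continuous_at)
  qed
  have Wb: "\<exists>M. \<forall>s x. \<bar>s\<bar> \<le> T \<longrightarrow> norm (W j s x) \<le> M" if j: "j \<le> 4" for j T
  proof -
    obtain M where M: "M \<ge> 0" "\<And>s j x. \<bar>s\<bar> \<le> T \<Longrightarrow> j \<le> 5 \<Longrightarrow> norm (vderiv j (\<Phi> s q0) x) \<le> M"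
      by (rule flow_bounded[OF partition flow q0, of T]) (rule that)
    have "norm (W j s x) \<le> M" if "\<bar>s\<bar> \<le> T" for s x
      using M(2)[OF that] j by (intro LIMSEQ_le_const2[OF tendsto_norm[OF pt[OF j]]]) auto
    then show ?thesis by blast
  qed
  \<comment> \<open>The equation solved for the time derivative, with the squared modulus written as
    \<open>w0 * cnj w0\<close> so that uniform limits pass through products.\<close>
  define N where "N w0 w2 = - \<i> * (- (1 / 2) * w2 + complex_of_real \<kappa> * (w0 * cnj w0 * w0))" for w0 w2 :: complex
  have N_eq: "\<i> * a = - (1 / 2) * w2 + complex_of_real (\<kappa> * (norm w0)\<^sup>2) * w0 \<longleftrightarrow> a = N w0 w2" for a w0 w2
  proof -
    have "complex_of_real (\<kappa> * (norm w0)\<^sup>2) * w0 = complex_of_real \<kappa> * (w0 * cnj w0 * w0)"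
      by (simp only: of_real_mult complex_norm_square mult.assoc)
    moreover have "\<i> * a = b \<longleftrightarrow> a = - \<i> * b" for b by (auto simp: mult.assoc[symmetric])
    ultimately show ?thesis by (simp only: N_def)
  qed
  \<comment> \<open>Time derivatives are not among the functions made to converge by compactness;
    the equation expresses them through the solution and its second space derivative, whose limits
    are known.\<close>
  have Dt: "((\<lambda>s. W 0 s x) has_vector_derivative N (W 0 s x) (W 2 s x)) (at s)" for s x
  proof (rule has_vector_derivative_uniform_limit[where f = "\<lambda>n s. \<Phi> s q0 (x + y (r n))"
        and f' = "\<lambda>n s. N (\<Phi> s q0 (x + y (r n))) (vderiv 2 (\<Phi> s q0) (x + y (r n)))"])
    obtain vt vx vxx where v: "\<And>t x. ((\<lambda>s. \<Phi> s q0 x) has_vector_derivative vt t x) (at t)"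
      "\<And>t x. (\<Phi> t q0 has_vector_derivative vx t x) (at x)" "\<And>t x. (vx t has_vector_derivative vxx t x) (at x)"
      "\<And>t x. \<i> * vt t x = - (1 / 2) * vxx t x + complex_of_real (\<kappa> * (norm (\<Phi> t q0 x))\<^sup>2) * \<Phi> t q0 x"
      using flow_classical[OF partition flow q0] unfolding classical_nls_solution_def by blast
    have "vderiv (Suc 0) (\<Phi> t q0) = vx t" for t by (rule vderiv_1_eqI[OF v(2)])
    then have "vderiv 2 (\<Phi> t q0) = vxx t" for t
      using vderiv_Suc_right[of 1 "\<Phi> t q0"] vderiv_1_eqI[OF v(3)] by (simp add: numeral_2_eq_2)
    then show "((\<lambda>s. \<Phi> s q0 (x + y (r n))) has_vector_derivative
        N (\<Phi> s q0 (x + y (r n))) (vderiv 2 (\<Phi> s q0) (x + y (r n)))) (at s)" for n s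
      using v(1,4) N_eq by metis
    show "(\<lambda>n. \<Phi> s q0 (x + y (r n))) \<longlonglongrightarrow> W 0 s x" for s using pt[of 0] by simp
    show "uniform_limit {-R..R} (\<lambda>n s. N (\<Phi> s q0 (x + y (r n))) (vderiv 2 (\<Phi> s q0) (x + y (r n))))
        (\<lambda>s. N (W 0 s x) (W 2 s x)) sequentially" for R
    proof -
      have u0: "uniform_limit {-R..R} (\<lambda>n s. \<Phi> s q0 (x + y (r n))) (\<lambda>s. W 0 s x) sequentially"
        using Ws[of 0 x R] by simp
      have u2: "uniform_limit {-R..R} (\<lambda>n s. vderiv 2 (\<Phi> s q0) (x + y (r n))) (\<lambda>s. W 2 s x) sequentially"
        by (rule Ws) simp
      obtain M where M: "\<And>s x. \<bar>s\<bar> \<le> R \<Longrightarrow> norm (W 0 s x) \<le> M" using Wb[of 0 R] by auto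
      have b0: "bounded ((\<lambda>s. W 0 s x) ` {-R..R})"
        unfolding bounded_iff by (intro exI[of _ M]) (auto intro!: M)
      have u1: "uniform_limit {-R..R} (\<lambda>n s. cnj (\<Phi> s q0 (x + y (r n)))) (\<lambda>s. cnj (W 0 s x)) sequentially"
        by (rule bounded_linear.uniform_limit[OF bounded_linear_cnj u0])
      have b1: "bounded ((\<lambda>s. cnj (W 0 s x)) ` {-R..R})"
        unfolding bounded_iff by (intro exI[of _ M]) (auto intro!: M)
      have "norm (W 0 s x * cnj (W 0 s x)) \<le> M * M" if "\<bar>s\<bar> \<le> R" for s
        unfolding norm_mult complex_mod_cnj
        by (intro mult_mono M that order_trans[OF norm_ge_zero M[OF that]]) simp
      then have b01: "bounded ((\<lambda>s. W 0 s x * cnj (W 0 s x)) ` {-R..R})"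
        unfolding bounded_iff by (intro exI[of _ "M * M"]) auto
      note cubic = uniform_lim_mult[OF uniform_lim_mult[OF u0 u1 b0 b1] u0 b01 b0]
      show ?thesis
        unfolding N_def
        by (intro bounded_linear.uniform_limit[OF bounded_linear_mult_right] uniform_limit_add cubic u2)
    qed
  qed
  have "classical_nls_solution \<kappa> (W 0)"
    unfolding classical_nls_solution_def
  proof (intro exI conjI allI)
    show "continuous_on UNIV (\<lambda>(t, x). N (W 0 t x) (W 2 t x))"
      using cont[of 0] cont[of 2] unfolding N_def case_prod_unfold by (intro continuous_intros) auto
    show "continuous_on UNIV (\<lambda>(t, x). W 1 t x)" "continuous_on UNIV (\<lambda>(t, x). W 2 t x)" by (rule cont; simp)+
    fix t x
    show "((\<lambda>s. W 0 s x) has_vector_derivative N (W 0 t x) (W 2 t x)) (at t)" by (rule Dt)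
    have "(vderiv j (W 0 t) has_vector_derivative vderiv (Suc j) (W 0 t) x) (at x)" if "j < 4" for j
      by (rule Ck_fun_has_vderiv[OF WCk that])
    from this[of 0] this[of 1]
    show "(W 0 t has_vector_derivative W 1 t x) (at x)" "(W 1 t has_vector_derivative W 2 t x) (at x)"
      by (simp_all add: Wv numeral_2_eq_2)
    show "\<i> * N (W 0 t x) (W 2 t x) = - (1 / 2) * W 2 t x + complex_of_real (\<kappa> * (norm (W 0 t x))\<^sup>2) * W 0 t x"
      by (simp only: N_eq)
  qed
  moreover have "bounded_on_strips (W 0)" by (rule bounded_on_stripsI[OF Wb]) simp
  moreover have "bounded_on_strips (\<lambda>t. vderiv (Suc 0) (W 0 t))"
    unfolding Wv[of "Suc 0", simplified] by (rule bounded_on_stripsI[OF Wb]) simp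
  moreover have "W 0 0 = p"
  proof
    fix x
    have "(\<lambda>n. q0 (x + y (r n))) \<longlonglongrightarrow> p x" using LIMSEQ_subseq_LIMSEQ[OF lim r] by (simp add: o_def)
    moreover have "(\<lambda>n. q0 (x + y (r n))) \<longlonglongrightarrow> W 0 0 x" using pt[of 0 0 x] by (simp add: flow_0[OF partition flow q0])
    ultimately show "W 0 0 x = p x" by (rule LIMSEQ_unique[rotated])
  qed
  ultimately have W: "W 0 s = \<Phi> s p" for s by (rule flow_unique[OF partition flow pS])
  show ?thesis
    by (rule that[OF r pS]) (use Wx Wv in \<open>simp add: W\<close>)
qed

end

section \<open>The flow as a homeomorphism of hulls\<close>

context
  fixes \<eta> :: "real \<Rightarrow> real" and \<kappa> :: real and \<Phi> :: "real \<Rightarrow> (real \<Rightarrow> complex) \<Rightarrow> real \<Rightarrow> complex"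
  assumes partition: "unit_partition \<eta>" and flow: "nls_flow \<eta> \<kappa> \<Phi>"
begin

text \<open>By contradiction: failing translations at ever finer neighbourhoods form a sequence to
  which \<open>flow_compactness\<close> applies, and some term of the subsequence lies in the
  forbidden neighbourhood. This argument needs translates of one solution, hence the restriction to
  them.\<close>

lemma flow_local_stability:
  assumes q0: "q0 \<in> mod_space \<eta> 5" and p: "p \<in> hull_loc q0" and e: "e > 0"
  shows "\<exists>R' e'. e' > 0 \<and> (\<forall>y. translate y q0 \<in> Ck_loc_nhd 4 p R' e' \<longrightarrow>
      translate y (\<Phi> t q0) \<in> Ck_loc_nhd 4 (\<Phi> t p) R e)"
proof (rule ccontr)
  assume "\<not> ?thesis"
  then have "\<forall>n. \<exists>y. translate y q0 \<in> Ck_loc_nhd 4 p (real (Suc n)) (inverse (real (Suc n))) \<and>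
      translate y (\<Phi> t q0) \<notin> Ck_loc_nhd 4 (\<Phi> t p) R e" by (metis inverse_positive_iff_positive of_nat_0_less_iff zero_less_Suc)
  then obtain y where y: "\<And>n. translate (y n) q0 \<in> Ck_loc_nhd 4 p (real (Suc n)) (inverse (real (Suc n)))"
      "\<And>n. translate (y n) (\<Phi> t q0) \<notin> Ck_loc_nhd 4 (\<Phi> t p) R e" by metis
  have lim: "(\<lambda>n. q0 (x + y n)) \<longlonglongrightarrow> p x" for x
    using Ck_loc_nhd_sequence_tendsto[OF y(1), of x] by (simp add: translate_def)
  obtain r where r: "strict_mono (r :: nat \<Rightarrow> nat)" "p \<in> mod_space \<eta> 5"
    "\<And>j R s. j \<le> 4 \<Longrightarrow> uniform_limit {-R..R} (\<lambda>n x. vderiv j (\<Phi> s q0) (x + y (r n))) (vderiv j (\<Phi> s p)) sequentially"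
    by (rule flow_compactness[OF partition flow q0 hull_loc_continuous[OF p] lim]) (rule that)
  have "\<forall>\<^sub>F n in sequentially. \<forall>j\<in>{..4}. \<forall>x\<in>{-R..R}. dist (vderiv j (\<Phi> t q0) (x + y (r n))) (vderiv j (\<Phi> t p) x) < e"
    using uniform_limitD[OF r(3) e] by (intro eventually_ball_finite) auto
  then obtain n where n: "\<forall>j\<in>{..4}. \<forall>x\<in>{-R..R}. dist (vderiv j (\<Phi> t q0) (x + y (r n))) (vderiv j (\<Phi> t p) x) < e"
    unfolding eventually_sequentially by blast
  have Ck4: "Ck_fun 4 (\<Phi> t q0)" by (rule Ck_fun_mono[OF flow_Ck[OF partition flow q0]]) simp
  have "translate (y (r n)) (\<Phi> t q0) \<in> Ck_loc_nhd 4 (\<Phi> t p) R e"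
    unfolding Ck_loc_nhd_def
    using n Ck_fun_translate[OF Ck4] by (simp add: dist_norm translate_def[of _ "vderiv _ _"])
  with y(2) show False by blast
qed

lemma hull_mod_space:
  assumes q0: "q0 \<in> mod_space \<eta> 5" and p: "p \<in> hull_loc q0"
  shows "p \<in> mod_space \<eta> 5"
proof -
  obtain y where "\<And>n. translate (y n) q0 \<in> Ck_loc_nhd 4 p (real (Suc n)) (inverse (real (Suc n)))"
    by (rule hull_loc_sequence[OF p]) (rule that)
  from Ck_loc_nhd_sequence_tendsto[OF this] have "(\<lambda>n. q0 (x + y n)) \<longlonglongrightarrow> p x" for x
    by (simp add: translate_def)
  then show ?thesis by (rule mod_space_translation_limit[OF partition q0 hull_loc_continuous[OF p]])
qed

text \<open>A bound for the single solution started at \<open>q0\<close> survives translation and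
  limits, so the same \<open>M\<close> serves the entire hull.\<close>

lemma hull_flow_bounded:
  assumes q0: "q0 \<in> mod_space \<eta> 5"
  obtains M where "M \<ge> 0"
    "\<And>p s j x. p \<in> hull_loc q0 \<Longrightarrow> \<bar>s\<bar> \<le> T \<Longrightarrow> j \<le> 4 \<Longrightarrow> norm (vderiv j (\<Phi> s p) x) \<le> M"
proof -
  obtain M where M: "M \<ge> 0" "\<And>s j x. \<bar>s\<bar> \<le> T \<Longrightarrow> j \<le> 5 \<Longrightarrow> norm (vderiv j (\<Phi> s q0) x) \<le> M"
    by (rule flow_bounded[OF partition flow q0, of T]) (rule that)
  have "norm (vderiv j (\<Phi> s p) x) \<le> M" if p: "p \<in> hull_loc q0" and s: "\<bar>s\<bar> \<le> T" and j: "j \<le> 4" for p s j x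
  proof -
    obtain y where "\<And>n. translate (y n) q0 \<in> Ck_loc_nhd 4 p (real (Suc n)) (inverse (real (Suc n)))"
      by (rule hull_loc_sequence[OF p]) (rule that)
    from Ck_loc_nhd_sequence_tendsto[OF this] have lim: "(\<lambda>n. q0 (x + y n)) \<longlonglongrightarrow> p x" for x
      by (simp add: translate_def)
    obtain r where r: "strict_mono (r :: nat \<Rightarrow> nat)" "p \<in> mod_space \<eta> 5"
      "\<And>j R s. j \<le> 4 \<Longrightarrow> uniform_limit {-R..R} (\<lambda>n x. vderiv j (\<Phi> s q0) (x + y (r n))) (vderiv j (\<Phi> s p)) sequentially"
      by (rule flow_compactness[OF partition flow q0 hull_loc_continuous[OF p] lim]) (rule that)
    have "(\<lambda>n. vderiv j (\<Phi> s q0) (x + y (r n))) \<longlonglongrightarrow> vderiv j (\<Phi> s p) x"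
      by (rule tendsto_uniform_limitI[OF r(3)[OF j, where R = "\<bar>x\<bar>"]]) auto
    from LIMSEQ_le_const2[OF tendsto_norm[OF this]] show ?thesis using M(2)[OF s, of j] j by auto
  qed
  with M(1) show ?thesis by (rule that)
qed

lemma flow_hull:
  assumes q0: "q0 \<in> mod_space \<eta> 5" and p: "p \<in> hull_loc q0"
  shows "\<Phi> t p \<in> hull_loc (\<Phi> t q0)"
  unfolding hull_loc_iff
proof (intro conjI allI impI)
  show "Ck_fun 4 (\<Phi> t p)"
    by (rule Ck_fun_mono[OF flow_Ck[OF partition flow hull_mod_space[OF q0 p]]]) simp
  fix R and e :: real assume "e > 0"
  from flow_local_stability[OF q0 p this] obtain R' e' where e': "e' > 0"
      "\<forall>y. translate y q0 \<in> Ck_loc_nhd 4 p R' e' \<longrightarrow> translate y (\<Phi> t q0) \<in> Ck_loc_nhd 4 (\<Phi> t p) R e"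
    by blast
  with p show "\<exists>y. translate y (\<Phi> t q0) \<in> Ck_loc_nhd 4 (\<Phi> t p) R e" unfolding hull_loc_iff by blast
qed

text \<open>Two points of the hull are compared through a translate of \<open>q0\<close> close to
  both, since stability is known along translates only.\<close>

lemma flow_continuous_map:
  assumes q0: "q0 \<in> mod_space \<eta> 5"
  shows "continuous_map (hull_top q0) (hull_top (\<Phi> t q0)) (\<Phi> t)"
proof (rule continuous_map_hullI)
  fix p R and e :: real assume p: "p \<in> hull_loc q0" and e: "e > 0"
  from e have e2: "e / 2 > 0" by simp
  obtain R' e' where e': "e' > 0" "\<And>y. translate y q0 \<in> Ck_loc_nhd 4 p R' e' \<Longrightarrow>
      translate y (\<Phi> t q0) \<in> Ck_loc_nhd 4 (\<Phi> t p) R (e / 2)"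
    using flow_local_stability[OF q0 p e2] by blast
  have "\<Phi> t p' \<in> Ck_loc_nhd 4 (\<Phi> t p) R e" if p': "p' \<in> hull_loc q0" "p' \<in> Ck_loc_nhd 4 p R' (e' / 2)" for p'
  proof -
    obtain R'' e'' where e'': "e'' > 0" "\<And>y. translate y q0 \<in> Ck_loc_nhd 4 p' R'' e'' \<Longrightarrow>
        translate y (\<Phi> t q0) \<in> Ck_loc_nhd 4 (\<Phi> t p') R (e / 2)"
      using flow_local_stability[OF q0 p'(1) e2] by blast
    have "min (e' / 2) e'' > 0" using e'(1) e''(1) by simp
    \<comment> \<open>The translate is close to \<open>p'\<close> at the scales of both stability
      statements; being within \<open>e' / 2\<close> of \<open>p'\<close>, it is within
      \<open>e'\<close> of \<open>p\<close>.\<close>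
    then obtain y where y: "translate y q0 \<in> Ck_loc_nhd 4 p' (max R' R'') (min (e' / 2) e'')"
      using p'(1) unfolding hull_loc_iff by blast
    have y1: "translate y q0 \<in> Ck_loc_nhd 4 p' R' (e' / 2)" "translate y q0 \<in> Ck_loc_nhd 4 p' R'' e''"
      by (rule subsetD[OF Ck_loc_nhd_mono y];
          simp only: max.cobounded1 max.cobounded2 min.cobounded1 min.cobounded2)+
    have add: "h \<in> Ck_loc_nhd 4 f r d"
      if "h \<in> Ck_loc_nhd 4 g r (d / 2)" "\<And>j x. j \<le> 4 \<Longrightarrow> x \<in> {-r..r} \<Longrightarrow> norm (vderiv j g x - vderiv j f x) < d / 2"
      for f g h :: "real \<Rightarrow> complex" and r d
    proof -
      have "norm (vderiv j h x - vderiv j f x) < d" if "j \<le> 4" "x \<in> {-r..r}" for j x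
      proof -
        have "norm (vderiv j h x - vderiv j g x) < d / 2"
          using \<open>h \<in> Ck_loc_nhd 4 g r (d / 2)\<close> that unfolding Ck_loc_nhd_def by blast
        with \<open>\<And>j x. j \<le> 4 \<Longrightarrow> x \<in> {-r..r} \<Longrightarrow> norm (vderiv j g x - vderiv j f x) < d / 2\<close>[OF that]
        show ?thesis
          using norm_triangle_ineq[of "vderiv j h x - vderiv j g x" "vderiv j g x - vderiv j f x"] by simp
      qed
      with that(1) show ?thesis unfolding Ck_loc_nhd_def by blast
    qed
    have "translate y q0 \<in> Ck_loc_nhd 4 p R' e'"
      by (rule add[OF y1(1)]) (use p'(2) in \<open>auto simp: Ck_loc_nhd_def\<close>)
    then have a: "translate y (\<Phi> t q0) \<in> Ck_loc_nhd 4 (\<Phi> t p) R (e / 2)" by (rule e'(2))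
    have b: "translate y (\<Phi> t q0) \<in> Ck_loc_nhd 4 (\<Phi> t p') R (e / 2)" by (rule e''(2)[OF y1(2)])
    have Ck: "Ck_fun 4 (\<Phi> t p')" by (rule hull_loc_Ck[OF flow_hull[OF q0 p'(1)]])
    have "\<Phi> t p' \<in> Ck_loc_nhd 4 (translate y (\<Phi> t q0)) R (e / 2)"
      using b Ck unfolding Ck_loc_nhd_def by (simp add: norm_minus_commute)
    then show ?thesis by (rule add) (use a in \<open>auto simp: Ck_loc_nhd_def\<close>)
  qed
  then show "\<exists>R' e'. e' > 0 \<and> (\<forall>p'\<in>hull_loc q0. p' \<in> Ck_loc_nhd 4 p R' e' \<longrightarrow>
      \<Phi> t p' \<in> Ck_loc_nhd 4 (\<Phi> t p) R e)"
    using e'(1) by (intro exI[of _ R'] exI[of _ "e' / 2"]) auto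
qed (rule flow_hull[OF q0])

lemma flow_homeomorphic_map:
  assumes q0: "q0 \<in> mod_space \<eta> 5"
  shows "homeomorphic_map (hull_top q0) (hull_top (\<Phi> t q0)) (\<Phi> t)"
proof -
  have inv: "\<Phi> (- s) (\<Phi> s p) = p" if "p \<in> mod_space \<eta> 5" for s p
    using flow_add[OF partition flow that, of "- s" s] flow_0[OF partition flow that] by simp
  have qt: "\<Phi> t q0 \<in> mod_space \<eta> 5" by (rule flow_mod_space[OF partition flow q0])
  have "homeomorphic_maps (hull_top q0) (hull_top (\<Phi> t q0)) (\<Phi> t) (\<Phi> (- t))"
    unfolding homeomorphic_maps_def topspace_hull_top
  proof (intro conjI ballI)
    show "continuous_map (hull_top q0) (hull_top (\<Phi> t q0)) (\<Phi> t)" by (rule flow_continuous_map[OF q0])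
    show "continuous_map (hull_top (\<Phi> t q0)) (hull_top q0) (\<Phi> (- t))"
      using flow_continuous_map[OF qt, of "- t"] by (simp add: inv[OF q0])
    show "\<Phi> (- t) (\<Phi> t p) = p" if "p \<in> hull_loc q0" for p by (rule inv[OF hull_mod_space[OF q0 that]])
    show "\<Phi> t (\<Phi> (- t) p) = p" if "p \<in> hull_loc (\<Phi> t q0)" for p
      using inv[OF hull_mod_space[OF qt that], of "- t"] by simp
  qed
  then show ?thesis unfolding homeomorphic_map_maps by blast
qed

end

section \<open>Lyapunov exponents\<close>

text \<open>Fekete's argument with \<open>x = k m + r\<close> and \<open>0 \<le> r \<le> m\<close>.
  In continuous time the remainder \<open>r\<close> ranges over an interval; the linear bound
  controls \<open>a r\<close> there.\<close>

lemma fekete_continuous_time: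
  fixes a :: "real \<Rightarrow> real"
  assumes sub: "\<And>x y. x \<ge> 0 \<Longrightarrow> y \<ge> 0 \<Longrightarrow> a (x + y) \<le> a x + a y"
    and bound: "\<And>x. x \<ge> 0 \<Longrightarrow> \<bar>a x\<bar> \<le> c + d * x" and "c \<ge> 0" "d \<ge> 0"
  shows "\<exists>l. ((\<lambda>x. (1 / x) * a x) \<longlongrightarrow> l) at_top"
proof -
  let ?g = "\<lambda>x. (1 / x) * a x"
  \<comment> \<open>Restricting to \<open>x \<ge> 1\<close> keeps the infimum finite: near 0 the
    bound \<open>c / x\<close> blows up.\<close>
  define l where "l = (INF x\<in>{1..}. ?g x)"
  have lower: "- (c + d) \<le> ?g x" if "x \<ge> 1" for x
  proof -
    have "- (c + d) * x \<le> - (c + d * x)" using that \<open>c \<ge> 0\<close> by (simp add: algebra_simps mult_right_le_one_le mult_le_cancel_left1)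
    also have "\<dots> \<le> a x" using bound[of x] that by (simp add: abs_le_iff)
    finally show ?thesis using that by (simp add: pos_le_divide_eq)
  qed
  have bdd: "bdd_below (?g ` {1..})" by (rule bdd_belowI2[where m = "- (c + d)"]) (use lower in auto)
  have l_le: "l \<le> ?g x" if "x \<ge> 1" for x
    unfolding l_def by (rule cINF_lower[OF bdd]) (use that in simp)
  have mult: "a (real k * m + r) \<le> real k * a m + a r" if "m \<ge> 0" "r \<ge> 0" for k m r
  proof (induction k)
    case (Suc k)
    have "a (real (Suc k) * m + r) = a (m + (real k * m + r))" by (simp add: algebra_simps)
    also have "\<dots> \<le> a m + a (real k * m + r)" using that by (intro sub) auto
    finally show ?case using Suc by (simp add: algebra_simps)
  qed simp
  have "(?g \<longlongrightarrow> l) at_top"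
  proof (rule order_tendstoI)
    fix b assume b: "b < l"
    from eventually_ge_at_top[of "1::real"] show "\<forall>\<^sub>F x in at_top. b < ?g x"
    proof eventually_elim
      case (elim x)
      from less_le_trans[OF b l_le[OF this]] show ?case .
    qed
  next
    fix b assume "l < b"
    then obtain m where m: "m \<ge> 1" "?g m < b"
      unfolding l_def by (subst (asm) cINF_less_iff[OF _ bdd]) auto
    \<comment> \<open>Collects the loss from replacing \<open>real k * m\<close> by
      \<open>x\<close>, at most \<open>\<bar>a m\<bar>\<close>, and the bound
      \<open>c + d * m\<close> for \<open>a r\<close>.\<close>
    define K where "K = \<bar>a m\<bar> + c + d * m"
    have "((\<lambda>x. ?g m + K / x) \<longlongrightarrow> ?g m + 0) at_top"
      by (intro tendsto_add tendsto_const tendsto_divide_0[OF tendsto_const] filterlim_at_top_imp_at_infinity filterlim_ident)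
    then have "\<forall>\<^sub>F x in at_top. ?g m + K / x < b" using m(2) by (intro order_tendstoD(2)) auto
    then show "\<forall>\<^sub>F x in at_top. ?g x < b"
      using eventually_ge_at_top[of m]
    proof eventually_elim
      case (elim x)
      define k where "k = nat \<lfloor>x / m\<rfloor>"
      define r where "r = x - real k * m"
      have "x / m \<ge> 0" using elim m(1) by simp
      then have "real k \<le> x / m" "x / m < real k + 1" unfolding k_def by linarith+
      then have r: "0 \<le> r" "r \<le> m" using m(1) by (auto simp: r_def field_simps)
      have x0: "x > 0" using elim m(1) by simp
      have "a x \<le> real k * a m + a r" using mult[of m r k] r m(1) by (simp add: r_def)
      also have "real k * a m = x * ?g m - r * ?g m"
        using m(1) by (simp add: r_def field_simps)
      also have "- (r * ?g m) \<le> \<bar>a m\<bar>"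
      proof -
        have "- (r * ?g m) \<le> (r / m) * \<bar>a m\<bar>"
          using r m(1) by (simp add: abs_if divide_right_mono mult_left_mono)
        also have "\<dots> \<le> 1 * \<bar>a m\<bar>" using r m(1) by (intro mult_right_mono) auto
        finally show ?thesis by simp
      qed
      then have "x * ?g m - r * ?g m + a r \<le> x * ?g m + \<bar>a m\<bar> + a r" by simp
      also have "a r \<le> c + d * m"
        using bound[OF r(1)] mult_left_mono[OF r(2) \<open>d \<ge> 0\<close>] by (simp add: abs_le_iff)
      finally have "a x \<le> x * ?g m + K" by (simp add: K_def)
      then have "?g x \<le> ?g m + K / x" using x0 by (simp add: field_simps)
      with elim show ?case by linarith
    qed
  qed
  then show ?thesis by blast
qed

section \<open>Measurability of the logarithm and existence of the mean exponent\<close>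

lemma space_borel_top: "space (borel_top X) = topspace X"
  unfolding borel_top_def by (intro space_measure_of) (auto dest: openin_subset)

lemma sets_borel_top: "sets (borel_top X) = sigma_sets (topspace X) {U. openin X U}"
  unfolding borel_top_def by (intro sets_measure_of) (auto dest: openin_subset)

lemma continuous_map_borel_measurable:
  assumes "continuous_map X Y f"
  shows "f \<in> borel_top X \<rightarrow>\<^sub>M borel_top Y"
  unfolding borel_top_def[of Y]
proof (rule measurable_measure_of)
  show "{U. openin Y U} \<subseteq> Pow (topspace Y)" by (auto dest: openin_subset)
  show "f \<in> space (borel_top X) \<rightarrow> topspace Y"
    using continuous_map_funspace[OF assms] by (simp add: space_borel_top)
  fix U assume "U \<in> {U. openin Y U}"
  then have "openin X {x \<in> topspace X. f x \<in> U}" using assms by (simp add: continuous_map_def)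
  moreover have "f -` U \<inter> space (borel_top X) = {x \<in> topspace X. f x \<in> U}" by (auto simp: space_borel_top)
  ultimately show "f -` U \<inter> space (borel_top X) \<in> sets (borel_top X)"
    by (auto simp: sets_borel_top intro: sigma_sets.Basic)
qed

lemma op_norm_diff_le: "\<bar>op_norm A - op_norm B\<bar> \<le> 4 * norm (A - B)"
  using op_norm_triangle[of "A - B" B] op_norm_triangle[of "B - A" A] op_norm_le_norm[of "A - B"]
    op_norm_le_norm[of "B - A"] norm_minus_commute[of A B]
  by simp

text \<open>Preimages of open sets are open in the hull: closeness on \<open>{-L..L}\<close>
  controls the transfer matrix by \<open>transfer_diff_bound\<close>, and \<open>ln\<close> is
  continuous at positive numbers. The common bound \<open>M\<close> makes the Lipschitz constant the
  same for all nearby potentials.\<close>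

lemma ln_op_norm_transfer_measurable:
  assumes \<kappa>: "\<kappa> \<in> {1, -1}" and L: "L \<ge> 0" and bound: "\<forall>p\<in>hull_loc f. \<forall>x. norm (p x) \<le> M"
  shows "(\<lambda>p. ln (op_norm (transfer \<kappa> p L 0 z))) \<in> borel_measurable (borel_top (hull_top f))"
proof (rule borel_measurableI)
  have M: "norm (p x) \<le> M" if "p \<in> hull_loc f" for p x using bound that by blast
  fix S :: "real set" assume S: "open S"
  let ?g = "\<lambda>p. ln (op_norm (transfer \<kappa> p L 0 z))"
  have "openin (hull_top f) {p \<in> hull_loc f. ?g p \<in> S}"
  proof (rule openin_hull_topI)
    fix p assume "p \<in> {p \<in> hull_loc f. ?g p \<in> S}"
    then have p: "p \<in> hull_loc f" "?g p \<in> S" by auto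
    let ?N = "op_norm (transfer \<kappa> p L 0 z)"
    have pos: "?N > 0" by (rule op_norm_transfer_bounds(1)[OF \<kappa> hull_loc_continuous[OF p(1)] L M[OF p(1)]])
    have "isCont ln ?N" using pos by (intro isCont_ln) auto
    then have "\<forall>\<^sub>F b in nhds ?N. ln b \<in> S"
      using S p(2) by (intro topological_tendstoD[of ln "ln ?N"]) (auto simp: isCont_def tendsto_at_iff_tendsto_nhds)
    then obtain d where d: "d > 0" "\<And>b. dist b ?N < d \<Longrightarrow> ln b \<in> S"
      unfolding eventually_nhds_metric by blast
    define C where "C = 8192 * exp (16 * (norm z + M) * L) ^ 3 * L"
    have C: "C \<ge> 0" using L by (simp add: C_def)
    \<comment> \<open>The 4 converts \<open>norm\<close> into \<open>op_norm\<close>; the added 1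
      covers \<open>C = 0\<close> and makes the final inequality strict.\<close>
    define e where "e = d / (4 * C + 1)"
    have e: "e > 0" using d(1) C by (simp add: e_def)
    have "?g p' \<in> S" if p': "p' \<in> hull_loc f" "p' \<in> Ck_loc_nhd 4 p L e" for p'
    proof -
      have "norm (p' x - p x) \<le> e" if "x \<in> {0..L}" for x
      proof -
        have "x \<in> {-L..L}" using that by auto
        with p'(2) have "norm (vderiv 0 p' x - vderiv 0 p x) < e" unfolding Ck_loc_nhd_def by blast
        then show ?thesis by simp
      qed
      then have "norm (transfer \<kappa> p' L 0 z - transfer \<kappa> p L 0 z) \<le> C * e"
        unfolding C_def
        by (intro transfer_diff_bound[OF \<kappa> hull_loc_continuous[OF p(1)] hull_loc_continuous[OF p'(1)] L M[OF p(1)] M[OF p'(1)]])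
          (use L in auto)
      then have "\<bar>op_norm (transfer \<kappa> p' L 0 z) - ?N\<bar> \<le> 4 * (C * e)"
        using op_norm_diff_le[of "transfer \<kappa> p' L 0 z" "transfer \<kappa> p L 0 z"] by linarith
      also have "\<dots> < (4 * C + 1) * e" using e by (simp add: algebra_simps)
      also have "\<dots> = d" using C by (simp add: e_def)
      finally show ?thesis by (intro d(2)) (simp add: dist_real_def)
    qed
    then show "\<exists>R e. e > 0 \<and> hull_loc f \<inter> Ck_loc_nhd 4 p R e \<subseteq> {p \<in> hull_loc f. ?g p \<in> S}"
      using e by blast
  qed auto
  then have "{p \<in> hull_loc f. ?g p \<in> S} \<in> sets (borel_top (hull_top f))"
    by (auto simp: sets_borel_top intro: sigma_sets.Basic)
  moreover have "?g -` S \<inter> space (borel_top (hull_top f)) = {p \<in> hull_loc f. ?g p \<in> S}"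
    by (auto simp: space_borel_top topspace_hull_top)
  ultimately show "?g -` S \<inter> space (borel_top (hull_top f)) \<in> sets (borel_top (hull_top f))" by simp
qed

lemma invariant_mean_log:
  assumes \<kappa>: "\<kappa> \<in> {1, -1}" and \<mu>: "invariant_prob f \<mu>"
    and hull_bound: "\<forall>p\<in>hull_loc f. \<forall>x. norm (p x) \<le> M" and M0: "M \<ge> 0"
  shows "\<And>L. L \<ge> 0 \<Longrightarrow> integrable \<mu> (\<lambda>p. ln (op_norm (transfer \<kappa> p L 0 z)))"
    and "\<exists>l. (mean_log \<kappa> \<mu> z \<longlongrightarrow> l) at_top"
proof -
  have M: "norm (p x) \<le> M" if "p \<in> hull_loc f" for p x using hull_bound that by blast
  interpret prob_space \<mu> using \<mu> by (simp add: invariant_prob_def)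
  have sets: "sets \<mu> = sets (borel_top (hull_top f))" and inv: "distr \<mu> \<mu> (translate y) = \<mu>" for y
    using \<mu> by (auto simp: invariant_prob_def)
  have space: "space \<mu> = hull_loc f"
    using sets_eq_imp_space_eq[OF sets] by (simp add: space_borel_top topspace_hull_top)
  let ?g = "\<lambda>L p. ln (op_norm (transfer \<kappa> p L 0 z))"
  define a where "a L = (LINT p|\<mu>. ?g L p)" for L
  have meas: "?g L \<in> borel_measurable \<mu>" if "L \<ge> 0" for L
    using ln_op_norm_transfer_measurable[OF \<kappa> that hull_bound, of z] measurable_cong_sets[OF sets refl] by blast
  have bound: "\<bar>?g L p\<bar> \<le> ln 64 + 16 * (norm z + M) * L" if "L \<ge> 0" "p \<in> hull_loc f" for L p
    by (rule op_norm_transfer_bounds(2)[OF \<kappa> hull_loc_continuous[OF that(2)] that(1) M[OF that(2)]])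
  show int: "integrable \<mu> (?g L)" if "L \<ge> 0" for L
    by (rule integrable_const_bound[where B = "ln 64 + 16 * (norm z + M) * L"])
      (use bound[OF that] meas[OF that] in \<open>auto simp: space\<close>)
  have trans: "translate y \<in> \<mu> \<rightarrow>\<^sub>M \<mu>" for y
    using continuous_map_borel_measurable[OF continuous_map_translate[of f y]] measurable_cong_sets[OF sets sets] by blast
  \<comment> \<open>The cocycle puts the translate by \<open>y\<close> into the factor of length
    \<open>x\<close>, and invariance of the measure removes it under the integral.\<close>
  have sub: "a (x + y) \<le> a x + a y" if x: "x \<ge> 0" and y: "y \<ge> 0" for x y
  proof -
    have shift: "(LINT p|\<mu>. ?g x (translate y p)) = a x" "integrable \<mu> (\<lambda>p. ?g x (translate y p))"
    proof -
      have "a x = (LINT p|distr \<mu> \<mu> (translate y). ?g x p)" by (simp add: inv a_def)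
      also have "\<dots> = (LINT p|\<mu>. ?g x (translate y p))" by (rule integral_distr[OF trans meas[OF x]])
      finally show "(LINT p|\<mu>. ?g x (translate y p)) = a x" by simp
      have "integrable (distr \<mu> \<mu> (translate y)) (?g x)" using int[OF x] by (simp add: inv)
      then show "integrable \<mu> (\<lambda>p. ?g x (translate y p))" by (simp add: integrable_distr_eq[OF trans meas[OF x]])
    qed
    have "a (x + y) \<le> (LINT p|\<mu>. ?g x (translate y p) + ?g y p)"
      unfolding a_def
    proof (rule integral_mono)
      fix p assume "p \<in> space \<mu>"
      then have p: "p \<in> hull_loc f" by (simp add: space)
      have tp: "translate y p \<in> hull_loc f" by (rule hull_loc_translate[OF p])
      have pos: "0 < op_norm (transfer \<kappa> q L 0 z)" if "q \<in> hull_loc f" "L \<ge> 0" for q L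
        by (rule op_norm_transfer_bounds(1)[OF \<kappa> hull_loc_continuous[OF that(1)] that(2) M[OF that(1)]])
      have "op_norm (transfer \<kappa> p (x + y) 0 z)
          \<le> op_norm (transfer \<kappa> (translate y p) x 0 z) * op_norm (transfer \<kappa> p y 0 z)"
        unfolding transfer_cocycle[OF hull_loc_continuous[OF p], of \<kappa> x y z] by (rule op_norm_mult_le)
      then have "?g (x + y) p \<le> ln (op_norm (transfer \<kappa> (translate y p) x 0 z) * op_norm (transfer \<kappa> p y 0 z))"
        using pos[OF p, of "x + y"] x y by (intro ln_mono) auto
      also have "\<dots> = ?g x (translate y p) + ?g y p"
        using pos[OF tp x] pos[OF p y] by (simp add: ln_mult)
      finally show "?g (x + y) p \<le> ?g x (translate y p) + ?g y p" .
    qed (use int shift(2) x y in auto)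
    also have "\<dots> = a x + a y" using shift int[OF y] by (simp add: a_def)
    finally show ?thesis .
  qed
  have "\<bar>a x\<bar> \<le> ln 64 + 16 * (norm z + M) * x" if "x \<ge> 0" for x
  proof -
    have "\<bar>a x\<bar> \<le> (LINT p|\<mu>. \<bar>?g x p\<bar>)" unfolding a_def by (rule integral_abs_bound)
    also have "\<dots> \<le> (LINT p|\<mu>. ln 64 + 16 * (norm z + M) * x)"
      using int[OF that] bound[OF that] by (intro integral_mono) (auto simp: space)
    finally show ?thesis by (simp add: prob_space)
  qed
  then have "\<exists>l. ((\<lambda>x. (1 / x) * a x) \<longlongrightarrow> l) at_top"
    using M0 by (intro fekete_continuous_time[OF sub, where c = "ln 64" and d = "16 * (norm z + M)"]) auto
  then show "\<exists>l. (mean_log \<kappa> \<mu> z \<longlongrightarrow> l) at_top"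
    by (simp add: mean_log_def[abs_def] a_def)
qed

theorem corollary50:
  fixes \<eta> :: "real \<Rightarrow> real" and \<kappa> t :: real
    and \<Phi> :: "real \<Rightarrow> (real \<Rightarrow> complex) \<Rightarrow> real \<Rightarrow> complex"
    and q0 :: "real \<Rightarrow> complex"
    and \<mu> \<mu>t :: "(real \<Rightarrow> complex) measure"
  assumes "unit_partition \<eta>"
    and "\<kappa> \<in> {1, -1}"
    and "nls_flow \<eta> \<kappa> \<Phi>"
    and "q0 \<in> mod_space \<eta> 5"
    and "invariant_prob q0 \<mu>"
    and "\<mu>t = distr \<mu> (borel_top (hull_top (\<Phi> t q0))) (\<Phi> t)"
  shows "homeomorphic_map (hull_top q0) (hull_top (\<Phi> t q0)) (\<Phi> t) \<and>
    (\<forall>y. \<forall>p\<in>hull_loc q0. \<Phi> t (translate y p) = translate y (\<Phi> t p)) \<and>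
    (\<forall>z. lyapunov_exists \<kappa> \<mu> z \<and> lyapunov_exists \<kappa> \<mu>t z \<and>
         lyapunov \<kappa> \<mu>t z = lyapunov \<kappa> \<mu> z)"
proof (intro conjI allI ballI)
  note partition = assms(1) and \<kappa> = assms(2) and flow = assms(3) and q0 = assms(4) and \<mu> = assms(5)
  show "homeomorphic_map (hull_top q0) (hull_top (\<Phi> t q0)) (\<Phi> t)"
    by (rule flow_homeomorphic_map[OF partition flow q0])
  show "\<Phi> t (translate y p) = translate y (\<Phi> t p)" if "p \<in> hull_loc q0" for y p
    by (rule flow_translate[OF partition flow hull_mod_space[OF partition flow q0 that]])
  obtain M where M: "M \<ge> 0"
    "\<And>p s j x. p \<in> hull_loc q0 \<Longrightarrow> \<bar>s\<bar> \<le> \<bar>t\<bar> \<Longrightarrow> j \<le> 4 \<Longrightarrow> norm (vderiv j (\<Phi> s p) x) \<le> M"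
    by (rule hull_flow_bounded[OF partition flow q0, of "\<bar>t\<bar>"]) (rule that)
  have id: "\<Phi> 0 p = p" if "p \<in> hull_loc q0" for p
    by (rule flow_0[OF partition flow hull_mod_space[OF partition flow q0 that]])
  have pM: "\<forall>p\<in>hull_loc q0. \<forall>x. norm (p x) \<le> M"
  proof (intro ballI allI)
    fix p x assume p: "p \<in> hull_loc q0"
    show "norm (p x) \<le> M" using M(2)[OF p, of 0 0 x] by (simp add: id[OF p])
  qed
  have qt: "\<Phi> t q0 \<in> mod_space \<eta> 5" by (rule flow_mod_space[OF partition flow q0])
  \<comment> \<open>A bound for the potentials of the target hull, needed for measurability there;
    time 0 is enough because the flow is then the identity.\<close>
  obtain Mt where Mt: "Mt \<ge> 0"
    "\<And>p s j x. p \<in> hull_loc (\<Phi> t q0) \<Longrightarrow> \<bar>s\<bar> \<le> 0 \<Longrightarrow> j \<le> 4 \<Longrightarrow> norm (vderiv j (\<Phi> s p) x) \<le> Mt"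
    by (rule hull_flow_bounded[OF partition flow qt, of 0]) (rule that)
  have ptM: "\<forall>p\<in>hull_loc (\<Phi> t q0). \<forall>x. norm (p x) \<le> Mt"
  proof (intro ballI allI)
    fix p x assume p: "p \<in> hull_loc (\<Phi> t q0)"
    show "norm (p x) \<le> Mt"
      using Mt(2)[OF p, of 0 0 x] by (simp add: flow_0[OF partition flow hull_mod_space[OF partition flow qt p]])
  qed
  interpret prob_space \<mu> using \<mu> by (simp add: invariant_prob_def)
  have sets: "sets \<mu> = sets (borel_top (hull_top q0))" using \<mu> by (simp add: invariant_prob_def)
  have space: "space \<mu> = hull_loc q0"
    using sets_eq_imp_space_eq[OF sets] by (simp add: space_borel_top topspace_hull_top)
  have F: "\<Phi> t \<in> \<mu> \<rightarrow>\<^sub>M borel_top (hull_top (\<Phi> t q0))"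
    using continuous_map_borel_measurable[OF flow_continuous_map[OF partition flow q0, of t]]
      measurable_cong_sets[OF sets refl] by blast
  fix z
  let ?g = "\<lambda>L p. ln (op_norm (transfer \<kappa> p L 0 z))"
  define C where "C = ln 16 + 16 * (2 * (norm z)\<^sup>2 + M\<^sup>2 + 2 * norm z * M + M) * \<bar>t\<bar>"
  have close: "\<bar>?g L (\<Phi> t p) - ?g L p\<bar> \<le> C" if p: "p \<in> hull_loc q0" and L: "L \<ge> 0" for p L
  proof -
    have "\<bar>?g L (\<Phi> t p) - ?g L (\<Phi> 0 p)\<bar> \<le> C"
      unfolding C_def
    proof (rule ln_op_norm_transfer_nls[OF \<kappa> flow_classical[OF partition flow hull_mod_space[OF partition flow q0 p]] L])
      show "norm (\<Phi> s p x) \<le> M" "norm (vderiv (Suc 0) (\<Phi> s p) x) \<le> M" if "\<bar>s\<bar> \<le> \<bar>t\<bar>" for s x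
        using M(2)[OF p that, of 0] M(2)[OF p that, of "Suc 0"] by simp_all
    qed
    then show ?thesis by (simp add: id[OF p])
  qed
  note int = invariant_mean_log(1)[OF \<kappa> \<mu> pM M(1), where z = z]
  have meas_t: "?g L \<in> borel_measurable (borel_top (hull_top (\<Phi> t q0)))" if "L \<ge> 0" for L
    by (rule ln_op_norm_transfer_measurable[OF \<kappa> that ptM])
  \<comment> \<open>All statements about \<open>\<mu>t\<close> are pulled back to
    \<open>\<mu>\<close>. Integrability follows from the bound \<open>C\<close> on the change of the
    logarithm, so invariance of \<open>\<mu>t\<close> does not enter.\<close>
  have int_t: "integrable \<mu> (\<lambda>p. ?g L (\<Phi> t p))" if L: "L \<ge> 0" for L
  proof (rule Bochner_Integration.integrable_bound[where f = "\<lambda>p. \<bar>?g L p\<bar> + C"])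
    show "(\<lambda>p. ?g L (\<Phi> t p)) \<in> borel_measurable \<mu>"
      using measurable_compose[OF F meas_t[OF L]] .
    show "AE p in \<mu>. norm (?g L (\<Phi> t p)) \<le> norm (\<bar>?g L p\<bar> + C)"
      using close[OF _ L] by (intro AE_I2) (fastforce simp: space)
  qed (use int[OF L] in auto)
  obtain l where l: "(mean_log \<kappa> \<mu> z \<longlongrightarrow> l) at_top" using invariant_mean_log(2)[OF \<kappa> \<mu> pM M(1)] by blast
  \<comment> \<open>Comparison with \<open>mean_log \<kappa> \<mu> z\<close> yields both the
    existence of the limit for \<open>\<mu>t\<close> and its value.\<close>
  have "((\<lambda>L. mean_log \<kappa> \<mu>t z L - mean_log \<kappa> \<mu> z L) \<longlongrightarrow> 0) at_top"
  proof (rule Lim_null_comparison)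
    show "((\<lambda>L. C / L) \<longlongrightarrow> 0) at_top"
      by (intro tendsto_divide_0[OF tendsto_const] filterlim_at_top_imp_at_infinity filterlim_ident)
    show "\<forall>\<^sub>F L in at_top. norm (mean_log \<kappa> \<mu>t z L - mean_log \<kappa> \<mu> z L) \<le> C / L"
      using eventually_gt_at_top[of 0]
    proof eventually_elim
      case (elim L)
      then have L: "L \<ge> 0" by simp
      have "(LINT p|\<mu>t. ?g L p) = (LINT p|\<mu>. ?g L (\<Phi> t p))"
        unfolding assms(6) by (rule integral_distr[OF F meas_t[OF L]])
      then have "mean_log \<kappa> \<mu>t z L - mean_log \<kappa> \<mu> z L = (LINT p|\<mu>. ?g L (\<Phi> t p) - ?g L p) / L"
        using int[OF L] int_t[OF L] by (simp add: mean_log_def diff_divide_distrib)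
      moreover have "\<bar>LINT p|\<mu>. ?g L (\<Phi> t p) - ?g L p\<bar> \<le> C"
      proof -
        have "\<bar>LINT p|\<mu>. ?g L (\<Phi> t p) - ?g L p\<bar> \<le> (LINT p|\<mu>. \<bar>?g L (\<Phi> t p) - ?g L p\<bar>)"
          by (rule integral_abs_bound)
        also have "\<dots> \<le> (LINT p|\<mu>. C)"
          using int[OF L] int_t[OF L] close[OF _ L] by (intro integral_mono) (auto simp: space)
        finally show ?thesis by (simp add: prob_space)
      qed
      ultimately show ?case using elim by (simp add: divide_right_mono)
    qed
  qed
  from tendsto_add[OF this l] have lt: "(mean_log \<kappa> \<mu>t z \<longlongrightarrow> l) at_top" by simp
  show "lyapunov_exists \<kappa> \<mu> z" unfolding lyapunov_exists_def using int l by auto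
  show "lyapunov_exists \<kappa> \<mu>t z"
    unfolding lyapunov_exists_def assms(6)
    using int_t integrable_distr_eq[OF F meas_t] lt[unfolded assms(6)] by auto
  show "lyapunov \<kappa> \<mu>t z = lyapunov \<kappa> \<mu> z"
    unfolding lyapunov_def using tendsto_Lim[OF _ l] tendsto_Lim[OF _ lt] by simp
qed

end
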